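(* Let $1\le p\le q\le+\infty$, $T>0$, $x_0\in\mathbb{R}^d$, $I=\{1,\dots,l_1\}$, $J=\{l_1+1,\dots,l_2\}$, let $U\subseteq L^m_q(0,T)$ be a nonempty closed convex set, let $g_i\colon\mathbb{R}^d\to\mathbb{R}$, $i\in I$, be convex and $g_k\colon\mathbb{R}^d\to\mathbb{R}$, $k\in J$, be affine, and let $\theta\colon\mathbb{R}^d\times\mathbb{R}^m\times[0,T]\to\mathbb{R}$, $\zeta\colon\mathbb{R}^d\to\mathbb{R}$, $f\colon\mathbb{R}^d\times\mathbb{R}^m\times[0,T]\to\mathbb{R}^d$. Consider $$\min\ \mathcal{I}(x,u)=\int_0^T\theta(x(t),u(t),t)\,dt+\zeta(x(T))\quad\text{subject to}\quad\dot x(t)=f(x(t),u(t),t),\ t\in[0,T],\ x(0)=x_0,$$ $$g_i(x(T))\le0\ \ \forall i\in I,\quad g_k(x(T))=0\ \ \forall k\in J,\quad u\in U\qquad(\ast)$$ over $(x,u)\in X=W^d_{1,p}(0,T)\times L^m_q(0,T)$. Let $A$ be the set of $(x,u)\in X$ with $x(0)=x_0$, $u\in U$, $\dot x(t)=f(x(t),u(t),t)$ for a.e. $t\in[0,T]$; put $\varphi(x,u)=\sum_{i\in I}\max\{g_i(x(T)),0\}+\sum_{k\in J}|g_k(x(T))|$ and $\Phi_\lambda=\mathcal{I}+\lambda\varphi$. Let $\mathcal{I}^*$ be the optimal value of $(\ast)$. Suppose that: 1. $f(x,u,t)=A(t)x+B(t)u$ for some $A(\cdot)\in L^{d\times d}_\infty(0,T)$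 and $B(\cdot)\in L^{d\times m}_\infty(0,T)$; 2. $\zeta$ is locally Lipschitz continuous, $\theta=\theta(x,u,t)$ is continuous, differentiable in $x$ and $u$, and $\nabla_x\theta$ and $\nabla_u\theta$ are continuous; 3. either $q=+\infty$, or $\theta$ and $\nabla_x\theta$ satisfy the growth condition of order $(q,1)$ while $\nabla_u\theta$ satisfies the growth condition of order $(q-1,q')$; 4. there exists a globally optimal solution of $(\ast)$, and the following Slater condition holds: $0\in\operatorname{relint}g_J(\mathcal{R}_I(x_0,T))$, and there exists a feasible point $(\widehat{x},\widehat{u})\in\Omega$ such that $g_i(\widehat{x}(T))<0$ for all $i\in I$; 5. there exist $\lambda_0>0$, $c>\mathcal{I}^*$ and $\delta>0$ such that $S_{\lambda_0}(c)\cap\Omega_\delta$ is bounded in $X$, and $\Phi_{\lambda_0}$ is bounded below on the set $A$. Then there exists $\lambda^*\ge0$ such that for any $\lambda\ge\lambda^*$ the penalty function $\Phi_\lambda$ for problem $(\ast)$ is completely exact on $S_\lambda(c)$.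
   Context: Spaces: $L^m_q(0,T)$ is the product of $m$ copies of $L^q(0,T)$ with norm $\|u\|_q=(\int_0^T|u(t)|^q\,dt)^{1/q}$ (ess sup of the Euclidean norm if $q=+\infty$). $W^d_{1,p}(0,T)$ is the space of absolutely continuous $x\colon[0,T]\to\mathbb{R}^d$ with $\dot x\in L^d_p(0,T)$, norm $\|x\|_{1,p}=\|x\|_p+\|\dot x\|_p$. $X$ carries the sum norm. $r'$ is the conjugate exponent of $r$. Growth condition: $g\colon\mathbb{R}^d\times\mathbb{R}^m\times[0,T]\to\mathbb{R}^k$ satisfies the growth condition of order $(l,s)$, $0\le l<+\infty$, $1\le s\le+\infty$, if for any $R>0$ there exist $C_R>0$ and an a.e. nonnegative $\omega_R\in L^s(0,T)$ with $|g(x,u,t)|\le C_R|u|^l+\omega_R(t)$ for a.e. $t\in[0,T]$ and all $(x,u)$ with $|x|\le R$. $g_J=(g_{l_1+1},\dots,g_{l_2})^T$; $\mathcal{R}(x_0,T)=\{x(T)\mid(x,u)\in A\}$; $\mathcal{R}_I(x_0,T)=\{\xi\in\mathcal{R}(x_0,T)\mid g_i(\xi)\le0,\ i\in I\}$. $\operatorname{relint}$ is the interior relative to the affine hull. The symbol $A$ (without argument) is a subset of $X$, $A(\cdot)$ is a matrix function. $\Omega=\{(x,u)\in A\mid\varphi(x,u)=0\}$ is the feasible set of $(\ast)$, $\Omega_\delta=\{(x,u)\in A\mid\varphi(x,u)<\delta\}$, $S_\lambda(c)=\{(x,u)\in A\mid\Phi_\lambda(x,u)<c\}$. For $K\subseteq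 X$, $f\colon X\to\mathbb{R}$ and $z\in K$, $f^{\downarrow}_K(z)=\liminf_{y\to z,\,y\in K}\frac{f(y)-f(z)}{\|y-z\|_X}$ ($+\infty$ if $z$ is isolated in $K$); $z$ is an inf-stationary point of $f$ on $K$ if $f^{\downarrow}_K(z)\ge0$. $\Phi_\lambda$ is completely exact on $S_\lambda(c)$ if: (1) the optimal values of $\min_\Omega\mathcal{I}$ and $\min_A\Phi_\lambda$ coincide; (2) their globally optimal solutions coincide; (3) $z\in S_\lambda(c)$ is a locally optimal solution of $\min_A\Phi_\lambda$ iff $z\in\Omega$ and $z$ is a locally optimal solution of $\min_\Omega\mathcal{I}$; (4) $z\in S_\lambda(c)$ is an inf-stationary point of $\Phi_\lambda$ on $A$ iff $z\in\Omega$ and $z$ is an inf-stationary point of $\mathcal{I}$ on $\Omega$. Local optimality is with respect to the norm of $X$. *)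

theory Defs
  imports "HOL-Analysis.Analysis" "HOL-Probability.Essential_Supremum"
begin

text \<open>
  Elements of the function spaces are represented by functions \<open>real \<Rightarrow> 'a\<close>, so the norms below
  are seminorms on representatives: \<open>u\<close> and \<open>v\<close> represent the same element of \<open>L\<^sup>q(0,T)\<close> iff
  \<open>Lp_norm q T (\<lambda>t. u t - v t) = 0\<close>, and values outside \<open>{0..T}\<close> are irrelevant.
  Exponents range over \<open>ennreal\<close>, with \<open>\<infinity>\<close> allowed.
\<close>

definition Lp_space :: "ennreal \<Rightarrow> real \<Rightarrow> (real \<Rightarrow> 'a::euclidean_space) set" where
  "Lp_space q T = {u. u \<in> borel_measurable (lebesgue_on {0..T}) \<and>
     (if q = \<infinity> then \<exists>C. AE t in lebesgue_on {0..T}. norm (u t) \<le> C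
      else integrable (lebesgue_on {0..T}) (\<lambda>t. norm (u t) powr enn2real q))}"

definition Lp_norm :: "ennreal \<Rightarrow> real \<Rightarrow> (real \<Rightarrow> 'a::euclidean_space) \<Rightarrow> real" where
  "Lp_norm q T u =
     (if q = \<infinity> then real_of_ereal (esssup (lebesgue_on {0..T}) (\<lambda>t. ereal (norm (u t))))
      else (LINT t|lebesgue_on {0..T}. norm (u t) powr enn2real q) powr (1 / enn2real q))"

text \<open>From \<open>1/r + 1/r' = 1\<close>; in \<open>ennreal\<close> this gives \<open>1' = \<infinity>\<close> and \<open>\<infinity>' = 1\<close>.\<close>

definition conj_exponent :: "ennreal \<Rightarrow> ennreal" where
  "conj_exponent r = inverse (1 - inverse r)"

text \<open>
  The family \<open>D\<close> ranges over finite families of nonoverlapping compact subintervals of \<open>{a..b}\<close>.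
\<close>

definition abs_continuous_on_interval :: "real \<Rightarrow> real \<Rightarrow> (real \<Rightarrow> 'a::real_normed_vector) \<Rightarrow> bool" where
  "abs_continuous_on_interval a b x \<longleftrightarrow>
     (\<forall>\<epsilon>>0. \<exists>\<delta>>0. \<forall>D. D division_of \<Union>D \<and> \<Union>D \<subseteq> {a..b} \<and> (\<Sum>k\<in>D. Sup k - Inf k) < \<delta> \<longrightarrow>
        (\<Sum>k\<in>D. norm (x (Sup k) - x (Inf k))) < \<epsilon>)"

definition deriv_on :: "real \<Rightarrow> (real \<Rightarrow> 'a::real_normed_vector) \<Rightarrow> real \<Rightarrow> 'a" where
  "deriv_on T x t = vector_derivative x (at t within {0..T})"

definition W1p_space :: "ennreal \<Rightarrow> real \<Rightarrow> (real \<Rightarrow> 'a::euclidean_space) set" where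
  "W1p_space p T = {x. abs_continuous_on_interval 0 T x \<and> deriv_on T x \<in> Lp_space p T}"

definition W1p_norm :: "ennreal \<Rightarrow> real \<Rightarrow> (real \<Rightarrow> 'a::euclidean_space) \<Rightarrow> real" where
  "W1p_norm p T x = Lp_norm p T x + Lp_norm p T (deriv_on T x)"

definition X_space :: "ennreal \<Rightarrow> ennreal \<Rightarrow> real \<Rightarrow>
    ((real \<Rightarrow> 'a::euclidean_space) \<times> (real \<Rightarrow> 'b::euclidean_space)) set" where
  "X_space p q T = W1p_space p T \<times> Lp_space q T"

definition X_norm :: "ennreal \<Rightarrow> ennreal \<Rightarrow> real \<Rightarrow>
    (real \<Rightarrow> 'a::euclidean_space) \<times> (real \<Rightarrow> 'b::euclidean_space) \<Rightarrow> real" where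
  "X_norm p q T z = W1p_norm p T (fst z) + Lp_norm q T (snd z)"

definition X_dist :: "ennreal \<Rightarrow> ennreal \<Rightarrow> real \<Rightarrow>
    (real \<Rightarrow> 'a::euclidean_space) \<times> (real \<Rightarrow> 'b::euclidean_space) \<Rightarrow>
    (real \<Rightarrow> 'a) \<times> (real \<Rightarrow> 'b) \<Rightarrow> real" where
  "X_dist p q T z y =
     X_norm p q T (\<lambda>t. fst z t - fst y t, \<lambda>t. snd z t - snd y t)"

text \<open>
  Closedness with respect to the seminorm makes \<open>U\<close> invariant under changes on null sets, i.e. a
  set of equivalence classes.
\<close>

definition Lp_closed :: "ennreal \<Rightarrow> real \<Rightarrow> (real \<Rightarrow> 'a::euclidean_space) set \<Rightarrow> bool" where
  "Lp_closed q T U \<longleftrightarrow>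
     (\<forall>u\<in>Lp_space q T. (\<forall>\<epsilon>>0. \<exists>v\<in>U. Lp_norm q T (\<lambda>t. u t - v t) < \<epsilon>) \<longrightarrow> u \<in> U)"

definition fun_convex :: "(real \<Rightarrow> 'a::real_vector) set \<Rightarrow> bool" where
  "fun_convex U \<longleftrightarrow> (\<forall>u\<in>U. \<forall>v\<in>U. \<forall>a\<ge>0. \<forall>b\<ge>0. a + b = 1 \<longrightarrow> (\<lambda>t. a *\<^sub>R u t + b *\<^sub>R v t) \<in> U)"

text \<open>The conditional implements \<open>\<bar>u\<bar>\<^sup>0 = 1\<close> at \<open>u = 0\<close>, since \<open>0 powr 0 = 0\<close>.\<close>

definition growth_condition :: "real \<Rightarrow> real \<Rightarrow> ennreal \<Rightarrow>
    ('a::real_normed_vector \<Rightarrow> 'b::real_normed_vector \<Rightarrow> real \<Rightarrow> 'c::real_normed_vector) \<Rightarrow> bool" where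
  "growth_condition T l s g \<longleftrightarrow>
     (\<forall>R>0. \<exists>C>0. \<exists>\<omega>\<in>Lp_space s T. (AE t in lebesgue_on {0..T}. (0::real) \<le> \<omega> t) \<and>
        (AE t in lebesgue_on {0..T}. \<forall>x u. norm x \<le> R \<longrightarrow>
           norm (g x u t) \<le> C * (if l = 0 then 1 else norm u powr l) + \<omega> t))"

text \<open>
  \<open>\<real>\<^sup>n\<close> is the topological space \<^term>\<open>Euclidean_space n\<close>, whose points are the sequences vanishing
  from index \<open>n\<close> on; \<open>n = 0\<close> is allowed. The predicate \<open>fun_affine\<close> is \<^const>\<open>affine\<close> transcribed to
  this carrier, as functions are not an instance of \<^class>\<open>real_vector\<close>.
\<close>

definition fun_affine :: "(nat \<Rightarrow> real) set \<Rightarrow> bool" where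
  "fun_affine S \<longleftrightarrow> (\<forall>x\<in>S. \<forall>y\<in>S. \<forall>a b. a + b = 1 \<longrightarrow> (\<lambda>i. a * x i + b * y i) \<in> S)"

definition relint :: "nat \<Rightarrow> (nat \<Rightarrow> real) set \<Rightarrow> (nat \<Rightarrow> real) set" where
  "relint n S = subtopology (Euclidean_space n) (fun_affine hull S) interior_of S"

definition vec_J :: "nat \<Rightarrow> nat \<Rightarrow> (nat \<Rightarrow> 'a \<Rightarrow> real) \<Rightarrow> 'a \<Rightarrow> nat \<Rightarrow> real" where
  "vec_J l1 l2 g \<xi> = (\<lambda>i. if i < l2 - l1 then g (l1 + 1 + i) \<xi> else 0)"

definition trajectories :: "ennreal \<Rightarrow> ennreal \<Rightarrow> real \<Rightarrow> 'a \<Rightarrow>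
    ('a::euclidean_space \<Rightarrow> 'b::euclidean_space \<Rightarrow> real \<Rightarrow> 'a) \<Rightarrow> (real \<Rightarrow> 'b) set \<Rightarrow>
    ((real \<Rightarrow> 'a) \<times> (real \<Rightarrow> 'b)) set" where
  "trajectories p q T x0 f U = {(x, u) \<in> X_space p q T. x 0 = x0 \<and> u \<in> U \<and>
     (AE t in lebesgue_on {0..T}. (x has_vector_derivative f (x t) (u t) t) (at t within {0..T}))}"

definition cost :: "real \<Rightarrow> ('a \<Rightarrow> 'b \<Rightarrow> real \<Rightarrow> real) \<Rightarrow> ('a \<Rightarrow> real) \<Rightarrow>
    (real \<Rightarrow> 'a) \<times> (real \<Rightarrow> 'b) \<Rightarrow> real" where
  "cost T \<theta> \<zeta> z = (LINT t|lebesgue_on {0..T}. \<theta> (fst z t) (snd z t) t) + \<zeta> (fst z T)"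

definition violation :: "real \<Rightarrow> nat \<Rightarrow> nat \<Rightarrow> (nat \<Rightarrow> 'a \<Rightarrow> real) \<Rightarrow>
    (real \<Rightarrow> 'a) \<times> (real \<Rightarrow> 'b) \<Rightarrow> real" where
  "violation T l1 l2 g z =
     (\<Sum>i\<in>{1..l1}. max (g i (fst z T)) 0) + (\<Sum>k\<in>{l1+1..l2}. \<bar>g k (fst z T)\<bar>)"

definition reachable :: "real \<Rightarrow> ((real \<Rightarrow> 'a) \<times> (real \<Rightarrow> 'b)) set \<Rightarrow> 'a set" where
  "reachable T A = (\<lambda>z. fst z T) ` A"

text \<open>
  The parameter \<open>d\<close> is a pseudometric. Points at distance \<open>0\<close> from \<open>z\<close> represent \<open>z\<close> itself and are
  excluded from the punctured neighbourhoods. If \<open>z\<close> is isolated in \<open>K\<close>, the filter is \<^term>\<open>bot\<close>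
  and the lower derivative is \<open>\<infinity>\<close>.
\<close>

definition punctured_nhds :: "('z \<Rightarrow> 'z \<Rightarrow> real) \<Rightarrow> 'z set \<Rightarrow> 'z \<Rightarrow> 'z filter" where
  "punctured_nhds d K z = (INF r\<in>{0<..}. principal {y \<in> K. 0 < d y z \<and> d y z < r})"

definition lower_deriv :: "('z \<Rightarrow> 'z \<Rightarrow> real) \<Rightarrow> 'z set \<Rightarrow> ('z \<Rightarrow> real) \<Rightarrow> 'z \<Rightarrow> ereal" where
  "lower_deriv d K F z = Liminf (punctured_nhds d K z) (\<lambda>y. ereal ((F y - F z) / d y z))"

definition inf_stationary :: "('z \<Rightarrow> 'z \<Rightarrow> real) \<Rightarrow> 'z set \<Rightarrow> ('z \<Rightarrow> real) \<Rightarrow> 'z \<Rightarrow> bool" where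
  "inf_stationary d K F z \<longleftrightarrow> z \<in> K \<and> 0 \<le> lower_deriv d K F z"

definition global_min_on :: "'z set \<Rightarrow> ('z \<Rightarrow> real) \<Rightarrow> 'z \<Rightarrow> bool" where
  "global_min_on K F z \<longleftrightarrow> z \<in> K \<and> (\<forall>y\<in>K. F z \<le> F y)"

definition local_min_on :: "('z \<Rightarrow> 'z \<Rightarrow> real) \<Rightarrow> 'z set \<Rightarrow> ('z \<Rightarrow> real) \<Rightarrow> 'z \<Rightarrow> bool" where
  "local_min_on d K F z \<longleftrightarrow> z \<in> K \<and> (\<exists>r>0. \<forall>y\<in>K. d y z < r \<longrightarrow> F z \<le> F y)"

definition optimal_value :: "'z set \<Rightarrow> ('z \<Rightarrow> real) \<Rightarrow> ereal" where
  "optimal_value K F = (INF z\<in>K. ereal (F z))"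

definition completely_exact :: "('z \<Rightarrow> 'z \<Rightarrow> real) \<Rightarrow> 'z set \<Rightarrow> 'z set \<Rightarrow>
    ('z \<Rightarrow> real) \<Rightarrow> ('z \<Rightarrow> real) \<Rightarrow> 'z set \<Rightarrow> bool" where
  "completely_exact d A \<Omega> F \<Phi> S \<longleftrightarrow>
     optimal_value \<Omega> F = optimal_value A \<Phi> \<and>
     {z. global_min_on \<Omega> F z} = {z. global_min_on A \<Phi> z} \<and>
     (\<forall>z\<in>S. local_min_on d A \<Phi> z \<longleftrightarrow> z \<in> \<Omega> \<and> local_min_on d \<Omega> F z) \<and>
     (\<forall>z\<in>S. inf_stationary d A \<Phi> z \<longleftrightarrow> z \<in> \<Omega> \<and> inf_stationary d \<Omega> F z)"

end

theory Submission
  imports Defs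
begin

text \<open>
  Since the system is linear and \<open>U\<close> is convex, the trajectories form a convex set on which the
  end point is an affine and Lipschitz function of \<open>(x, u)\<close>. The growth conditions and the crude
  form \<open>a b \<le> a\<^sup>q' + b\<^sup>q\<close> of Young's inequality make the cost Lipschitz, with some constant \<open>L\<close>, on
  bounded sets of trajectories. Slater's condition provides finitely many trajectories such that
  every \<open>z\<close> in a bounded set becomes feasible after a convex combination with them whose weights
  are proportional to \<open>\<phi> z\<close>; hence a feasible trajectory lies within \<open>K \<phi> z\<close> of \<open>z\<close>.

  For \<open>\<lambda> \<ge> L K + K\<close>, passing from \<open>z\<close> to this feasible trajectory raises the cost by at most
  \<open>L K \<phi> z\<close> but removes the penalty \<open>\<lambda> \<phi> z\<close>, which compares optimal values, minimisers and
  stationary points of the two problems; moving only part of the way shows that an infeasible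
  point is neither locally optimal nor stationary. The argument stays in a bounded set: as
  \<open>\<Phi> lam0\<close> is bounded below, \<open>\<phi> < \<delta>\<close> on \<open>S \<lambda> c\<close> once \<open>\<lambda>\<close> is large.
\<close>

section \<open>Lebesgue spaces on an interval\<close>

text \<open>Bounded sets of trajectories are not compact. The error bound survives because the
  constraints see a trajectory only through its end point in a finite-dimensional space, so the
  equality defects span a finite-dimensional space and finitely many correcting trajectories
  suffice. Strict inequalities say nothing about the equalities: there the relative interior
  supplies, for every trajectory, another one that satisfies the inequalities and whose defect is a
  negative multiple of the given one. The summand K beyond L K in the threshold makes the penalty
  function fall by K \<phi>(z) over a distance of at most K \<phi>(z), that is at unit rate, which
  rules out stationarity at infeasible points; at feasible points the same surplus absorbs the error
  made by replacing a trajectory with a feasible one. The Lipschitz end point rests on the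
  fundamental theorem of calculus for absolutely continuous functions, obtained from their
  definition by gauge integration. Elements are representatives, so distance 0 is not equality, and
  punctured neighbourhoods require separate arguments.\<close>

lemma AE_lebesgue_on_imp_negligible:
  assumes "AE t in lebesgue_on S. P t" "S \<in> sets lebesgue"
  shows "negligible {t \<in> S. \<not> P t}"
proof -
  have "AE t in lebesgue. t \<in> S \<longrightarrow> P t"
    using assms AE_restrict_space_iff[of S lebesgue P] by auto
  then obtain N where "{t. \<not> (t \<in> S \<longrightarrow> P t)} \<subseteq> N" "N \<in> null_sets lebesgue"
    by (auto simp: eventually_ae_filter)
  then show ?thesis
    by (auto simp: negligible_iff_null_sets[symmetric] intro: negligible_subset)
qed

text \<open>True because Lebesgue measure is complete.\<close>

lemma borel_measurable_lebesgue_on_AE_cong: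
  fixes f g :: "real \<Rightarrow> 'a::euclidean_space"
  assumes "f \<in> borel_measurable (lebesgue_on S)" "AE t in lebesgue_on S. f t = g t"
    "S \<in> sets lebesgue"
  shows "g \<in> borel_measurable (lebesgue_on S)"
proof -
  have "f measurable_on S"
    using assms by (simp add: measurable_on_iff_borel_measurable)
  then have "g measurable_on S"
    using AE_lebesgue_on_imp_negligible[OF assms(2,3)] by (rule measurable_on_spike) auto
  then show ?thesis
    using assms by (simp add: measurable_on_iff_borel_measurable)
qed

text \<open>An interval of positive length is not null. This turns an almost-everywhere inequality
  between constants, such as nonnegativity of an essential supremum, into an actual one.\<close>

lemma AE_lebesgue_on_const:
  assumes "AE t in lebesgue_on {0..T}. P" "0 < (T::real)"
  shows P
proof (rule ccontr)
  assume "\<not> P"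
  then have "negligible {0..T}"
    using AE_lebesgue_on_imp_negligible[OF assms(1)] by (simp add: atLeastAtMost_def atLeast_def atMost_def Int_def)
  then show False
    using assms(2) negligible_interval(1)[of 0 T] by simp
qed

lemma finite_measure_lebesgue_on_interval [simp]: "finite_measure (lebesgue_on {a..b::real})"
  by (rule finite_measure_lebesgue_on) simp

lemma integrable_const_interval [simp]: "integrable (lebesgue_on {a..b::real}) (\<lambda>_. c :: 'a::euclidean_space)"
  by (rule finite_measure.integrable_const) simp

lemma measure_lebesgue_on_interval [simp]: "0 \<le> T \<Longrightarrow> measure (lebesgue_on {0..T}) {0..T} = (T::real)"
  by (simp add: measure_restrict_space)

lemma LINT_const_interval: "0 \<le> T \<Longrightarrow> (LINT t|lebesgue_on {0..T}. c) = T * (c::real)"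
  by simp

text \<open>The left argument is the average of x/a and y/b with weights a/(a+b) and b/(a+b), so
  this is convexity of the r-th power; applied pointwise it yields Minkowski's inequality. The
  boundary cases x = 0 and y = 0 are settled by \<open>s powr r\<close> \<le> \<open>s\<close> on
  [0, 1].\<close>

lemma powr_convex_combination:
  fixes x y a b r :: real
  assumes "0 \<le> x" "0 \<le> y" "0 < a" "0 < b" "1 \<le> r"
  shows "((x + y) / (a + b)) powr r \<le> a / (a + b) * (x / a) powr r + b / (a + b) * (y / b) powr r"
proof -
  have shrink: "(s * z) powr r \<le> s * z powr r" if "0 \<le> s" "s \<le> 1" "0 \<le> z" for s z
  proof (cases "s = 0")
    case False
    then have "s powr r \<le> s powr 1"
      using that assms(5) by (intro powr_mono') auto
    with that False show ?thesis
      by (simp add: powr_mult mult_right_mono)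
  qed simp
  have comb: "(x + y) / (a + b) = (a / (a + b)) * (x / a) + (b / (a + b)) * (y / b)"
    using assms by (simp add: add_divide_distrib)
  consider "x = 0" | "y = 0" | "0 < x" "0 < y" using assms by linarith
  then show ?thesis
  proof cases
    case 1
    then show ?thesis using shrink[of "b / (a + b)" "y / b"] assms comb by simp
  next
    case 2
    then show ?thesis using shrink[of "a / (a + b)" "x / a"] assms comb by simp
  next
    case 3
    have "((1 - b / (a + b)) *\<^sub>R (x / a) + (b / (a + b)) *\<^sub>R (y / b)) powr r
        \<le> (1 - b / (a + b)) * (x / a) powr r + (b / (a + b)) * (y / b) powr r"
      using convex_onD[OF powr_convex[OF assms(5)], of "b / (a + b)" "x / a" "y / b"] 3 assms by simp
    moreover have "1 - b / (a + b) = a / (a + b)"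
      using assms by (simp add: field_simps)
    ultimately show ?thesis using comb by simp
  qed
qed

section \<open>Seminorms on Lebesgue spaces and Minkowski's inequality\<close>

lemma Lp_spaceD_measurable: "f \<in> Lp_space q T \<Longrightarrow> f \<in> borel_measurable (lebesgue_on {0..T})"
  by (simp add: Lp_space_def)

lemma enn2real_ge_1: "1 \<le> q \<Longrightarrow> q \<noteq> \<infinity> \<Longrightarrow> 1 \<le> enn2real q"
  by (cases q) auto

text \<open>\<open>real_of_ereal\<close> sends infinite values to 0, so \<open>Lp_norm\<close>
  carries information only once the essential supremum is known to be finite. Membership in the
  space bounds it above, and T > 0 bounds it below by 0.\<close>

lemma Lp_norm_infinity_nonneg_and_le_iff:
  fixes f :: "real \<Rightarrow> 'a::euclidean_space"
  assumes f: "f \<in> Lp_space \<infinity> T" and T: "0 < T"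
  shows "0 \<le> Lp_norm \<infinity> T f \<and> (Lp_norm \<infinity> T f \<le> a \<longleftrightarrow> (AE t in lebesgue_on {0..T}. norm (f t) \<le> a))"
proof -
  let ?M = "lebesgue_on {0..T}"
  let ?E = "esssup ?M (\<lambda>t. ereal (norm (f t)))"
  have m: "(\<lambda>t. ereal (norm (f t))) \<in> borel_measurable ?M"
    using Lp_spaceD_measurable[OF f] by measurable
  obtain C where C: "AE t in ?M. norm (f t) \<le> C"
    using f by (auto simp: Lp_space_def)
  have "?E \<le> ereal C"
    using C m by (intro esssup_I) auto
  moreover have "0 \<le> ?E"
  proof -
    have "AE t in ?M. (0::ereal) \<le> ?E"
      using esssup_AE[of "\<lambda>t. ereal (norm (f t))" ?M]
      by eventually_elim (auto intro: order_trans[rotated])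
    then show ?thesis using AE_lebesgue_on_const[OF _ T] by blast
  qed
  ultimately obtain e where e: "?E = ereal e" "0 \<le> e"
    by (cases ?E) auto
  have n: "Lp_norm \<infinity> T f = e"
    by (simp add: Lp_norm_def e)
  have "AE t in ?M. norm (f t) \<le> a" if "e \<le> a"
    using esssup_AE[of "\<lambda>t. ereal (norm (f t))" ?M] unfolding e
    by eventually_elim (use that in auto)
  moreover have "e \<le> a" if "AE t in ?M. norm (f t) \<le> a"
    using esssup_I[OF m, of "ereal a"] that e by auto
  ultimately show ?thesis using n e by auto
qed

lemma Lp_norm_nonneg:
  fixes f :: "real \<Rightarrow> 'a::euclidean_space"
  assumes "f \<in> Lp_space q T" "0 < T"
  shows "0 \<le> Lp_norm q T f"
  using assms Lp_norm_infinity_nonneg_and_le_iff[of f T] by (cases "q = \<infinity>") (auto simp: Lp_norm_def)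

lemma Lp_norm_infinity_le_iff:
  fixes f :: "real \<Rightarrow> 'a::euclidean_space"
  assumes "f \<in> Lp_space \<infinity> T" "0 < T"
  shows "Lp_norm \<infinity> T f \<le> a \<longleftrightarrow> (AE t in lebesgue_on {0..T}. norm (f t) \<le> a)"
  using Lp_norm_infinity_nonneg_and_le_iff[OF assms] by simp

lemma LINT_powr_scale:
  assumes "0 < a"
  shows "(LINT t|M. (norm (f t) / a) powr r) = (LINT t|M. norm (f t) powr r) / a powr r"
  using assms by (simp add: powr_divide)

text \<open>Describes the norm by its unit ball, in the manner of a Luxemburg norm: roots disappear,
  and triangle or Hoelder type estimates become integrals of pointwise inequalities. If the power is
  not integrable, both integrals are 0 and both inequalities hold.\<close>

lemma Lp_norm_finite_le_iff:
  fixes f :: "real \<Rightarrow> 'a::euclidean_space"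
  assumes "q \<noteq> \<infinity>" "1 \<le> q" "0 < a"
  shows "Lp_norm q T f \<le> a \<longleftrightarrow> (LINT t|lebesgue_on {0..T}. (norm (f t) / a) powr enn2real q) \<le> 1"
proof -
  let ?r = "enn2real q" and ?I = "LINT t|lebesgue_on {0..T}. norm (f t) powr enn2real q"
  have r: "1 \<le> ?r" using assms enn2real_ge_1 by auto
  have I: "0 \<le> ?I" by simp
  have "?I powr (1 / ?r) \<le> a \<longleftrightarrow> ?I \<le> a powr ?r"
  proof
    assume "?I powr (1 / ?r) \<le> a"
    then have "(?I powr (1 / ?r)) powr ?r \<le> a powr ?r"
      using r by (intro powr_mono2) auto
    then show "?I \<le> a powr ?r" using r I by (simp add: powr_powr)
  next
    assume "?I \<le> a powr ?r"
    then have "?I powr (1 / ?r) \<le> (a powr ?r) powr (1 / ?r)"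
      using r I by (intro powr_mono2) auto
    then show "?I powr (1 / ?r) \<le> a" using r assms by (simp add: powr_powr)
  qed
  then show ?thesis
    using assms unfolding LINT_powr_scale[OF assms(3)] by (simp add: Lp_norm_def)
qed


lemma Lp_space_finite_iff:
  "q \<noteq> \<infinity> \<Longrightarrow> f \<in> Lp_space q T \<longleftrightarrow> f \<in> borel_measurable (lebesgue_on {0..T}) \<and>
     integrable (lebesgue_on {0..T}) (\<lambda>t. norm (f t) powr enn2real q)"
  by (simp add: Lp_space_def)

lemma integrable_powr_scale:
  assumes "f \<in> Lp_space q T" "q \<noteq> \<infinity>" "0 < a"
  shows "integrable (lebesgue_on {0..T}) (\<lambda>t. (norm (f t) / a) powr enn2real q)"
  using assms by (simp add: powr_divide Lp_space_def)

text \<open>Dividing by a norm \<open>n\<close> fails for \<open>n = 0\<close>. Estimates are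
  therefore proved at every scale above \<open>n\<close>, and this lemma passes to the
  limit.\<close>

lemma le_mult_if_le_mult_greater:
  fixes c n X :: real
  assumes "0 \<le> c" "\<And>a. n < a \<Longrightarrow> X \<le> c * a"
  shows "X \<le> c * n"
proof (rule field_le_epsilon)
  fix e :: real assume "0 < e"
  then have "X \<le> c * (n + e / (c + 1))"
    using assms by (intro assms(2)) simp
  also have "\<dots> = c * n + e * (c / (c + 1))"
    by (simp add: algebra_simps)
  also have "e * (c / (c + 1)) \<le> e * 1"
    using \<open>0 < e\<close> assms(1) by (intro mult_left_mono) auto
  finally show "X \<le> c * n + e" by simp
qed

text \<open>If a and b exceed the norms of f and g, the integrals of the q-th powers of f/a and g/b
  are at most 1, and by convexity so is that of (f+g)/(a+b). Letting a and b decrease to the norms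
  gives the triangle inequality.\<close>

lemma Lp_space_add_and_norm_triangle:
  fixes f g :: "real \<Rightarrow> 'a::euclidean_space"
  assumes f: "f \<in> Lp_space q T" and g: "g \<in> Lp_space q T" and q: "1 \<le> q" and T: "0 < T"
  shows "(\<lambda>t. f t + g t) \<in> Lp_space q T \<and>
    Lp_norm q T (\<lambda>t. f t + g t) \<le> Lp_norm q T f + Lp_norm q T g"
proof -
  let ?M = "lebesgue_on {0..T}"
  have [measurable]: "f \<in> borel_measurable ?M" "g \<in> borel_measurable ?M"
    using f g by (auto simp: Lp_space_def)
  show ?thesis
  proof (cases "q = \<infinity>")
    case True
    have "AE t in ?M. norm (f t) \<le> Lp_norm q T f" "AE t in ?M. norm (g t) \<le> Lp_norm q T g"
      using Lp_norm_infinity_le_iff[of _ T] f g T True by auto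
    then have AE: "AE t in ?M. norm (f t + g t) \<le> Lp_norm q T f + Lp_norm q T g"
      by eventually_elim (auto intro: norm_triangle_le)
    then have "(\<lambda>t. f t + g t) \<in> Lp_space \<infinity> T"
      by (auto simp: Lp_space_def)
    with AE show ?thesis
      using Lp_norm_infinity_le_iff T True by blast
  next
    case False
    define r where "r = enn2real q"
    have r: "1 \<le> r" using enn2real_ge_1[OF q False] by (simp add: r_def)
    have bound: "(norm (f t + g t) / (a + b)) powr r
        \<le> a / (a + b) * (norm (f t) / a) powr r + b / (a + b) * (norm (g t) / b) powr r"
      if "0 < a" "0 < b" for a b t
    proof -
      have "(norm (f t + g t) / (a + b)) powr r \<le> ((norm (f t) + norm (g t)) / (a + b)) powr r"
        using that r by (intro powr_mono2 divide_right_mono norm_triangle_ineq) auto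
      also note powr_convex_combination[OF norm_ge_zero norm_ge_zero that r]
      finally show ?thesis .
    qed
    have int: "integrable ?M (\<lambda>t. (norm (h t) / a) powr r)" if "h \<in> Lp_space q T" "0 < a" for h :: "real \<Rightarrow> 'a" and a
      using integrable_powr_scale[OF that(1) False that(2)] by (simp add: r_def)
    have rhs: "integrable ?M (\<lambda>t. a / (a + b) * (norm (f t) / a) powr r + b / (a + b) * (norm (g t) / b) powr r)"
      if "0 < a" "0 < b" for a b
      using int[OF f that(1)] int[OF g that(2)] by simp
    have int_sum: "integrable ?M (\<lambda>t. (norm (f t + g t) / (a + b)) powr r)" if "0 < a" "0 < b" for a b
    proof (rule Bochner_Integration.integrable_bound[OF rhs[OF that]])
      show "AE t in ?M. norm ((norm (f t + g t) / (a + b)) powr r)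
         \<le> norm (a / (a + b) * (norm (f t) / a) powr r + b / (a + b) * (norm (g t) / b) powr r)"
        using bound[OF that] by (auto intro!: AE_I2 order_trans[OF bound[OF that]])
    qed measurable
    have mem: "(\<lambda>t. f t + g t) \<in> Lp_space q T"
    proof -
      \<comment> \<open>The scales a = b = 1 suffice for membership; the factor undoes the division
        by 1 + 1.\<close>
      have "integrable ?M (\<lambda>t. 2 powr r * (norm (f t + g t) / (1 + 1)) powr r)"
        using int_sum[of 1 1] by simp
      then show ?thesis
        unfolding Lp_space_finite_iff[OF False] by (simp add: powr_divide r_def)
    qed
    have le: "Lp_norm q T (\<lambda>t. f t + g t) \<le> a + b"
      if "Lp_norm q T f < a" "Lp_norm q T g < b" for a b
    proof -
      have ab: "0 < a" "0 < b"
        using that Lp_norm_nonneg[OF f T] Lp_norm_nonneg[OF g T] by auto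
      have le1: "(LINT t|?M. (norm (f t) / a) powr r) \<le> 1" "(LINT t|?M. (norm (g t) / b) powr r) \<le> 1"
        using that Lp_norm_finite_le_iff[OF False q ab(1), of T f] Lp_norm_finite_le_iff[OF False q ab(2), of T g]
        unfolding r_def by linarith+
      have "(LINT t|?M. (norm (f t + g t) / (a + b)) powr r)
          \<le> (LINT t|?M. a / (a + b) * (norm (f t) / a) powr r + b / (a + b) * (norm (g t) / b) powr r)"
        by (intro integral_mono int_sum rhs ab bound)
      also have "\<dots> = a / (a + b) * (LINT t|?M. (norm (f t) / a) powr r)
          + b / (a + b) * (LINT t|?M. (norm (g t) / b) powr r)"
        using int[OF f ab(1)] int[OF g ab(2)] by simp
      also have "\<dots> \<le> a / (a + b) * 1 + b / (a + b) * 1"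
        using le1 ab by (intro add_mono mult_left_mono) auto
      also have "\<dots> = 1" using ab by (simp add: add_divide_distrib[symmetric])
      finally show ?thesis
        using ab Lp_norm_finite_le_iff[OF False q, of "a + b" T "\<lambda>t. f t + g t"] by (simp add: r_def)
    qed
    have "Lp_norm q T (\<lambda>t. f t + g t) \<le> Lp_norm q T f + Lp_norm q T g"
    proof (rule field_le_epsilon)
      fix e :: real assume "0 < e"
      then show "Lp_norm q T (\<lambda>t. f t + g t) \<le> Lp_norm q T f + Lp_norm q T g + e"
        using le[of "Lp_norm q T f + e / 2" "Lp_norm q T g + e / 2"] by simp
    qed
    with mem show ?thesis by simp
  qed
qed

lemmas Lp_norm_triangle = Lp_space_add_and_norm_triangle[THEN conjunct2]

lemma Lp_space_scaleR:
  fixes f :: "real \<Rightarrow> 'a::euclidean_space"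
  assumes "f \<in> Lp_space q T"
  shows "(\<lambda>t. c *\<^sub>R f t) \<in> Lp_space q T"
proof (cases "q = \<infinity>")
  case True
  from assms obtain C where "AE t in lebesgue_on {0..T}. norm (f t) \<le> C"
    by (auto simp: Lp_space_def True)
  then have "AE t in lebesgue_on {0..T}. norm (c *\<^sub>R f t) \<le> \<bar>c\<bar> * C"
    by eventually_elim (auto intro: mult_left_mono)
  then show ?thesis using assms True by (auto simp: Lp_space_def)
next
  case False
  then show ?thesis using assms by (auto simp: Lp_space_def powr_mult)
qed

lemma Lp_norm_scaleR:
  fixes f :: "real \<Rightarrow> 'a::euclidean_space"
  assumes f: "f \<in> Lp_space q T" and q: "1 \<le> q" and T: "0 < T"
  shows "Lp_norm q T (\<lambda>t. c *\<^sub>R f t) = \<bar>c\<bar> * Lp_norm q T f"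
proof (cases "q = \<infinity>")
  case True
  have le: "Lp_norm \<infinity> T (\<lambda>t. c *\<^sub>R f t) \<le> \<bar>c\<bar> * Lp_norm \<infinity> T f"
    if "f \<in> Lp_space \<infinity> T" for c and f :: "real \<Rightarrow> 'a"
  proof -
    have "AE t in lebesgue_on {0..T}. norm (f t) \<le> Lp_norm \<infinity> T f"
      using Lp_norm_infinity_le_iff[OF that T] by auto
    then have "AE t in lebesgue_on {0..T}. norm (c *\<^sub>R f t) \<le> \<bar>c\<bar> * Lp_norm \<infinity> T f"
      by eventually_elim (auto intro: mult_left_mono)
    then show ?thesis
      using Lp_norm_infinity_le_iff[OF Lp_space_scaleR[OF that] T] by blast
  qed
  show ?thesis
  proof (cases "c = 0")
    case True
    then show ?thesis
      using le[of f 0] Lp_norm_nonneg[OF Lp_space_scaleR[OF f] T, of 0] f \<open>q = \<infinity>\<close> by auto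
  next
    case False
    \<comment> \<open>The reverse inequality is the one just proved, for the factor 1/c and the
      function c f.\<close>
    have "Lp_norm \<infinity> T (\<lambda>t. (1 / c) *\<^sub>R c *\<^sub>R f t) \<le> \<bar>1 / c\<bar> * Lp_norm \<infinity> T (\<lambda>t. c *\<^sub>R f t)"
      using Lp_space_scaleR[OF f] True by (intro le) auto
    then have "\<bar>c\<bar> * Lp_norm \<infinity> T f \<le> Lp_norm \<infinity> T (\<lambda>t. c *\<^sub>R f t)"
      using False by (simp add: field_simps)
    with le[of f c] f True show ?thesis by auto
  qed
next
  case False
  then show ?thesis
    using enn2real_ge_1[OF q False] by (simp add: Lp_norm_def powr_mult powr_powr)
qed

text \<open>Needed because the derivative of a linear combination is known only almost
  everywhere.\<close>

lemma Lp_AE_cong: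
  fixes f g :: "real \<Rightarrow> 'a::euclidean_space"
  assumes f: "f \<in> Lp_space q T" and eq: "AE t in lebesgue_on {0..T}. f t = g t"
  shows "g \<in> Lp_space q T \<and> Lp_norm q T g = Lp_norm q T f"
proof -
  let ?M = "lebesgue_on {0..T}"
  have [measurable]: "f \<in> borel_measurable ?M" using f by (simp add: Lp_space_def)
  have [measurable]: "g \<in> borel_measurable ?M"
    using borel_measurable_lebesgue_on_AE_cong[OF _ eq] by simp
  have "esssup ?M (\<lambda>t. ereal (norm (f t))) = esssup ?M (\<lambda>t. ereal (norm (g t)))"
    using eq by (intro esssup_AE_cong) auto
  moreover have "(LINT t|?M. norm (f t) powr enn2real q) = (LINT t|?M. norm (g t) powr enn2real q)"
    using eq by (intro integral_cong_AE) auto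
  moreover have "integrable ?M (\<lambda>t. norm (f t) powr enn2real q)
      \<longleftrightarrow> integrable ?M (\<lambda>t. norm (g t) powr enn2real q)"
    using eq by (intro integrable_cong_AE) auto
  moreover have "AE t in ?M. norm (g t) \<le> C" if "AE t in ?M. norm (f t) \<le> C" for C
    using that eq by eventually_elim auto
  ultimately show ?thesis
    using f by (cases "q = \<infinity>") (simp add: Lp_space_def Lp_norm_def; blast)+
qed

lemma Lp_space_bounded:
  fixes f :: "real \<Rightarrow> 'a::euclidean_space"
  assumes [measurable]: "f \<in> borel_measurable (lebesgue_on {0..T})"
    and C: "AE t in lebesgue_on {0..T}. norm (f t) \<le> C"
  shows "f \<in> Lp_space q T"
proof (cases "q = \<infinity>")
  case False
  have "integrable (lebesgue_on {0..T}) (\<lambda>t. norm (f t) powr enn2real q)"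
    by (rule Bochner_Integration.integrable_bound[OF integrable_const_interval[of 0 T "C powr enn2real q"]])
      (use C in \<open>auto elim!: eventually_mono intro!: powr_mono2\<close>)
  then show ?thesis using False by (simp add: Lp_space_def)
qed (use C in \<open>auto simp: Lp_space_def\<close>)

text \<open>The crude constant comes from \<open>s \<le> 1 + s\<^sup>q\<close> with \<open>s = \<bar>f\<bar> / a\<close> and \<open>a > \<parallel>f\<parallel>\<^sub>q\<close>.\<close>

lemma Lp_space_integrable_and_L1_le:
  fixes f :: "real \<Rightarrow> 'a::euclidean_space"
  assumes f: "f \<in> Lp_space q T" and q: "1 \<le> q" and T: "0 < T"
  shows "integrable (lebesgue_on {0..T}) f \<and>
    (LINT t|lebesgue_on {0..T}. norm (f t)) \<le> (T + 1) * Lp_norm q T f"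
proof -
  let ?M = "lebesgue_on {0..T}"
  have [measurable]: "f \<in> borel_measurable ?M" using f by (simp add: Lp_space_def)
  have *: "integrable ?M f \<and> (LINT t|?M. norm (f t)) \<le> (T + 1) * a" if a: "Lp_norm q T f < a" for a
  proof -
    have a0: "0 < a" using a Lp_norm_nonneg[OF f T] by auto
    \<comment> \<open>A common integrable majorant lets both kinds of exponent finish in the same
      way.\<close>
    obtain h where h: "integrable ?M h" "AE t in ?M. norm (f t) \<le> h t" "(LINT t|?M. h t) \<le> (T + 1) * a"
    proof (cases "q = \<infinity>")
      case True
      have "AE t in ?M. norm (f t) \<le> a"
        using a f Lp_norm_infinity_le_iff[of f T a] T True by auto
      moreover have "(LINT t|?M. a) \<le> (T + 1) * a"
        using T a0 by (subst LINT_const_interval) auto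
      ultimately show ?thesis
        using that[of "\<lambda>_. a"] by simp
    next
      case False
      let ?s = "\<lambda>t. (norm (f t) / a) powr enn2real q"
      have s: "integrable ?M ?s" by (rule integrable_powr_scale[OF f False a0])
      have r: "1 \<le> enn2real q" using enn2real_ge_1[OF q False] .
      have le: "y \<le> 1 + y powr enn2real q" if "0 \<le> y" for y
      proof (cases "y \<le> 1")
        case False
        then have "y powr 1 \<le> y powr enn2real q" using r by (intro powr_mono) auto
        with False show ?thesis by simp
      next
        case True
        have "0 \<le> y powr enn2real q" by simp
        with True show ?thesis by linarith
      qed
      have pt: "norm (f t) \<le> a * (1 + ?s t)" for t
        using mult_left_mono[OF le[of "norm (f t) / a"], of a] a0 by simp
      have "(LINT t|?M. a * (1 + ?s t)) = a * (T + (LINT t|?M. ?s t))"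
        using s T by (simp add: LINT_const_interval)
      also have "\<dots> \<le> a * (T + 1)"
        using Lp_norm_finite_le_iff[OF False q a0, of T f] a a0 by simp
      finally show ?thesis
        using s pt by (intro that[of "\<lambda>t. a * (1 + ?s t)"]) (auto simp: mult.commute)
    qed
    have f_int: "integrable ?M f"
      by (rule Bochner_Integration.integrable_bound[OF h(1)]) (use h(2) in \<open>auto elim: eventually_mono\<close>)
    then have "(LINT t|?M. norm (f t)) \<le> (LINT t|?M. h t)"
      using h by (intro integral_mono_AE) auto
    with f_int h(3) show ?thesis by linarith
  qed
  have "integrable ?M f" using *[of "Lp_norm q T f + 1"] by simp
  moreover have "(LINT t|?M. norm (f t)) \<le> (T + 1) * Lp_norm q T f"
    by (rule le_mult_if_le_mult_greater) (use * T in auto)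
  ultimately show ?thesis by blast
qed

lemmas Lp_space_integrable = Lp_space_integrable_and_L1_le[THEN conjunct1]
lemmas L1_le_Lp_norm = Lp_space_integrable_and_L1_le[THEN conjunct2]

section \<open>Absolutely continuous functions\<close>

lemma abs_continuous_on_interval_scaleR:
  assumes "abs_continuous_on_interval a b x"
  shows "abs_continuous_on_interval a b (\<lambda>t. c *\<^sub>R x t)"
  unfolding abs_continuous_on_interval_def
proof (intro allI impI)
  fix e :: real assume "0 < e"
  \<comment> \<open>Adding 1 to |c| covers c = 0.\<close>
  then have "0 < e / (\<bar>c\<bar> + 1)" by simp
  then obtain d where "0 < d" and d: "\<And>D. D division_of \<Union>D \<and> \<Union>D \<subseteq> {a..b} \<and> (\<Sum>k\<in>D. Sup k - Inf k) < d \<Longrightarrow>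
      (\<Sum>k\<in>D. norm (x (Sup k) - x (Inf k))) < e / (\<bar>c\<bar> + 1)"
    using assms unfolding abs_continuous_on_interval_def by blast
  have "(\<Sum>k\<in>D. norm (c *\<^sub>R x (Sup k) - c *\<^sub>R x (Inf k))) < e"
    if D: "D division_of \<Union>D \<and> \<Union>D \<subseteq> {a..b} \<and> (\<Sum>k\<in>D. Sup k - Inf k) < d" for D
  proof -
    let ?s = "\<Sum>k\<in>D. norm (x (Sup k) - x (Inf k))"
    have "(\<Sum>k\<in>D. norm (c *\<^sub>R x (Sup k) - c *\<^sub>R x (Inf k))) = \<bar>c\<bar> * ?s"
      by (simp add: scaleR_diff_right[symmetric] sum_distrib_left)
    also have "\<dots> \<le> (\<bar>c\<bar> + 1) * ?s"
      by (intro mult_right_mono sum_nonneg) auto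
    also have "\<dots> < e"
      using d[OF D] by (simp add: field_simps)
    finally show ?thesis .
  qed
  with \<open>0 < d\<close> show "\<exists>d>0. \<forall>D. D division_of \<Union>D \<and> \<Union>D \<subseteq> {a..b} \<and> (\<Sum>k\<in>D. Sup k - Inf k) < d \<longrightarrow>
      (\<Sum>k\<in>D. norm (c *\<^sub>R x (Sup k) - c *\<^sub>R x (Inf k))) < e"
    by blast
qed

lemma abs_continuous_on_interval_add:
  assumes "abs_continuous_on_interval a b x" "abs_continuous_on_interval a b y"
  shows "abs_continuous_on_interval a b (\<lambda>t. x t + y t)"
  unfolding abs_continuous_on_interval_def
proof (intro allI impI)
  fix e :: real assume "0 < e"
  then have "0 < e / 2" by simp
  obtain d1 where "0 < d1" and d1: "\<And>D. D division_of \<Union>D \<and> \<Union>D \<subseteq> {a..b} \<and> (\<Sum>k\<in>D. Sup k - Inf k) < d1 \<Longrightarrow>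
      (\<Sum>k\<in>D. norm (x (Sup k) - x (Inf k))) < e / 2"
    using assms(1) \<open>0 < e / 2\<close> unfolding abs_continuous_on_interval_def by blast
  obtain d2 where "0 < d2" and d2: "\<And>D. D division_of \<Union>D \<and> \<Union>D \<subseteq> {a..b} \<and> (\<Sum>k\<in>D. Sup k - Inf k) < d2 \<Longrightarrow>
      (\<Sum>k\<in>D. norm (y (Sup k) - y (Inf k))) < e / 2"
    using assms(2) \<open>0 < e / 2\<close> unfolding abs_continuous_on_interval_def by blast
  have "(\<Sum>k\<in>D. norm (x (Sup k) + y (Sup k) - (x (Inf k) + y (Inf k)))) < e"
    if D: "D division_of \<Union>D \<and> \<Union>D \<subseteq> {a..b} \<and> (\<Sum>k\<in>D. Sup k - Inf k) < min d1 d2" for D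
  proof -
    have "(\<Sum>k\<in>D. norm (x (Sup k) + y (Sup k) - (x (Inf k) + y (Inf k))))
        \<le> (\<Sum>k\<in>D. norm (x (Sup k) - x (Inf k)) + norm (y (Sup k) - y (Inf k)))"
      by (intro sum_mono) (metis add_diff_add norm_triangle_ineq)
    also have "\<dots> < e"
      using d1[of D] d2[of D] D by (simp add: sum.distrib)
    finally show ?thesis .
  qed
  with \<open>0 < d1\<close> \<open>0 < d2\<close> show "\<exists>d>0. \<forall>D. D division_of \<Union>D \<and> \<Union>D \<subseteq> {a..b} \<and> (\<Sum>k\<in>D. Sup k - Inf k) < d \<longrightarrow>
      (\<Sum>k\<in>D. norm (x (Sup k) + y (Sup k) - (x (Inf k) + y (Inf k)))) < e"
    by (intro exI[of _ "min d1 d2"]) auto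
qed

lemma abs_continuous_on_interval_subset:
  assumes "abs_continuous_on_interval a b x" "{c..d} \<subseteq> {a..b}"
  shows "abs_continuous_on_interval c d x"
  using assms unfolding abs_continuous_on_interval_def by (meson subset_trans)

lemma abs_continuous_on_interval_imp_continuous_on:
  assumes "abs_continuous_on_interval a b x"
  shows "continuous_on {a..b} x"
  unfolding continuous_on_iff
proof (intro ballI allI impI)
  fix s e :: real assume s: "s \<in> {a..b}" and "0 < e"
  then obtain d where "0 < d" and d: "\<And>D. D division_of \<Union>D \<and> \<Union>D \<subseteq> {a..b} \<and> (\<Sum>k\<in>D. Sup k - Inf k) < d \<Longrightarrow>
      (\<Sum>k\<in>D. norm (x (Sup k) - x (Inf k))) < e"
    using assms unfolding abs_continuous_on_interval_def by blast
  have *: "norm (x v - x u) < e" if "u \<in> {a..b}" "v \<in> {a..b}" "u \<le> v" "v - u < d" for u v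
  proof -
    \<comment> \<open>A division with a single member turns absolute continuity into uniform
      continuity.\<close>
    have "{{u..v}} division_of {u..v}"
      using division_of_self[of u v] that by simp
    then show ?thesis
      using d[of "{{u..v}}"] that by simp
  qed
  have "dist (x t) (x s) < e" if "t \<in> {a..b}" "dist t s < d" for t
    using *[of s t] *[of t s] s that by (cases "s \<le> t") (auto simp: dist_norm norm_minus_commute)
  with \<open>0 < d\<close> show "\<exists>d>0. \<forall>t\<in>{a..b}. dist t s < d \<longrightarrow> dist (x t) (x s) < e"
    by blast
qed

text \<open>The straddle lemma: because u \<le> t \<le> v, the errors of the linear approximation at
  the two ends add up to a multiple of v - u. Tagged intervals of the gauge integral have exactly
  this shape.\<close>

lemma has_vector_derivative_straddle:
  fixes x :: "real \<Rightarrow> 'a::real_normed_vector"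
  assumes "(x has_vector_derivative D) (at t within S)" "0 < e"
  obtains d where "0 < d" "\<And>u v. \<lbrakk>u \<in> S; v \<in> S; u \<le> t; t \<le> v; u \<in> ball t d; v \<in> ball t d\<rbrakk> \<Longrightarrow>
    norm ((v - u) *\<^sub>R D - (x v - x u)) \<le> e * (v - u)"
proof -
  obtain d where "0 < d" and d: "\<And>y. y \<in> S \<Longrightarrow> norm (y - t) < d \<Longrightarrow>
      norm (x y - x t - (y - t) *\<^sub>R D) \<le> e * norm (y - t)"
    using assms unfolding has_vector_derivative_def has_derivative_within_alt by blast
  show thesis
  proof (rule that[OF \<open>0 < d\<close>])
    fix u v assume uv: "u \<in> S" "v \<in> S" "u \<le> t" "t \<le> v" "u \<in> ball t d" "v \<in> ball t d"
    have "(v - u) *\<^sub>R D - (x v - x u) = (x u - x t - (u - t) *\<^sub>R D) - (x v - x t - (v - t) *\<^sub>R D)"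
      by (simp add: algebra_simps)
    also have "norm \<dots> \<le> norm (x u - x t - (u - t) *\<^sub>R D) + norm (x v - x t - (v - t) *\<^sub>R D)"
      by (rule norm_triangle_ineq4)
    also have "\<dots> \<le> e * norm (u - t) + e * norm (v - t)"
      using uv by (intro add_mono d) (auto simp: dist_real_def)
    also have "\<dots> = e * (v - u)"
      using uv by (simp add: algebra_simps)
    finally show "norm ((v - u) *\<^sub>R D - (x v - x u)) \<le> e * (v - u)" .
  qed
qed

text \<open>Tags in the exceptional null set are confined by the gauge to an open set of small measure,
  where absolute continuity controls the increments; at the other tags differentiability does.\<close>

lemma abs_continuous_on_interval_has_integral:
  fixes x :: "real \<Rightarrow> 'a::euclidean_space"
  assumes AC: "abs_continuous_on_interval a b x" and "a \<le> b"
    and N: "negligible N"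
    and deriv: "\<And>t. t \<in> {a..b} - N \<Longrightarrow> (x has_vector_derivative h t) (at t within {a..b})"
  shows "(h has_integral (x b - x a)) {a..b}"
proof -
  \<comment> \<open>With value 0 on \<open>N\<close>, tags in \<open>N\<close> contribute nothing to
    the Riemann sum, and only the increments of \<open>x\<close> remain to be controlled
    there.\<close>
  define h' where "h' t = (if t \<in> N then 0 else h t)" for t
  have "(h' has_integral (x b - x a)) {a..b}"
    unfolding has_integral_real
  proof (intro allI impI)
    fix e :: real assume "0 < e"
    \<comment> \<open>Summed over a division of [a, b] the straddle errors amount to at most \<eta>
      (b - a) < e / 2; adding 1 covers a = b.\<close>
    define \<eta> where "\<eta> = e / (2 * (b - a + 1))"
    have "0 < \<eta>" using \<open>0 < e\<close> \<open>a \<le> b\<close> by (simp add: \<eta>_def)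
    have "\<eta> * (b - a) < \<eta> * (b - a + 1)"
      using \<open>0 < \<eta>\<close> by (intro mult_strict_left_mono) auto
    also have "\<dots> = e / 2"
    proof -
      have "e / (2 * c) * c = e / 2" if "0 < c" for c :: real using that by simp
      with \<open>a \<le> b\<close> show ?thesis by (simp only: \<eta>_def)
    qed
    finally have \<eta>: "\<eta> * (b - a) < e / 2" .
    obtain \<delta> where "0 < \<delta>" and \<delta>: "\<And>D. D division_of \<Union>D \<and> \<Union>D \<subseteq> {a..b} \<and> (\<Sum>k\<in>D. Sup k - Inf k) < \<delta> \<Longrightarrow>
        (\<Sum>k\<in>D. norm (x (Sup k) - x (Inf k))) < e / 2"
      using AC \<open>0 < e\<close> unfolding abs_continuous_on_interval_def
      by (meson half_gt_zero)
    have N0: "N \<in> null_sets lebesgue" using N by (simp add: negligible_iff_null_sets)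
    obtain W where W: "open W" "N \<subseteq> W" "W - N \<in> lmeasurable" "emeasure lebesgue (W - N) < ennreal \<delta>"
      using sets_lebesgue_outer_open[OF negligible_imp_sets[OF N] \<open>0 < \<delta>\<close>] by blast
    have W_eq: "(W - N) \<union> N = W" using W(2) by auto
    have "W \<in> lmeasurable"
      using fmeasurable.Un[OF W(3) negligible_imp_measurable[OF N]] unfolding W_eq .
    moreover have "emeasure lebesgue W < ennreal \<delta>"
      using emeasure_Un_null_set[OF fmeasurableD[OF W(3)] N0] W(4) unfolding W_eq by simp
    ultimately have W\<delta>: "W \<in> lmeasurable" "measure lebesgue W < \<delta>"
      using \<open>0 < \<delta>\<close> by (auto simp: emeasure_eq_measure2 ennreal_less_iff)
    have "\<exists>d>0. \<forall>u v. u \<in> {a..b} \<longrightarrow> v \<in> {a..b} \<longrightarrow> u \<le> t \<longrightarrow> t \<le> v \<longrightarrow> u \<in> ball t d \<longrightarrow> v \<in> ball t d \<longrightarrow>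
        norm ((v - u) *\<^sub>R h t - (x v - x u)) \<le> \<eta> * (v - u)" if "t \<in> {a..b} - N" for t
      using has_vector_derivative_straddle[OF deriv[OF that] \<open>0 < \<eta>\<close>] by metis
    then obtain d where d: "\<And>t. t \<in> {a..b} - N \<Longrightarrow> 0 < d t"
      "\<And>t u v. \<lbrakk>t \<in> {a..b} - N; u \<in> {a..b}; v \<in> {a..b}; u \<le> t; t \<le> v; u \<in> ball t (d t); v \<in> ball t (d t)\<rbrakk> \<Longrightarrow>
        norm ((v - u) *\<^sub>R h t - (x v - x u)) \<le> \<eta> * (v - u)"
      by metis
    define \<gamma> where "\<gamma> t = (if t \<in> N then W else if t \<in> {a..b} then ball t (d t) else UNIV)" for t
    have "gauge \<gamma>"
      unfolding gauge_def \<gamma>_def using W d(1) by auto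
    moreover have "norm ((\<Sum>(t, k)\<in>D. Henstock_Kurzweil_Integration.content k *\<^sub>R h' t) - (x b - x a)) < e"
      if D: "D tagged_division_of {a..b}" and fine: "\<gamma> fine D" for D
    proof -
      have fin: "finite D" using D by (rule tagged_division_of_finite)
      define D1 where "D1 = {(t, k) \<in> D. t \<in> N}"
      have D1_sub: "D1 \<subseteq> D" by (auto simp: D1_def)
      let ?r = "\<lambda>(t, k). Henstock_Kurzweil_Integration.content k *\<^sub>R h' t - (x (Sup k) - x (Inf k))"
      have interval: "\<exists>u v. k = {u..v} \<and> u \<le> t \<and> t \<le> v \<and> {u..v} \<subseteq> {a..b} \<and> {u..v} \<subseteq> \<gamma> t" if mem: "(t, k) \<in> D" for t k
      proof -
        obtain u v where "k = {u..v}" using tagged_division_ofD(4)[OF D mem] by auto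
        moreover have "t \<in> k" "k \<subseteq> {a..b}" using tagged_division_ofD(2,3)[OF D mem] by auto
        moreover have "k \<subseteq> \<gamma> t" using fine mem by (auto simp: fine_def)
        ultimately show ?thesis by auto
      qed
      have ne: "k \<noteq> {}" if "(t, k) \<in> D" for t k
        using interval[OF that] by auto
      have D1: "D1 tagged_division_of \<Union>(snd ` D1)"
        using D D1_sub unfolding tagged_division_of_def[of D]
        by (intro tagged_partial_division_of_Union_self) (rule tagged_partial_division_subset, auto)
      \<comment> \<open>Passing from tagged pairs to their intervals requires a function that is 0
        on all degenerate boxes, including the empty one, where \<open>Sup\<close> and
        \<open>Inf\<close> carry no information. Only degenerate intervals can occur with two tags,
        so no increment is lost.\<close>
      define \<Delta> where "\<Delta> k = (if k = {} then 0 else norm (x (Sup k) - x (Inf k)))" for k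
      have "(\<Sum>(t, k)\<in>D. Henstock_Kurzweil_Integration.content k *\<^sub>R h' t) - (x b - x a) = (\<Sum>p\<in>D. ?r p)"
        using additive_tagged_division_1[OF \<open>a \<le> b\<close> D, of x]
        by (simp add: split_beta sum_subtractf)
      also have "\<dots> = (\<Sum>p\<in>D - D1. ?r p) + (\<Sum>p\<in>D1. ?r p)"
        by (rule sum.subset_diff[OF D1_sub fin])
      also have "norm \<dots> \<le> norm (\<Sum>p\<in>D - D1. ?r p) + norm (\<Sum>p\<in>D1. ?r p)"
        by (rule norm_triangle_ineq)
      also have "norm (\<Sum>p\<in>D - D1. ?r p) \<le> (\<Sum>(t, k)\<in>D - D1. \<eta> * Henstock_Kurzweil_Integration.content k)"
      proof (rule sum_norm_le)
        fix p assume "p \<in> D - D1"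
        then obtain t k where p: "p = (t, k)" "(t, k) \<in> D" "t \<notin> N" by (cases p) (auto simp: D1_def)
        obtain u v where k: "k = {u..v}" "u \<le> t" "t \<le> v" "{u..v} \<subseteq> {a..b}" "{u..v} \<subseteq> \<gamma> t"
          using interval[OF p(2)] by blast
        have t: "t \<in> {a..b} - N" using k p by auto
        moreover have "u \<in> {u..v}" "v \<in> {u..v}" using k by auto
        ultimately have "norm ((v - u) *\<^sub>R h t - (x v - x u)) \<le> \<eta> * (v - u)"
          using k p(3) by (intro d(2)) (auto simp: \<gamma>_def subset_iff)
        then show "norm (?r p) \<le> (case p of (t, k) \<Rightarrow> \<eta> * Henstock_Kurzweil_Integration.content k)"
          using k p by (simp add: h'_def)
      qed
      also have "\<dots> \<le> (\<Sum>(t, k)\<in>D. \<eta> * Henstock_Kurzweil_Integration.content k)"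
        using \<open>0 < \<eta>\<close> fin by (intro sum_mono2) auto
      also have "\<dots> = \<eta> * (b - a)"
        using additive_content_tagged_division[of D a b] D \<open>a \<le> b\<close>
        by (simp add: split_beta sum_distrib_left[symmetric])
      also have "norm (\<Sum>p\<in>D1. ?r p) \<le> (\<Sum>(t, k)\<in>D1. norm (x (Sup k) - x (Inf k)))"
        by (rule sum_norm_le) (auto simp: D1_def h'_def norm_minus_commute)
      also have "\<dots> = (\<Sum>(t, k)\<in>D1. \<Delta> k)"
        using ne by (intro sum.cong) (auto simp: \<Delta>_def D1_def)
      also have "\<dots> = (\<Sum>k\<in>snd ` D1. \<Delta> k)"
      proof (rule sum.over_tagged_division_lemma)
        show "D1 tagged_division_of \<Union>(snd ` D1)" by (rule D1)
        show "\<Delta> (cbox u v) = 0" if "box u v = {}" for u v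
          using that by (cases "u = v") (auto simp: \<Delta>_def)
      qed
      also have "\<dots> = (\<Sum>k\<in>snd ` D1. norm (x (Sup k) - x (Inf k)))"
        using ne by (intro sum.cong) (auto simp: \<Delta>_def D1_def)
      also have "\<dots> < e / 2"
      proof (rule \<delta>, intro conjI)
        show div: "snd ` D1 division_of \<Union>(snd ` D1)"
          by (rule division_of_tagged_division[OF D1])
        show "\<Union>(snd ` D1) \<subseteq> {a..b}"
        proof
          fix s assume "s \<in> \<Union>(snd ` D1)"
          then obtain t k where "(t, k) \<in> D" "s \<in> k" by (auto simp: D1_def)
          then show "s \<in> {a..b}" using interval[of t k] by auto
        qed
        have sub: "\<Union>(snd ` D1) \<subseteq> W"
        proof
          fix s assume "s \<in> \<Union>(snd ` D1)"
          then obtain t k where "(t, k) \<in> D" "t \<in> N" "s \<in> k" by (auto simp: D1_def)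
          then show "s \<in> W" using interval[of t k] by (auto simp: \<gamma>_def)
        qed
        \<comment> \<open>The intervals do not overlap and lie in \<open>W\<close>, so their total
          length is at most the measure of \<open>W\<close>.\<close>
        have "(\<Sum>k\<in>snd ` D1. Sup k - Inf k) = (\<Sum>k\<in>snd ` D1. measure lebesgue k)"
        proof (rule sum.cong)
          fix k assume "k \<in> snd ` D1"
          then obtain t where "(t, k) \<in> D" by (auto simp: D1_def)
          then obtain u v where "k = {u..v}" "u \<le> t" "t \<le> v" using interval[of t k] by auto
          then show "Sup k - Inf k = measure lebesgue k" by simp
        qed simp
        also have "\<dots> = measure lebesgue (\<Union>(snd ` D1))"
          by (rule content_division[OF div])
        also have "\<dots> \<le> measure lebesgue W"
          using sub W\<delta>(1) lmeasurable_division[OF div] by (intro measure_mono_fmeasurable) auto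
        finally show "(\<Sum>k\<in>snd ` D1. Sup k - Inf k) < \<delta>"
          using W\<delta>(2) by linarith
      qed
      finally show ?thesis using \<eta> by linarith
    qed
    ultimately show "\<exists>\<gamma>. gauge \<gamma> \<and> (\<forall>D. D tagged_division_of {a..b} \<and> \<gamma> fine D \<longrightarrow>
        norm ((\<Sum>(t, k)\<in>D. Henstock_Kurzweil_Integration.content k *\<^sub>R h' t) - (x b - x a)) < e)"
      by (intro exI[of _ \<gamma>] conjI allI impI) simp_all
  qed
  then show ?thesis
    by (rule has_integral_spike[OF N, rotated]) (auto simp: h'_def)
qed

section \<open>Trajectories\<close>

text \<open>By Lebesgue's theorem the second condition is automatic; it is carried along because
  trajectories provide it directly.\<close>

definition W1p_diff :: "ennreal \<Rightarrow> real \<Rightarrow> (real \<Rightarrow> 'a::euclidean_space) set" where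
  "W1p_diff p T = {x \<in> W1p_space p T.
     AE t in lebesgue_on {0..T}. (x has_vector_derivative deriv_on T x t) (at t within {0..T})}"

lemma deriv_on_eqI:
  fixes x :: "real \<Rightarrow> 'a::euclidean_space"
  assumes "(x has_vector_derivative D) (at t within {0..T})" "t \<in> {0..T}" "0 < T"
  shows "deriv_on T x t = D"
  unfolding deriv_on_def using assms by (intro vector_derivative_within_closed_interval) auto

lemma AE_lebesgue_on_mem: "S \<in> sets lebesgue \<Longrightarrow> AE t in lebesgue_on S. t \<in> S"
  using AE_space[of "lebesgue_on S"] by simp

lemma AE_deriv_on_eqI:
  fixes x :: "real \<Rightarrow> 'a::euclidean_space"
  assumes "AE t in lebesgue_on {0..T}. (x has_vector_derivative D t) (at t within {0..T})" "0 < T"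
  shows "AE t in lebesgue_on {0..T}. (x has_vector_derivative deriv_on T x t) (at t within {0..T}) \<and>
    deriv_on T x t = D t"
proof -
  have "AE t in lebesgue_on {0..T}. t \<in> {0..T}" by (rule AE_lebesgue_on_mem) simp
  with assms(1) show ?thesis
    by eventually_elim (use deriv_on_eqI[where x = x and T = T] assms(2) in auto)
qed

lemma W1p_diff_imp_Lp_space:
  assumes "x \<in> W1p_diff p T"
  shows "x \<in> Lp_space p T"
proof -
  have cont: "continuous_on {0..T} x"
    using assms by (auto simp: W1p_diff_def W1p_space_def intro: abs_continuous_on_interval_imp_continuous_on)
  then have "bounded (x ` {0..T})"
    by (intro compact_imp_bounded compact_continuous_image) auto
  then obtain C where "\<forall>t\<in>{0..T}. norm (x t) \<le> C"
    by (auto simp: bounded_iff)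
  then have "AE t in lebesgue_on {0..T}. norm (x t) \<le> C"
    using AE_lebesgue_on_mem[of "{0..T}"] by (auto elim: eventually_mono)
  moreover have "x \<in> borel_measurable (lebesgue_on {0..T})"
    using cont by (intro continuous_imp_measurable_on_sets_lebesgue) auto
  ultimately show ?thesis by (rule Lp_space_bounded[rotated])
qed

lemma Lp_lincomb:
  fixes u v :: "real \<Rightarrow> 'a::euclidean_space"
  assumes "u \<in> Lp_space q T" "v \<in> Lp_space q T" "1 \<le> q" "0 < T"
  shows "(\<lambda>t. a *\<^sub>R u t + b *\<^sub>R v t) \<in> Lp_space q T"
    and "Lp_norm q T (\<lambda>t. a *\<^sub>R u t + b *\<^sub>R v t) \<le> \<bar>a\<bar> * Lp_norm q T u + \<bar>b\<bar> * Lp_norm q T v"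
  using Lp_space_add_and_norm_triangle[OF Lp_space_scaleR[OF assms(1), of a] Lp_space_scaleR[OF assms(2), of b]]
    Lp_norm_scaleR[OF assms(1), of a] Lp_norm_scaleR[OF assms(2), of b] assms(3,4)
  by auto

text \<open>\<open>deriv_on\<close> is a choice term and is linear only where the derivatives exist.
  \<open>W1p_diff\<close> provides them almost everywhere, and membership and norm do not notice the
  exceptional null set.\<close>

lemma W1p_diff_lincomb:
  fixes x y :: "real \<Rightarrow> 'a::euclidean_space"
  assumes x: "x \<in> W1p_diff p T" and y: "y \<in> W1p_diff p T" and p: "1 \<le> p" and T: "0 < T"
  shows "(\<lambda>t. a *\<^sub>R x t + b *\<^sub>R y t) \<in> W1p_diff p T"
    and "W1p_norm p T (\<lambda>t. a *\<^sub>R x t + b *\<^sub>R y t) \<le> \<bar>a\<bar> * W1p_norm p T x + \<bar>b\<bar> * W1p_norm p T y"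
proof -
  let ?M = "lebesgue_on {0..T}"
  let ?z = "\<lambda>t. a *\<^sub>R x t + b *\<^sub>R y t"
  let ?D = "\<lambda>t. a *\<^sub>R deriv_on T x t + b *\<^sub>R deriv_on T y t"
  have Lp: "deriv_on T x \<in> Lp_space p T" "deriv_on T y \<in> Lp_space p T"
    using x y by (auto simp: W1p_diff_def W1p_space_def)
  have "AE t in ?M. (x has_vector_derivative deriv_on T x t) (at t within {0..T})"
    "AE t in ?M. (y has_vector_derivative deriv_on T y t) (at t within {0..T})"
    using x y by (auto simp: W1p_diff_def)
  then have "AE t in ?M. (?z has_vector_derivative ?D t) (at t within {0..T})"
    by eventually_elim (auto intro!: derivative_eq_intros)
  from AE_deriv_on_eqI[OF this T] have
    diff: "AE t in ?M. (?z has_vector_derivative deriv_on T ?z t) (at t within {0..T})" and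
    eq: "AE t in ?M. ?D t = deriv_on T ?z t"
    by (auto elim: eventually_mono)
  note D = Lp_lincomb[OF Lp p T, of a b]
  note z = Lp_AE_cong[OF D(1) eq]
  have AC: "abs_continuous_on_interval 0 T ?z"
    using x y by (auto simp: W1p_diff_def W1p_space_def
        intro!: abs_continuous_on_interval_add abs_continuous_on_interval_scaleR)
  show "?z \<in> W1p_diff p T"
    using AC diff z by (simp add: W1p_diff_def W1p_space_def)
  show "W1p_norm p T ?z \<le> \<bar>a\<bar> * W1p_norm p T x + \<bar>b\<bar> * W1p_norm p T y"
    using Lp_lincomb(2)[OF W1p_diff_imp_Lp_space[OF x] W1p_diff_imp_Lp_space[OF y] p T, of a b] D(2) z
    by (simp add: W1p_norm_def algebra_simps)
qed

lemma W1p_norm_nonneg: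
  assumes "x \<in> W1p_diff p T" "0 < T"
  shows "0 \<le> W1p_norm p T x"
  using assms Lp_norm_nonneg[OF W1p_diff_imp_Lp_space[OF assms(1)]] Lp_norm_nonneg[of "deriv_on T x" p T]
  by (simp add: W1p_norm_def W1p_diff_def W1p_space_def)

text \<open>A Sobolev embedding: the value at \<open>t\<close> is the integral of the derivative
  over [0, t], and on [0, T] the integral of the norm is at most T + 1 times the p-norm.\<close>

lemma norm_le_W1p_norm:
  fixes x :: "real \<Rightarrow> 'a::euclidean_space"
  assumes x: "x \<in> W1p_diff p T" and p: "1 \<le> p" and T: "0 < T" and x0: "x 0 = 0" and t: "t \<in> {0..T}"
  shows "norm (x t) \<le> (T + 1) * W1p_norm p T x"
proof -
  let ?h = "deriv_on T x"
  have AC: "abs_continuous_on_interval 0 t x"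
    using x t by (auto simp: W1p_diff_def W1p_space_def intro: abs_continuous_on_interval_subset)
  define N where "N = {t \<in> {0..T}. \<not> (x has_vector_derivative ?h t) (at t within {0..T})}"
  have "negligible N"
    unfolding N_def using x by (intro AE_lebesgue_on_imp_negligible) (auto simp: W1p_diff_def)
  moreover have "(x has_vector_derivative ?h s) (at s within {0..t})" if "s \<in> {0..t} - N" for s
    using that t unfolding N_def by (auto intro: has_vector_derivative_within_subset)
  ultimately have I: "(?h has_integral (x t - x 0)) {0..t}"
    using AC t by (intro abs_continuous_on_interval_has_integral) auto
  have h: "?h \<in> Lp_space p T" using x by (simp add: W1p_diff_def W1p_space_def)
  have int: "integrable (lebesgue_on {0..T}) (\<lambda>s. norm (?h s))"
    using Lp_space_integrable[OF h p T] by simp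
  then have nI: "(\<lambda>s. norm (?h s)) integrable_on {0..T}"
    by (intro integrable_on_lebesgue_on) auto
  then have nI': "(\<lambda>s. norm (?h s)) integrable_on {0..t}"
    using t by (intro integrable_on_subinterval[OF nI]) auto
  have "norm (x t) = norm (integral {0..t} ?h)"
    using integral_unique[OF I] x0 by simp
  also have "\<dots> \<le> integral {0..t} (\<lambda>s. norm (?h s))"
    using I nI' by (intro Henstock_Kurzweil_Integration.integral_norm_bound_integral) (auto simp: has_integral_iff)
  also have "\<dots> \<le> integral {0..T} (\<lambda>s. norm (?h s))"
    using nI nI' t by (intro integral_subset_le) auto
  also have "\<dots> = (LINT s|lebesgue_on {0..T}. norm (?h s))"
    using int by (intro lebesgue_integral_eq_integral[symmetric]) auto
  also have "\<dots> \<le> (T + 1) * Lp_norm p T ?h"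
    by (rule L1_le_Lp_norm[OF h p T])
  also have "\<dots> \<le> (T + 1) * W1p_norm p T x"
    using T Lp_norm_nonneg[OF W1p_diff_imp_Lp_space[OF x] T] by (simp add: W1p_norm_def)
  finally show ?thesis .
qed

section \<open>The product space and its pseudometric\<close>

definition X_diff :: "ennreal \<Rightarrow> ennreal \<Rightarrow> real \<Rightarrow>
    ((real \<Rightarrow> 'a::euclidean_space) \<times> (real \<Rightarrow> 'b::euclidean_space)) set" where
  "X_diff p q T = W1p_diff p T \<times> Lp_space q T"

text \<open>Coefficients (1, -1) give differences and (1 - s, s) convex combinations, so the
  triangle inequality, symmetry and convexity of \<open>X_dist\<close> all come from the one
  estimate in \<open>X_diff_lincomb\<close>.\<close>

definition lincomb :: "real \<Rightarrow> (real \<Rightarrow> 'a::real_vector) \<times> (real \<Rightarrow> 'b::real_vector) \<Rightarrow>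
    real \<Rightarrow> (real \<Rightarrow> 'a) \<times> (real \<Rightarrow> 'b) \<Rightarrow> (real \<Rightarrow> 'a) \<times> (real \<Rightarrow> 'b)" where
  "lincomb a z b y = (\<lambda>t. a *\<^sub>R fst z t + b *\<^sub>R fst y t, \<lambda>t. a *\<^sub>R snd z t + b *\<^sub>R snd y t)"

lemma fst_lincomb [simp]: "fst (lincomb a z b y) t = a *\<^sub>R fst z t + b *\<^sub>R fst y t"
  and snd_lincomb [simp]: "snd (lincomb a z b y) t = a *\<^sub>R snd z t + b *\<^sub>R snd y t"
  by (simp_all add: lincomb_def)

context
  fixes p q :: ennreal and T :: real
  assumes pqT: "1 \<le> p" "1 \<le> q" "0 < T"
begin

lemma X_diff_lincomb:
  assumes "z \<in> X_diff p q T" "y \<in> X_diff p q T"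
  shows "lincomb a z b y \<in> X_diff p q T"
    and "X_norm p q T (lincomb a z b y) \<le> \<bar>a\<bar> * X_norm p q T z + \<bar>b\<bar> * X_norm p q T y"
  using assms W1p_diff_lincomb[of "fst z" p T "fst y" a b] Lp_lincomb[of "snd z" q T "snd y" a b] pqT
  by (auto simp: X_diff_def lincomb_def X_norm_def algebra_simps)

lemma X_norm_nonneg: "z \<in> X_diff p q T \<Longrightarrow> 0 \<le> X_norm p q T z"
  using pqT by (auto simp: X_diff_def X_norm_def intro!: add_nonneg_nonneg Lp_norm_nonneg W1p_norm_nonneg)

lemma X_dist_eq: "X_dist p q T z y = X_norm p q T (lincomb 1 z (-1) y)"
  by (simp add: X_dist_def lincomb_def)

lemma X_dist_nonneg: "z \<in> X_diff p q T \<Longrightarrow> y \<in> X_diff p q T \<Longrightarrow> 0 \<le> X_dist p q T z y"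
  unfolding X_dist_eq by (intro X_norm_nonneg X_diff_lincomb)

lemma X_dist_le: "z \<in> X_diff p q T \<Longrightarrow> y \<in> X_diff p q T \<Longrightarrow>
    X_dist p q T z y \<le> X_norm p q T z + X_norm p q T y"
  unfolding X_dist_eq using X_diff_lincomb(2)[of z y 1 "-1"] by simp

lemma X_dist_self:
  assumes "z \<in> X_diff p q T"
  shows "X_dist p q T z z = 0"
proof -
  have "lincomb 1 z (-1) z = lincomb 0 z 0 z" by (simp add: lincomb_def)
  then show ?thesis
    using X_diff_lincomb(2)[OF assms assms, of 0 0] X_dist_nonneg[OF assms assms]
    by (simp add: X_dist_eq)
qed

lemma X_dist_triangle:
  assumes "z \<in> X_diff p q T" "y \<in> X_diff p q T" "w \<in> X_diff p q T"
  shows "X_dist p q T z w \<le> X_dist p q T z y + X_dist p q T y w"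
proof -
  have "lincomb 1 z (-1) w = lincomb 1 (lincomb 1 z (-1) y) 1 (lincomb 1 y (-1) w)"
    by (simp add: lincomb_def)
  then show ?thesis
    using X_diff_lincomb(2)[OF X_diff_lincomb(1)[OF assms(1,2), of 1 "-1"] X_diff_lincomb(1)[OF assms(2,3), of 1 "-1"], of 1 1]
    by (simp add: X_dist_eq)
qed

lemma X_dist_commute:
  assumes "z \<in> X_diff p q T" "y \<in> X_diff p q T"
  shows "X_dist p q T z y = X_dist p q T y z"
proof -
  have "X_dist p q T z y \<le> X_dist p q T y z" if "z \<in> X_diff p q T" "y \<in> X_diff p q T" 
    for z y :: "(real \<Rightarrow> 'x::euclidean_space) \<times> (real \<Rightarrow> 'y::euclidean_space)"
  proof -
    have "lincomb 1 z (-1) y = lincomb (-1) (lincomb 1 y (-1) z) 0 z"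
      by (simp add: lincomb_def)
    then show ?thesis
      using X_diff_lincomb(2)[OF X_diff_lincomb(1)[OF that(2,1), of 1 "-1"] that(1), of "-1" 0]
      by (simp add: X_dist_eq)
  qed
  from this[OF assms] this[OF assms(2,1)] show ?thesis by simp
qed

lemma X_dist_lincomb_le:
  assumes "z \<in> X_diff p q T" "y \<in> X_diff p q T" "w \<in> X_diff p q T" "0 \<le> s" "s \<le> 1"
  shows "X_dist p q T (lincomb (1 - s) z s y) w \<le> (1 - s) * X_dist p q T z w + s * X_dist p q T y w"
proof -
  have "lincomb 1 (lincomb (1 - s) z s y) (-1) w
      = lincomb (1 - s) (lincomb 1 z (-1) w) s (lincomb 1 y (-1) w)"
    by (simp add: lincomb_def algebra_simps)
  then show ?thesis
    using X_diff_lincomb(2)[OF X_diff_lincomb(1)[OF assms(1,3), of 1 "-1"] X_diff_lincomb(1)[OF assms(2,3), of 1 "-1"], of "1 - s" s] assms(4,5)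
    by (simp add: X_dist_eq)
qed

text \<open>With a common initial value the difference of the states starts at 0, so the embedding
  \<open>norm_le_W1p_norm\<close> applies to it.\<close>

lemma state_diff_le_X_dist:
  assumes "z \<in> X_diff p q T" "y \<in> X_diff p q T" "fst z 0 = fst y 0" "t \<in> {0..T}"
  shows "norm (fst z t - fst y t) \<le> (T + 1) * X_dist p q T z y"
proof -
  have "lincomb 1 z (-1) y \<in> X_diff p q T" using assms by (intro X_diff_lincomb)
  then have "fst (lincomb 1 z (-1) y) \<in> W1p_diff p T" "snd (lincomb 1 z (-1) y) \<in> Lp_space q T"
    by (auto simp: X_diff_def)
  then have "norm (fst (lincomb 1 z (-1) y) t) \<le> (T + 1) * W1p_norm p T (fst (lincomb 1 z (-1) y))"
    and "0 \<le> Lp_norm q T (snd (lincomb 1 z (-1) y))"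
    using assms pqT norm_le_W1p_norm[of "fst (lincomb 1 z (-1) y)" p T t]
      Lp_norm_nonneg[of "snd (lincomb 1 z (-1) y)" q T] by auto
  then show ?thesis
    using pqT by (simp add: X_dist_eq X_norm_def distrib_left add_increasing2)
qed

lemma control_diff_le_X_dist:
  assumes "z \<in> X_diff p q T" "y \<in> X_diff p q T"
  shows "Lp_norm q T (\<lambda>t. snd z t - snd y t) \<le> X_dist p q T z y"
proof -
  have "lincomb 1 z (-1) y \<in> X_diff p q T" using assms by (intro X_diff_lincomb)
  then have "fst (lincomb 1 z (-1) y) \<in> W1p_diff p T" by (auto simp: X_diff_def)
  then have "0 \<le> W1p_norm p T (fst (lincomb 1 z (-1) y))"
    using pqT by (intro W1p_norm_nonneg)
  then show ?thesis
    unfolding X_dist_eq X_norm_def by (simp add: lincomb_def)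
qed

lemma trajectories_subset_X_diff: "trajectories p q T x0 f U \<subseteq> X_diff p q T"
proof
  fix z assume z: "z \<in> trajectories p q T x0 f U"
  then have "AE t in lebesgue_on {0..T}. (fst z has_vector_derivative f (fst z t) (snd z t) t) (at t within {0..T})"
    by (auto simp: trajectories_def)
  from AE_deriv_on_eqI[OF this] pqT
  have "AE t in lebesgue_on {0..T}. (fst z has_vector_derivative deriv_on T (fst z) t) (at t within {0..T})"
    by (auto elim: eventually_mono)
  with z show "z \<in> X_diff p q T"
    by (auto simp: trajectories_def X_space_def X_diff_def W1p_diff_def)
qed

text \<open>The dynamics enter through compatibility with affine combinations of state and control;
  the differential equation is then preserved wherever both trajectories satisfy it.\<close>

lemma trajectories_lincomb:
  assumes z: "z \<in> trajectories p q T x0 f U" and y: "y \<in> trajectories p q T x0 f U"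
    and s: "0 \<le> s" "s \<le> 1" and U: "fun_convex U"
    and f: "\<And>x u x' u' t s. t \<in> {0..T} \<Longrightarrow>
      f ((1 - s) *\<^sub>R x + s *\<^sub>R x') ((1 - s) *\<^sub>R u + s *\<^sub>R u') t = (1 - s) *\<^sub>R f x u t + s *\<^sub>R f x' u' t"
  shows "lincomb (1 - s) z s y \<in> trajectories p q T x0 f U"
proof -
  have "lincomb (1 - s) z s y \<in> X_diff p q T"
    using z y trajectories_subset_X_diff by (intro X_diff_lincomb) auto
  then have X: "lincomb (1 - s) z s y \<in> X_space p q T"
    by (auto simp: X_diff_def X_space_def W1p_diff_def)
  have "(1 - s) *\<^sub>R x0 + s *\<^sub>R x0 = x0" by (simp add: algebra_simps)
  then have x0: "fst (lincomb (1 - s) z s y) 0 = x0"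
    using z y by (auto simp: trajectories_def)
  have u: "snd (lincomb (1 - s) z s y) \<in> U"
    using z y s U unfolding fun_convex_def lincomb_def trajectories_def by auto
  have "AE t in lebesgue_on {0..T}. (fst z has_vector_derivative f (fst z t) (snd z t) t) (at t within {0..T})"
    "AE t in lebesgue_on {0..T}. (fst y has_vector_derivative f (fst y t) (snd y t) t) (at t within {0..T})"
    "AE t in lebesgue_on {0..T}. t \<in> {0..T}"
    using z y AE_lebesgue_on_mem[of "{0..T}"] by (auto simp: trajectories_def)
  then have "AE t in lebesgue_on {0..T}. (fst (lincomb (1 - s) z s y) has_vector_derivative
      f (fst (lincomb (1 - s) z s y) t) (snd (lincomb (1 - s) z s y) t) t) (at t within {0..T})"
  proof eventually_elim
    case (elim t)
    then have "((\<lambda>t. (1 - s) *\<^sub>R fst z t + s *\<^sub>R fst y t) has_vector_derivative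
        (1 - s) *\<^sub>R f (fst z t) (snd z t) t + s *\<^sub>R f (fst y t) (snd y t) t) (at t within {0..T})"
      by (auto intro!: derivative_eq_intros)
    then show ?case using elim f by (simp add: lincomb_def)
  qed
  then show ?thesis
    using X x0 u by (auto simp: trajectories_def split_beta)
qed

end

section \<open>Exact penalties in convex pseudometric spaces\<close>

lemma eventually_punctured_nhds:
  "eventually P (punctured_nhds d K z) \<longleftrightarrow> (\<exists>r>0. \<forall>y\<in>K. 0 < d y z \<longrightarrow> d y z < r \<longrightarrow> P y)"
proof -
  have "eventually P (punctured_nhds d K z) \<longleftrightarrow>
      (\<exists>r\<in>{0<..}. eventually P (principal {y \<in> K. 0 < d y z \<and> d y z < r}))"
    unfolding punctured_nhds_def
  proof (rule eventually_INF_base)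
    fix r s :: real assume "r \<in> {0<..}" "s \<in> {0<..}"
    then show "\<exists>t\<in>{0<..}. principal {y \<in> K. 0 < d y z \<and> d y z < t}
        \<le> inf (principal {y \<in> K. 0 < d y z \<and> d y z < r}) (principal {y \<in> K. 0 < d y z \<and> d y z < s})"
      by (intro bexI[of _ "min r s"]) auto
  qed auto
  then show ?thesis by (auto simp: eventually_principal)
qed

text \<open>A form without quotients and lower limits, in which inequalities can be chained. At an
  isolated point the condition is vacuous, in agreement with the value \<infinity> of the lower
  derivative.\<close>

lemma inf_stationary_iff:
  "inf_stationary d K F z \<longleftrightarrow> z \<in> K \<and>
    (\<forall>\<epsilon>>0. \<exists>r>0. \<forall>y\<in>K. 0 < d y z \<longrightarrow> d y z < r \<longrightarrow> F z - \<epsilon> * d y z \<le> F y)"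
proof -
  have *: "0 \<le> lower_deriv d K F z \<longleftrightarrow>
      (\<forall>\<epsilon>>0. \<exists>r>0. \<forall>y\<in>K. 0 < d y z \<longrightarrow> d y z < r \<longrightarrow> - \<epsilon> < (F y - F z) / d y z)"
  proof -
    have "0 \<le> lower_deriv d K F z \<longleftrightarrow>
        (\<forall>\<alpha><0. \<exists>r>0. \<forall>y\<in>K. 0 < d y z \<longrightarrow> d y z < r \<longrightarrow> \<alpha> < ereal ((F y - F z) / d y z))"
      unfolding lower_deriv_def le_Liminf_iff eventually_punctured_nhds ..
    also have "\<dots> \<longleftrightarrow> (\<forall>\<epsilon>>0. \<exists>r>0. \<forall>y\<in>K. 0 < d y z \<longrightarrow> d y z < r \<longrightarrow> - \<epsilon> < (F y - F z) / d y z)"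
    proof safe
      fix \<epsilon> :: real assume "0 < \<epsilon>"
        and *: "\<forall>\<alpha><0. \<exists>r>0. \<forall>y\<in>K. 0 < d y z \<longrightarrow> d y z < r \<longrightarrow> \<alpha> < ereal ((F y - F z) / d y z)"
      show "\<exists>r>0. \<forall>y\<in>K. 0 < d y z \<longrightarrow> d y z < r \<longrightarrow> - \<epsilon> < (F y - F z) / d y z"
        using *[rule_format, of "ereal (- \<epsilon>)"] \<open>0 < \<epsilon>\<close> by simp
    next
      fix \<alpha> :: ereal assume "\<alpha> < 0"
        and *: "\<forall>\<epsilon>>0. \<exists>r>0. \<forall>y\<in>K. 0 < d y z \<longrightarrow> d y z < r \<longrightarrow> - \<epsilon> < (F y - F z) / d y z"
      show "\<exists>r>0. \<forall>y\<in>K. 0 < d y z \<longrightarrow> d y z < r \<longrightarrow> \<alpha> < ereal ((F y - F z) / d y z)"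
      proof (cases \<alpha>)
        case (real a)
        then show ?thesis using *[rule_format, of "- a"] \<open>\<alpha> < 0\<close> by simp
      qed (use \<open>\<alpha> < 0\<close> in \<open>auto intro!: exI[of _ 1]\<close>)
    qed
    finally show ?thesis .
  qed
  have "(\<forall>\<epsilon>>0. \<exists>r>0. \<forall>y\<in>K. 0 < d y z \<longrightarrow> d y z < r \<longrightarrow> - \<epsilon> < (F y - F z) / d y z) \<longleftrightarrow>
      (\<forall>\<epsilon>>0. \<exists>r>0. \<forall>y\<in>K. 0 < d y z \<longrightarrow> d y z < r \<longrightarrow> F z - \<epsilon> * d y z \<le> F y)"
  proof (intro iffI allI impI)
    fix \<epsilon> :: real
    assume "\<forall>\<epsilon>>0. \<exists>r>0. \<forall>y\<in>K. 0 < d y z \<longrightarrow> d y z < r \<longrightarrow> - \<epsilon> < (F y - F z) / d y z" "0 < \<epsilon>"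
    then obtain r where r: "0 < r" "\<forall>y\<in>K. 0 < d y z \<longrightarrow> d y z < r \<longrightarrow> - \<epsilon> < (F y - F z) / d y z"
      by blast
    show "\<exists>r>0. \<forall>y\<in>K. 0 < d y z \<longrightarrow> d y z < r \<longrightarrow> F z - \<epsilon> * d y z \<le> F y"
    proof (intro exI[of _ r] conjI ballI impI)
      fix y assume y: "y \<in> K" "0 < d y z" "d y z < r"
      then have "- \<epsilon> < (F y - F z) / d y z" using r by blast
      then show "F z - \<epsilon> * d y z \<le> F y" using y by (simp add: pos_less_divide_eq)
    qed (rule r)
  next
    fix \<epsilon> :: real
    assume *: "\<forall>\<epsilon>>0. \<exists>r>0. \<forall>y\<in>K. 0 < d y z \<longrightarrow> d y z < r \<longrightarrow> F z - \<epsilon> * d y z \<le> F y" and "0 < \<epsilon>"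
    \<comment> \<open>Halving \<epsilon> and using that the distance is positive recovers the strict
      inequality.\<close>
    from *[THEN spec, of "\<epsilon> / 2"] \<open>0 < \<epsilon>\<close> obtain r where r: "0 < r" "\<forall>y\<in>K. 0 < d y z \<longrightarrow> d y z < r \<longrightarrow> F z - \<epsilon> / 2 * d y z \<le> F y"
      by auto
    show "\<exists>r>0. \<forall>y\<in>K. 0 < d y z \<longrightarrow> d y z < r \<longrightarrow> - \<epsilon> < (F y - F z) / d y z"
    proof (intro exI[of _ r] conjI ballI impI)
      fix y assume y: "y \<in> K" "0 < d y z" "d y z < r"
      then have "F z - \<epsilon> / 2 * d y z \<le> F y" using r by blast
      moreover have "0 < \<epsilon> * d y z" using y \<open>0 < \<epsilon>\<close> by simp
      ultimately have "- \<epsilon> * d y z < F y - F z" by (simp add: field_simps)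
      then show "- \<epsilon> < (F y - F z) / d y z" using y by (simp add: pos_less_divide_eq)
    qed (rule r)
  qed
  with * show ?thesis unfolding inf_stationary_def by simp
qed

text \<open>Collects what the penalty argument uses of trajectories. Distance 0 between distinct
  points is allowed, as for two representatives of one element, and convexity enters as convexity of
  the distance to a fixed point along \<open>mix\<close>, where \<open>s\<close> is the weight of
  the second point.\<close>

locale convex_pseudometric =
  fixes A :: "'z set" and d :: "'z \<Rightarrow> 'z \<Rightarrow> real" and mix :: "real \<Rightarrow> 'z \<Rightarrow> 'z \<Rightarrow> 'z"
  assumes d_nonneg: "\<lbrakk>x \<in> A; y \<in> A\<rbrakk> \<Longrightarrow> 0 \<le> d x y"
    and d_self: "x \<in> A \<Longrightarrow> d x x = 0"
    and d_commute: "\<lbrakk>x \<in> A; y \<in> A\<rbrakk> \<Longrightarrow> d x y = d y x"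
    and d_triangle: "\<lbrakk>x \<in> A; y \<in> A; z \<in> A\<rbrakk> \<Longrightarrow> d x z \<le> d x y + d y z"
    and mix_mem: "\<lbrakk>x \<in> A; y \<in> A; 0 \<le> s; s \<le> 1\<rbrakk> \<Longrightarrow> mix s x y \<in> A"
    and d_mix: "\<lbrakk>x \<in> A; y \<in> A; z \<in> A; 0 \<le> s; s \<le> 1\<rbrakk> \<Longrightarrow> d (mix s x y) z \<le> (1 - s) * d x z + s * d y z"
begin

text \<open>For \<open>z\<close> infeasible, the segment from \<open>z\<close> to a feasible point at distance at most \<open>K \<phi>(z)\<close>
  is a direction of linear decrease of the penalty function; this excludes infeasible local
  minimisers and infeasible stationary points.\<close>

lemma completely_exactI:
  fixes F \<phi> :: "'z \<Rightarrow> real"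
  assumes \<phi>_nonneg: "\<And>z. z \<in> A \<Longrightarrow> 0 \<le> \<phi> z"
    and \<phi>_mix: "\<And>x y s. \<lbrakk>x \<in> A; y \<in> A; 0 \<le> s; s \<le> 1\<rbrakk> \<Longrightarrow> \<phi> (mix s x y) \<le> (1 - s) * \<phi> x + s * \<phi> y"
    and \<phi>_cont: "\<And>z \<epsilon>. \<lbrakk>z \<in> A; 0 < \<epsilon>\<rbrakk> \<Longrightarrow> \<exists>r>0. \<forall>y\<in>A. d y z < r \<longrightarrow> \<bar>\<phi> y - \<phi> z\<bar> < \<epsilon>"
    and z0: "z0 \<in> A"
    and bounded: "\<And>z. \<lbrakk>z \<in> A; F z + lam * \<phi> z < c\<rbrakk> \<Longrightarrow> d z z0 \<le> M"
    and R: "M + 1 \<le> R"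
    and error_bound: "\<And>z. \<lbrakk>z \<in> A; d z z0 \<le> M + 1\<rbrakk> \<Longrightarrow>
      \<exists>w\<in>A. \<phi> w = 0 \<and> d w z \<le> K * \<phi> z \<and> d w z0 \<le> R"
    and lipschitz: "\<And>x y. \<lbrakk>x \<in> A; y \<in> A; d x z0 \<le> R; d y z0 \<le> R\<rbrakk> \<Longrightarrow> \<bar>F x - F y\<bar> \<le> L * d x y"
    and "0 < K" "0 \<le> L" and lam: "L * K + K \<le> lam"
    and sol: "global_min_on {z \<in> A. \<phi> z = 0} F zs" and zs_c: "F zs < c"
  shows "completely_exact d A {z \<in> A. \<phi> z = 0} F (\<lambda>z. F z + lam * \<phi> z) {z \<in> A. F z + lam * \<phi> z < c}"
proof -
  define \<Omega> where "\<Omega> = {z \<in> A. \<phi> z = 0}"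
  define \<Phi> where "\<Phi> z = F z + lam * \<phi> z" for z
  \<comment> \<open>The term \<open>K * \<phi> z\<close> is the surplus of \<open>lam\<close> over
    \<open>L * K\<close>. It forces global minimisers to be feasible and later absorbs an error in
    the stationarity estimate.\<close>
  have proj: "\<exists>w\<in>\<Omega>. d w z \<le> K * \<phi> z \<and> F w \<le> \<Phi> z - K * \<phi> z \<and> d w z0 \<le> R"
    if z: "z \<in> A" "d z z0 \<le> M + 1" for z
  proof -
    obtain w where w: "w \<in> A" "\<phi> w = 0" "d w z \<le> K * \<phi> z" "d w z0 \<le> R"
      using error_bound[OF z] by blast
    have "F w - F z \<le> L * d w z"
      using lipschitz[OF w(1) z(1) w(4)] z R by linarith
    also have "\<dots> \<le> L * (K * \<phi> z)"
      using w \<open>0 \<le> L\<close> by (intro mult_left_mono)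
    also have "\<dots> \<le> (lam - K) * \<phi> z"
      using mult_right_mono[OF lam \<phi>_nonneg[OF z(1)]] by (simp add: algebra_simps)
    finally have "F w \<le> \<Phi> z - K * \<phi> z"
      by (simp add: \<Phi>_def algebra_simps)
    with w show ?thesis by (auto simp: \<Omega>_def)
  qed
  have \<Phi>_\<Omega>: "\<Phi> z = F z" "z \<in> A" if "z \<in> \<Omega>" for z
    using that by (auto simp: \<Omega>_def \<Phi>_def)
  have zs: "zs \<in> \<Omega>" and zs_min: "\<And>y. y \<in> \<Omega> \<Longrightarrow> F zs \<le> F y"
    using sol by (auto simp: global_min_on_def \<Omega>_def)
  have min_\<Phi>: "F zs + K * \<phi> z \<le> \<Phi> z" if "z \<in> A" "\<Phi> z < c" for z
  proof -
    have "d z z0 \<le> M + 1" using bounded[of z] that by (simp add: \<Phi>_def)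
    with proj[OF that(1)] obtain w where "w \<in> \<Omega>" "F w \<le> \<Phi> z - K * \<phi> z" by blast
    with zs_min[of w] show ?thesis by linarith
  qed
  have zs_\<Phi>: "F zs \<le> \<Phi> z" if "z \<in> A" for z
  proof (cases "\<Phi> z < c")
    case True
    have "0 \<le> K * \<phi> z" using \<phi>_nonneg[OF that] \<open>0 < K\<close> by simp
    with min_\<Phi>[OF that True] show ?thesis by linarith
  qed (use zs_c in simp)
  have opt_values: "optimal_value \<Omega> F = optimal_value A \<Phi>"
  proof -
    have "optimal_value \<Omega> F = F zs"
      unfolding optimal_value_def using zs zs_min by (intro antisym INF_lower INF_greatest) auto
    moreover have "optimal_value A \<Phi> = F zs"
      unfolding optimal_value_def
      using zs zs_\<Phi> \<Phi>_\<Omega>[OF zs] by (intro antisym INF_lower2[of zs] INF_greatest) auto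
    ultimately show ?thesis by simp
  qed
  have solutions: "global_min_on \<Omega> F z \<longleftrightarrow> global_min_on A \<Phi> z" for z
  proof
    assume z: "global_min_on \<Omega> F z"
    then have "F z \<le> F zs" using zs by (auto simp: global_min_on_def)
    with z zs_\<Phi> \<Phi>_\<Omega>[of z] show "global_min_on A \<Phi> z"
      unfolding global_min_on_def by force
  next
    assume z: "global_min_on A \<Phi> z"
    then have "z \<in> A" "\<Phi> z \<le> F zs"
      using \<Phi>_\<Omega>[OF zs] by (auto simp: global_min_on_def)
    moreover from this have "F zs + K * \<phi> z \<le> \<Phi> z" using zs_c by (intro min_\<Phi>) auto
    ultimately have "K * \<phi> z \<le> 0" by linarith
    with \<open>0 < K\<close> \<phi>_nonneg[OF \<open>z \<in> A\<close>] have "\<phi> z = 0" by (simp add: mult_le_0_iff)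
    with \<open>z \<in> A\<close> have "z \<in> \<Omega>" by (simp add: \<Omega>_def)
    with \<open>\<Phi> z \<le> F zs\<close> zs_min show "global_min_on \<Omega> F z"
      unfolding global_min_on_def using \<Phi>_\<Omega>[of z] by force
  qed
  \<comment> \<open>One \<open>w\<close> serves all \<open>s\<close>. The strict drop of
    \<open>\<phi>\<close> is recorded in order to show later that the moved point is not another
    representative of \<open>z\<close>.\<close>
  have descent: "\<exists>w\<in>A. \<forall>s. 0 < s \<longrightarrow> s \<le> 1 \<longrightarrow> mix s z w \<in> A \<and> \<phi> (mix s z w) < \<phi> z \<and>
      d (mix s z w) z \<le> s * (K * \<phi> z) \<and> \<Phi> (mix s z w) \<le> \<Phi> z - s * (K * \<phi> z)"
    if z: "z \<in> A" "\<Phi> z < c" "\<phi> z \<noteq> 0" for z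
  proof -
    have zM: "d z z0 \<le> M" using bounded[of z] z by (simp add: \<Phi>_def)
    obtain w where w: "w \<in> A" "\<phi> w = 0" "d w z \<le> K * \<phi> z" "d w z0 \<le> R"
      using error_bound[of z] z zM by auto
    have \<phi>z: "0 < \<phi> z" using \<phi>_nonneg[OF z(1)] z(3) by simp
    have "mix s z w \<in> A \<and> \<phi> (mix s z w) < \<phi> z \<and>
      d (mix s z w) z \<le> s * (K * \<phi> z) \<and> \<Phi> (mix s z w) \<le> \<Phi> z - s * (K * \<phi> z)"
      if s: "0 < s" "s \<le> 1" for s
    proof -
      let ?y = "mix s z w"
      have y: "?y \<in> A" using z w s by (intro mix_mem) auto
      have \<phi>y: "\<phi> ?y \<le> (1 - s) * \<phi> z"
        using \<phi>_mix[of z w s] z w s by simp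
      have "0 < s * \<phi> z" using s \<phi>z by simp
      with \<phi>y have "\<phi> ?y < \<phi> z" by (simp add: algebra_simps)
      have "d ?y z \<le> s * d w z"
        using d_mix[of z w z s] d_self[OF z(1)] z w s by simp
      also have "\<dots> \<le> s * (K * \<phi> z)" using w s by (intro mult_left_mono) auto
      finally have dy: "d ?y z \<le> s * (K * \<phi> z)" .
      have "d ?y z0 \<le> (1 - s) * d z z0 + s * d w z0"
        using d_mix[of z w z0 s] z w s z0 by simp
      also have "\<dots> \<le> (1 - s) * R + s * R"
        using s zM w R by (intro add_mono mult_left_mono) auto
      finally have "d ?y z0 \<le> R" by (simp add: algebra_simps)
      then have "F ?y - F z \<le> L * d ?y z"
        using lipschitz[OF y z(1)] zM R by linarith
      also have "\<dots> \<le> L * (s * (K * \<phi> z))"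
        using dy \<open>0 \<le> L\<close> by (intro mult_left_mono)
      finally have "\<Phi> ?y \<le> F z + L * (s * (K * \<phi> z)) + lam * \<phi> ?y"
        by (simp add: \<Phi>_def)
      also have "lam * \<phi> ?y \<le> lam * ((1 - s) * \<phi> z)"
      proof (rule mult_left_mono[OF \<phi>y])
        have "0 \<le> L * K + K" using \<open>0 \<le> L\<close> \<open>0 < K\<close> by simp
        with lam show "0 \<le> lam" by linarith
      qed
      also have "F z + L * (s * (K * \<phi> z)) + lam * ((1 - s) * \<phi> z) = \<Phi> z - (lam - L * K) * (s * \<phi> z)"
        by (simp add: \<Phi>_def algebra_simps)
      also have "\<dots> \<le> \<Phi> z - K * (s * \<phi> z)"
        using lam \<open>0 < s * \<phi> z\<close> by (intro diff_left_mono mult_right_mono) auto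
      finally have "\<Phi> ?y \<le> \<Phi> z - s * (K * \<phi> z)" by (simp add: algebra_simps)
      with y \<open>\<phi> ?y < \<phi> z\<close> dy show ?thesis by blast
    qed
    with w show ?thesis by blast
  qed
  have small: "\<exists>s. 0 < s \<and> s \<le> 1 \<and> s * b < r" if "0 < r" for b r :: real
  proof -
    let ?s = "min 1 (r / (2 * (\<bar>b\<bar> + 1)))"
    have "?s * b \<le> ?s * (\<bar>b\<bar> + 1)" using that by (intro mult_left_mono) auto
    also have "\<dots> \<le> r / (2 * (\<bar>b\<bar> + 1)) * (\<bar>b\<bar> + 1)" by (intro mult_right_mono) auto
    also have "\<dots> = r / 2" by (simp add: field_simps)
    finally show ?thesis using that by (intro exI[of _ ?s]) auto
  qed
  have near: "\<exists>r>0. \<forall>y\<in>A. d y z < r \<longrightarrow>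
      (\<exists>w\<in>\<Omega>. d w z < \<rho> \<and> d w z \<le> d y z + K * \<phi> y \<and> F w \<le> \<Phi> y - K * \<phi> y \<and> d w z0 \<le> R)"
    if z: "z \<in> \<Omega>" "\<Phi> z < c" and "0 < \<rho>" for z \<rho>
  proof -
    have zM: "d z z0 \<le> M" using bounded[of z] z by (simp add: \<Phi>_def \<Omega>_def)
    have zA: "z \<in> A" "\<phi> z = 0" using z by (auto simp: \<Omega>_def)
    obtain r1 where r1: "0 < r1" "\<And>y. y \<in> A \<Longrightarrow> d y z < r1 \<Longrightarrow> \<bar>\<phi> y - \<phi> z\<bar> < \<rho> / (2 * K)"
      using \<phi>_cont[OF zA(1), of "\<rho> / (2 * K)"] \<open>0 < \<rho>\<close> \<open>0 < K\<close> by auto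
    show ?thesis
    \<comment> \<open>The radius \<open>r1\<close> gives \<open>K * \<phi> y\<close> < \<rho> / 2,
      which together with \<rho> / 2 for \<open>d y z\<close> puts \<open>w\<close> within \<rho> of
      \<open>z\<close>; the 1 keeps \<open>y\<close> within M + 1 of \<open>z0\<close>, where the
      error bound applies.\<close>
    proof (intro exI[of _ "min r1 (min (\<rho> / 2) 1)"] conjI ballI impI)
      fix y assume y: "y \<in> A" "d y z < min r1 (min (\<rho> / 2) 1)"
      have "d y z0 \<le> M + 1"
        using d_triangle[OF y(1) zA(1) z0] y zM by linarith
      from proj[OF y(1) this] obtain w where w: "w \<in> \<Omega>" "d w y \<le> K * \<phi> y" "F w \<le> \<Phi> y - K * \<phi> y" "d w z0 \<le> R"
        by blast
      have "d w z \<le> d y z + K * \<phi> y"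
        using d_triangle[of w y z] \<Phi>_\<Omega>(2)[OF w(1)] y(1) zA(1) w(2) by simp
      moreover have "K * \<phi> y < \<rho> / 2"
      proof -
        have "\<phi> y < \<rho> / (2 * K)" using r1(2)[OF y(1)] y(2) zA(2) by simp
        with \<open>0 < K\<close> show ?thesis by (simp add: field_simps)
      qed
      ultimately show "\<exists>w\<in>\<Omega>. d w z < \<rho> \<and> d w z \<le> d y z + K * \<phi> y \<and> F w \<le> \<Phi> y - K * \<phi> y \<and> d w z0 \<le> R"
        using w y by (intro bexI[of _ w]) auto
    qed (use r1 \<open>0 < \<rho>\<close> in auto)
  qed
  have local_mins: "local_min_on d A \<Phi> z \<longleftrightarrow> z \<in> \<Omega> \<and> local_min_on d \<Omega> F z" if z: "z \<in> A" "\<Phi> z < c" for z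
  proof
    assume lm: "local_min_on d A \<Phi> z"
    then obtain r where r: "0 < r" "\<And>y. y \<in> A \<Longrightarrow> d y z < r \<Longrightarrow> \<Phi> z \<le> \<Phi> y"
      by (auto simp: local_min_on_def)
    have "\<phi> z = 0"
    proof (rule ccontr)
      assume "\<phi> z \<noteq> 0"
      with \<phi>_nonneg[OF z(1)] have \<phi>z: "0 < \<phi> z" by simp
      obtain s where s: "0 < s" "s \<le> 1" "s * (K * \<phi> z) < r" using small[OF r(1)] by blast
      obtain w where "mix s z w \<in> A" "d (mix s z w) z \<le> s * (K * \<phi> z)"
        "\<Phi> (mix s z w) \<le> \<Phi> z - s * (K * \<phi> z)"
        using descent[OF z \<open>\<phi> z \<noteq> 0\<close>] s by blast
      moreover from this have "\<Phi> z \<le> \<Phi> (mix s z w)" using s by (intro r) auto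
      moreover have "0 < s * (K * \<phi> z)" using s \<open>0 < K\<close> \<phi>z by simp
      ultimately show False by linarith
    qed
    with z have "z \<in> \<Omega>" by (simp add: \<Omega>_def)
    with r show "z \<in> \<Omega> \<and> local_min_on d \<Omega> F z"
      unfolding local_min_on_def using \<Phi>_\<Omega> by metis
  next
    assume "z \<in> \<Omega> \<and> local_min_on d \<Omega> F z"
    then obtain \<rho> where z\<Omega>: "z \<in> \<Omega>" and \<rho>: "0 < \<rho>" "\<And>y. y \<in> \<Omega> \<Longrightarrow> d y z < \<rho> \<Longrightarrow> F z \<le> F y"
      by (auto simp: local_min_on_def)
    obtain r where r: "0 < r" "\<And>y. y \<in> A \<Longrightarrow> d y z < r \<Longrightarrow>
      \<exists>w\<in>\<Omega>. d w z < \<rho> \<and> d w z \<le> d y z + K * \<phi> y \<and> F w \<le> \<Phi> y - K * \<phi> y \<and> d w z0 \<le> R"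
      using near[OF z\<Omega> z(2) \<rho>(1)] by blast
    have "\<Phi> z \<le> \<Phi> y" if y: "y \<in> A" "d y z < r" for y
    proof -
      obtain w where "w \<in> \<Omega>" "d w z < \<rho>" "F w \<le> \<Phi> y - K * \<phi> y" using r(2)[OF y] by blast
      moreover have "0 \<le> K * \<phi> y" using \<phi>_nonneg[OF y(1)] \<open>0 < K\<close> by simp
      ultimately show ?thesis using \<rho>(2)[of w] \<Phi>_\<Omega>(1)[OF z\<Omega>] by linarith
    qed
    with r(1) z(1) show "local_min_on d A \<Phi> z" by (auto simp: local_min_on_def)
  qed
  have stat_points: "inf_stationary d A \<Phi> z \<longleftrightarrow> z \<in> \<Omega> \<and> inf_stationary d \<Omega> F z"
    if z: "z \<in> A" "\<Phi> z < c" for z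
  proof
    assume st: "inf_stationary d A \<Phi> z"
    have "\<phi> z = 0"
    proof (rule ccontr)
      assume "\<phi> z \<noteq> 0"
      with \<phi>_nonneg[OF z(1)] have \<phi>z: "0 < \<phi> z" by simp
      \<comment> \<open>Along the descent segment the decrease is at least the distance travelled.
        Any tolerated slope below 1 contradicts this, and 1/2 is one.\<close>
      from st[unfolded inf_stationary_iff, THEN conjunct2, THEN spec, of "1 / 2"]
      obtain r where r: "0 < r"
        "\<And>y. y \<in> A \<Longrightarrow> 0 < d y z \<Longrightarrow> d y z < r \<Longrightarrow> \<Phi> z - (1 / 2) * d y z \<le> \<Phi> y"
        by (auto simp del: half_gt_zero_iff)
      obtain s where s: "0 < s" "s \<le> 1" "s * (K * \<phi> z) < r" using small[OF r(1)] by blast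
      obtain w where w: "mix s z w \<in> A" "\<phi> (mix s z w) < \<phi> z" "d (mix s z w) z \<le> s * (K * \<phi> z)"
        "\<Phi> (mix s z w) \<le> \<Phi> z - s * (K * \<phi> z)"
        using descent[OF z \<open>\<phi> z \<noteq> 0\<close>] s by blast
      \<comment> \<open>At distance 0 continuity would force equal values of \<open>\<phi>\<close>,
        but the descent lowers \<open>\<phi>\<close> strictly.\<close>
      have "0 < d (mix s z w) z"
      proof (rule ccontr)
        assume "\<not> 0 < d (mix s z w) z"
        with d_nonneg[OF w(1) z(1)] have "d (mix s z w) z = 0" by simp
        moreover obtain r' where "0 < r'" "\<forall>y\<in>A. d y z < r' \<longrightarrow> \<bar>\<phi> y - \<phi> z\<bar> < \<phi> z - \<phi> (mix s z w)"
          using \<phi>_cont[OF z(1), of "\<phi> z - \<phi> (mix s z w)"] w(2) by auto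
        ultimately show False using w(1) by fastforce
      qed
      then have "\<Phi> z - (1 / 2) * d (mix s z w) z \<le> \<Phi> (mix s z w)"
        using w s by (intro r) auto
      moreover have "0 < s * (K * \<phi> z)" using s \<open>0 < K\<close> \<phi>z by simp
      ultimately show False using w by linarith
    qed
    with z have "z \<in> \<Omega>" by (simp add: \<Omega>_def)
    with st show "z \<in> \<Omega> \<and> inf_stationary d \<Omega> F z"
      unfolding inf_stationary_iff using \<Phi>_\<Omega> by metis
  next
    assume "z \<in> \<Omega> \<and> inf_stationary d \<Omega> F z"
    then have z\<Omega>: "z \<in> \<Omega>" and st: "inf_stationary d \<Omega> F z" by auto
    have zA: "z \<in> A" using z by simp
    have zR: "d z z0 \<le> R" using bounded[of z] z R by (simp add: \<Phi>_def)
    show "inf_stationary d A \<Phi> z"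
      unfolding inf_stationary_iff
    proof (intro conjI allI impI zA)
      fix \<epsilon>0 :: real assume "0 < \<epsilon>0"
      \<comment> \<open>Stationarity is used at \<open>w\<close> instead of \<open>y\<close>, which
        costs up to \<open>\<epsilon> * (K * \<phi> y)\<close>. With \<epsilon> capped at 1 the
        surplus \<open>K * \<phi> y\<close> pays for it.\<close>
      define \<epsilon> where "\<epsilon> = min \<epsilon>0 1"
      have \<epsilon>: "0 < \<epsilon>" "\<epsilon> \<le> 1" "\<epsilon> \<le> \<epsilon>0" using \<open>0 < \<epsilon>0\<close> by (auto simp: \<epsilon>_def)
      obtain \<rho> where \<rho>: "0 < \<rho>"
        "\<And>y. y \<in> \<Omega> \<Longrightarrow> 0 < d y z \<Longrightarrow> d y z < \<rho> \<Longrightarrow> F z - \<epsilon> * d y z \<le> F y"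
        using st \<epsilon>(1) unfolding inf_stationary_iff by blast
      obtain r where r: "0 < r" "\<And>y. y \<in> A \<Longrightarrow> d y z < r \<Longrightarrow>
        \<exists>w\<in>\<Omega>. d w z < \<rho> \<and> d w z \<le> d y z + K * \<phi> y \<and> F w \<le> \<Phi> y - K * \<phi> y \<and> d w z0 \<le> R"
        using near[OF z\<Omega> z(2) \<rho>(1)] by blast
      show "\<exists>r>0. \<forall>y\<in>A. 0 < d y z \<longrightarrow> d y z < r \<longrightarrow> \<Phi> z - \<epsilon>0 * d y z \<le> \<Phi> y"
      proof (intro exI[of _ r] conjI ballI impI r(1))
        fix y assume y: "y \<in> A" "0 < d y z" "d y z < r"
        obtain w where w: "w \<in> \<Omega>" "d w z < \<rho>" "d w z \<le> d y z + K * \<phi> y" "F w \<le> \<Phi> y - K * \<phi> y" "d w z0 \<le> R"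
          using r(2)[OF y(1,3)] by blast
        have wA: "w \<in> A" using w(1) by (simp add: \<Omega>_def)
        have "F z - \<epsilon> * d w z \<le> F w"
        \<comment> \<open>Stationarity is silent at distance 0, where the Lipschitz bound shows that
          the costs agree.\<close>
        proof (cases "0 < d w z")
          case False
          with d_nonneg[OF wA zA] have "d w z = 0" by simp
          then show ?thesis using lipschitz[OF wA zA w(5) zR] by simp
        qed (use \<rho>(2)[OF w(1)] w(2) in auto)
        moreover have "\<epsilon> * d w z \<le> \<epsilon> * (d y z + K * \<phi> y)"
          using w(3) \<epsilon> by (intro mult_left_mono) auto
        moreover have "\<epsilon> * (K * \<phi> y) \<le> 1 * (K * \<phi> y)"
          using \<epsilon> \<open>0 < K\<close> \<phi>_nonneg[OF y(1)] by (intro mult_right_mono) auto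
        moreover have "\<epsilon> * d y z \<le> \<epsilon>0 * d y z"
          using \<epsilon> y by (intro mult_right_mono) auto
        ultimately show "\<Phi> z - \<epsilon>0 * d y z \<le> \<Phi> y"
          using w(4) \<Phi>_\<Omega>(1)[OF z\<Omega>] by (simp add: distrib_left)
      qed
    qed
  qed
  have "completely_exact d A \<Omega> F \<Phi> {z \<in> A. \<Phi> z < c}"
    unfolding completely_exact_def using opt_values solutions local_mins stat_points by auto
  then show ?thesis
    unfolding \<Omega>_def \<Phi>_def .
qed

end

section \<open>The error bound under the Slater condition\<close>

context convex_pseudometric
begin

text \<open>The point is the average of \<open>z\<close> with weight 1 and the \<open>w j\<close>
  with weights \<open>t j\<close>, built by repeated mixing; both estimates are Jensen's inequality
  multiplied by the total weight. Quantifying over \<open>G\<close> inside the existential lets one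
  point serve all constraints.\<close>

lemma weighted_combination_exists:
  fixes e :: "'z \<Rightarrow> 'a::real_vector" and w :: "'j \<Rightarrow> 'z" and t :: "'j \<Rightarrow> real"
  assumes e_mix: "\<And>x y s. \<lbrakk>x \<in> A; y \<in> A; 0 \<le> s; s \<le> 1\<rbrakk> \<Longrightarrow> e (mix s x y) = (1 - s) *\<^sub>R e x + s *\<^sub>R e y"
    and z: "z \<in> A" and "finite J" and "\<And>j. j \<in> J \<Longrightarrow> w j \<in> A" and "\<And>j. j \<in> J \<Longrightarrow> 0 \<le> t j"
  shows "\<exists>z'\<in>A. (\<forall>y\<in>A. (1 + sum t J) * d z' y \<le> d z y + (\<Sum>j\<in>J. t j * d (w j) y)) \<and>
    (\<forall>G. convex_on UNIV G \<longrightarrow> (1 + sum t J) * G (e z') \<le> G (e z) + (\<Sum>j\<in>J. t j * G (e (w j))))"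
  using assms(3-)
proof (induction J rule: finite_induct)
  case empty
  then show ?case using z by auto
next
  case (insert j J)
  then obtain z' where z': "z' \<in> A"
    and dz': "\<And>y. y \<in> A \<Longrightarrow> (1 + sum t J) * d z' y \<le> d z y + (\<Sum>j\<in>J. t j * d (w j) y)"
    and Gz': "\<And>G. convex_on UNIV G \<Longrightarrow> (1 + sum t J) * G (e z') \<le> G (e z) + (\<Sum>j\<in>J. t j * G (e (w j)))"
    by auto
  have tau: "0 \<le> sum t J" using insert by (intro sum_nonneg) auto
  have tj: "0 \<le> t j" and wj: "w j \<in> A" using insert by auto
  define \<tau> where "\<tau> = 1 + sum t J + t j"
  have \<tau>: "0 < \<tau>" using tau tj by (simp add: \<tau>_def)
  \<comment> \<open>The share of the new point in the total weight \<tau>; the previous combination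
    keeps its weight \<open>1 + sum t J\<close>.\<close>
  define s where "s = t j / \<tau>"
  have s: "0 \<le> s" "s \<le> 1" using tau tj \<tau> by (auto simp: s_def \<tau>_def)
  have \<tau>s: "\<tau> * s = t j" "\<tau> * (1 - s) = 1 + sum t J"
    using \<tau> by (auto simp: s_def right_diff_distrib) (simp add: \<tau>_def)
  have sums: "1 + sum t (insert j J) = \<tau>"
    "(\<Sum>j\<in>insert j J. t j * h j) = t j * h j + (\<Sum>j\<in>J. t j * h j)" for h
    using insert by (auto simp: \<tau>_def)
  show ?case
  proof (intro bexI[of _ "mix s z' (w j)"] conjI ballI allI impI)
    show "mix s z' (w j) \<in> A" using z' wj s by (rule mix_mem)
    fix y assume y: "y \<in> A"
    have "\<tau> * d (mix s z' (w j)) y \<le> \<tau> * ((1 - s) * d z' y + s * d (w j) y)"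
      using d_mix[OF z' wj y s] \<tau> by (intro mult_left_mono) auto
    also have "\<dots> = (\<tau> * (1 - s)) * d z' y + (\<tau> * s) * d (w j) y"
      by (simp only: distrib_left mult.assoc)
    also have "\<dots> = (1 + sum t J) * d z' y + t j * d (w j) y"
      by (simp only: \<tau>s)
    finally show "(1 + sum t (insert j J)) * d (mix s z' (w j)) y \<le> d z y + (\<Sum>j\<in>insert j J. t j * d (w j) y)"
      using dz'[OF y] unfolding sums by linarith
  next
    fix G :: "'a \<Rightarrow> real" assume G: "convex_on UNIV G"
    have "G (e (mix s z' (w j))) \<le> (1 - s) * G (e z') + s * G (e (w j))"
      using convex_onD[OF G s, of "e z'" "e (w j)"] e_mix[OF z' wj s] by simp
    then have "\<tau> * G (e (mix s z' (w j))) \<le> \<tau> * ((1 - s) * G (e z') + s * G (e (w j)))"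
      using \<tau> by (intro mult_left_mono) auto
    also have "\<dots> = (\<tau> * (1 - s)) * G (e z') + (\<tau> * s) * G (e (w j))"
      by (simp only: distrib_left mult.assoc)
    also have "\<dots> = (1 + sum t J) * G (e z') + t j * G (e (w j))"
      by (simp only: \<tau>s)
    finally show "(1 + sum t (insert j J)) * G (e (mix s z' (w j))) \<le> G (e z) + (\<Sum>j\<in>insert j J. t j * G (e (w j)))"
      using Gz'[OF G] unfolding sums by linarith
  qed
qed

text \<open>The equality constraints are encoded by the single vector \<open>H(z) = \<Sum>\<^sub>k g\<^sub>k(e z) a\<^sub>k\<close>, which
  vanishes iff all of them hold. Its values are cancelled by adding multiples of finitely many points
  \<open>w\<close>, two for each member of a basis of the span of the range of \<open>H\<close>; a multiple of the
  strictly feasible point then restores the inequalities.\<close>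

lemma slater_error_bound:
  fixes e :: "'z \<Rightarrow> 'a::euclidean_space" and g :: "nat \<Rightarrow> 'a \<Rightarrow> real"
  assumes e_mix: "\<And>x y s. \<lbrakk>x \<in> A; y \<in> A; 0 \<le> s; s \<le> 1\<rbrakk> \<Longrightarrow> e (mix s x y) = (1 - s) *\<^sub>R e x + s *\<^sub>R e y"
    and fin: "finite I" "finite J"
    and g_I: "\<And>i. i \<in> I \<Longrightarrow> convex_on UNIV (g i)"
    and g_J: "\<And>k. k \<in> J \<Longrightarrow> \<exists>a b. \<forall>\<xi>. g k \<xi> = a \<bullet> \<xi> + b"
    and zh: "zh \<in> A" "\<And>i. i \<in> I \<Longrightarrow> g i (e zh) < 0" "\<And>k. k \<in> J \<Longrightarrow> g k (e zh) = 0"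
    and slater: "\<And>z. z \<in> A \<Longrightarrow> \<exists>s>0. \<exists>w\<in>A. (\<forall>i\<in>I. g i (e w) \<le> 0) \<and> (\<forall>k\<in>J. g k (e w) = - s * g k (e z))"
    and z0: "z0 \<in> A"
  defines "\<phi> \<equiv> \<lambda>z. (\<Sum>i\<in>I. max (g i (e z)) 0) + (\<Sum>k\<in>J. \<bar>g k (e z)\<bar>)"
  shows "\<exists>K>0. \<exists>R. \<forall>z\<in>A. d z z0 \<le> M \<longrightarrow> (\<exists>w\<in>A. \<phi> w = 0 \<and> d w z \<le> K * \<phi> z \<and> d w z0 \<le> R)"
proof -
  obtain a b where ab: "\<And>k \<xi>. k \<in> J \<Longrightarrow> g k \<xi> = a k \<bullet> \<xi> + b k"
    using g_J by metis
  have \<phi>_nonneg: "0 \<le> \<phi> z" for z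
    unfolding \<phi>_def by (intro add_nonneg_nonneg sum_nonneg) auto
  have g_I_le: "g i (e z) \<le> \<phi> z" if "i \<in> I" for i z
  proof -
    have "max (g i (e z)) 0 \<le> (\<Sum>i\<in>I. max (g i (e z)) 0)"
      using that fin by (intro member_le_sum) auto
    moreover have "0 \<le> (\<Sum>k\<in>J. \<bar>g k (e z)\<bar>)" by (intro sum_nonneg) auto
    ultimately show ?thesis unfolding \<phi>_def by linarith
  qed
  have g_J_le: "\<bar>g k (e z)\<bar> \<le> \<phi> z" if "k \<in> J" for k z
  proof -
    have "\<bar>g k (e z)\<bar> \<le> (\<Sum>k\<in>J. \<bar>g k (e z)\<bar>)"
      using that fin by (intro member_le_sum) auto
    moreover have "0 \<le> (\<Sum>i\<in>I. max (g i (e z)) 0)" by (intro sum_nonneg) auto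
    ultimately show ?thesis unfolding \<phi>_def by linarith
  qed
  define H where "H z = (\<Sum>k\<in>J. g k (e z) *\<^sub>R a k)" for z
  define Na where "Na = (\<Sum>k\<in>J. norm (a k))"
  have Na: "0 \<le> Na" unfolding Na_def by (intro sum_nonneg) auto
  have norm_H: "norm (H z) \<le> Na * \<phi> z" for z
  proof -
    have "norm (H z) \<le> (\<Sum>k\<in>J. \<bar>g k (e z)\<bar> * norm (a k))"
      unfolding H_def by (rule sum_norm_le) simp
    also have "\<dots> \<le> (\<Sum>k\<in>J. \<phi> z * norm (a k))"
      using g_J_le by (intro sum_mono mult_right_mono) auto
    finally show ?thesis by (simp add: Na_def sum_distrib_left mult.commute)
  qed
  have H0: "g k (e z) = 0" if "H z = 0" "k \<in> J" for k z
  proof -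
    \<comment> \<open>Since \<open>zh\<close> satisfies the equalities, \<open>g k (e z)\<close> is
      the inner product of \<open>a k\<close> with \<open>e z - e zh\<close>. The sum of squares is
      thus an inner product with \<open>H z\<close>, and no independence of the \<open>a k\<close>
      enters.\<close>
    have "(\<Sum>k\<in>J. (g k (e z))\<^sup>2) = (\<Sum>k\<in>J. g k (e z) * (a k \<bullet> (e z - e zh)))"
    proof (rule sum.cong)
      fix k assume k: "k \<in> J"
      have "g k (e z) = a k \<bullet> (e z - e zh)"
        using zh(3)[OF k] ab[OF k, of "e z"] ab[OF k, of "e zh"] by (simp add: inner_diff_right)
      then show "(g k (e z))\<^sup>2 = g k (e z) * (a k \<bullet> (e z - e zh))"
        by (simp add: power2_eq_square)
    qed simp
    also have "\<dots> = H z \<bullet> (e z - e zh)"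
      by (simp add: H_def inner_sum_left)
    finally have "(\<Sum>k\<in>J. (g k (e z))\<^sup>2) = 0" using that by simp
    then have "\<forall>k\<in>J. (g k (e z))\<^sup>2 = 0"
      using fin by (subst (asm) sum_nonneg_eq_0_iff) auto
    with that show ?thesis by simp
  qed
  obtain B where B: "B \<subseteq> H ` A" "independent B" "H ` A \<subseteq> span B"
    using maximal_independent_subset[of "H ` A"] by metis
  have finB: "finite B" using B(2) by (rule finiteI_independent)
  have neg: "\<exists>s>0. \<exists>w\<in>A. H w = - s *\<^sub>R H z \<and> (\<forall>i\<in>I. g i (e w) \<le> 0)" if z: "z \<in> A" for z
  proof -
    obtain s w where p: "0 < s" "w \<in> A" "\<forall>i\<in>I. g i (e w) \<le> 0" "\<forall>k\<in>J. g k (e w) = - s * g k (e z)"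
      using slater[OF z] by blast
    have "H w = - s *\<^sub>R H z"
      unfolding H_def scaleR_sum_right using p(4) by (intro sum.cong) auto
    with p show ?thesis by blast
  qed
  have neg_B: "\<exists>s>0. \<exists>w\<in>A. H w = - s *\<^sub>R v \<and> (\<forall>i\<in>I. g i (e w) \<le> 0)" if "v \<in> B" for v
    using neg B(1) that by blast
  \<comment> \<open>The vector \<open>v\<close> is a value of \<open>H\<close>, but perhaps at a
    point violating the inequalities. Reflecting twice gives a positive multiple of \<open>v\<close>
    at a point that satisfies them.\<close>
  have pos_B: "\<exists>s>0. \<exists>w\<in>A. H w = s *\<^sub>R v \<and> (\<forall>i\<in>I. g i (e w) \<le> 0)" if v: "v \<in> B" for v
  proof -
    obtain s1 w1 where 1: "0 < s1" "w1 \<in> A" "H w1 = - s1 *\<^sub>R v" using neg_B[OF v] by blast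
    obtain s2 w2 where 2: "0 < s2" "w2 \<in> A" "H w2 = - s2 *\<^sub>R H w1" "\<forall>i\<in>I. g i (e w2) \<le> 0"
      using neg[OF 1(2)] by blast
    have "0 < s2 * s1" "H w2 = (s2 * s1) *\<^sub>R v" using 1 2 by auto
    with 2 show ?thesis by blast
  qed
  obtain sp wp where p: "\<And>v. v \<in> B \<Longrightarrow> 0 < sp v \<and> wp v \<in> A \<and> H (wp v) = - sp v *\<^sub>R v \<and> (\<forall>i\<in>I. g i (e (wp v)) \<le> 0)"
    using neg_B by metis
  obtain sm wm where m: "\<And>v. v \<in> B \<Longrightarrow> 0 < sm v \<and> wm v \<in> A \<and> H (wm v) = sm v *\<^sub>R v \<and> (\<forall>i\<in>I. g i (e (wm v)) \<le> 0)"
    using pos_B by metis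
  have pm: "\<And>v. v \<in> B \<Longrightarrow> 0 < sp v" "\<And>v. v \<in> B \<Longrightarrow> 0 < sm v"
    "\<And>v. v \<in> B \<Longrightarrow> wp v \<in> A" "\<And>v. v \<in> B \<Longrightarrow> wm v \<in> A"
    "\<And>v. v \<in> B \<Longrightarrow> H (wp v) = - sp v *\<^sub>R v" "\<And>v. v \<in> B \<Longrightarrow> H (wm v) = sm v *\<^sub>R v"
    "\<And>v i. v \<in> B \<Longrightarrow> i \<in> I \<Longrightarrow> g i (e (wp v)) \<le> 0" "\<And>v i. v \<in> B \<Longrightarrow> i \<in> I \<Longrightarrow> g i (e (wm v)) \<le> 0"
    by (simp_all add: p m)
  \<comment> \<open>Coordinate functionals of the basis. Linear maps on a finite-dimensional space
    are bounded, so the coordinates of \<open>H z\<close> are at most a constant times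
    \<open>\<phi> z\<close>.\<close>
  have "\<exists>f. linear f \<and> (\<forall>v'\<in>B. f v' = (if v' = v then 1 else (0::real)))" for v
    by (rule linear_independent_extend[OF B(2)])
  then obtain f where f: "\<And>v. linear (f v)" "\<And>v v'. v' \<in> B \<Longrightarrow> f v v' = (if v' = v then 1 else (0::real))"
    by metis
  have repr: "x = (\<Sum>v\<in>B. f v x *\<^sub>R v)" if "x \<in> span B" for x
  proof (rule linear_eq_on_span[OF _ _ _ that])
    show "linear (\<lambda>x. \<Sum>v\<in>B. f v x *\<^sub>R v)"
      using f(1) by (intro linear_compose_sum ballI) (auto intro!: linearI simp: linear_add linear_scale scaleR_add_left)
    show "x = (\<Sum>v\<in>B. f v x *\<^sub>R v)" if "x \<in> B" for x
    proof -
      have "(\<Sum>v\<in>B. f v x *\<^sub>R v) = (\<Sum>v\<in>B. if x = v then v else 0)"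
        using f(2)[OF that] by (intro sum.cong) auto
      then show ?thesis using that finB by simp
    qed
  qed (rule linear_id[unfolded id_def])
  have "\<exists>c\<ge>0. \<forall>x. \<bar>f v x\<bar> \<le> c * norm x" for v
    using linear_bounded_pos[OF f(1)[of v]] by (metis less_imp_le real_norm_def mult.commute)
  then obtain C where C: "\<And>v. 0 \<le> C v" "\<And>v x. \<bar>f v x\<bar> \<le> C v * norm x"
    by metis
  \<comment> \<open>The least slack of \<open>zh\<close> in the inequalities; the inserted 1 keeps
    the minimum defined when \<open>I\<close> is empty.\<close>
  define \<eta> where "\<eta> = Min (insert 1 ((\<lambda>i. - g i (e zh)) ` I))"
  have \<eta>: "0 < \<eta>" "\<And>i. i \<in> I \<Longrightarrow> g i (e zh) \<le> - \<eta>"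
  proof -
    show "0 < \<eta>" unfolding \<eta>_def using fin zh(2) by (subst Min_gr_iff) auto
    fix i assume "i \<in> I"
    then have "\<eta> \<le> - g i (e zh)" unfolding \<eta>_def using fin by (intro Min_le) auto
    then show "g i (e zh) \<le> - \<eta>" by linarith
  qed
  \<comment> \<open>\<open>None\<close> stands for \<open>zh\<close>, and \<open>Some v\<close> for
    the point that cancels the \<open>v\<close>-coordinate of \<open>H z\<close>.\<close>
  define JJ where "JJ = insert None (Some ` B)"
  have finJJ: "finite JJ" using finB by (simp add: JJ_def)
  have sum_JJ: "(\<Sum>j\<in>JJ. h j) = h None + (\<Sum>v\<in>B. h (Some v))" for h :: "_ \<Rightarrow> real"
    using finB by (simp add: JJ_def sum.reindex)
  \<comment> \<open>Whether \<open>wp v\<close> or \<open>wm v\<close> is used depends on a sign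
    determined by \<open>z\<close>. Adding the contributions of both, here and in
    \<open>\<kappa>\<close>, keeps the constants independent of \<open>z\<close>.\<close>
  define D where "D j = (case j of None \<Rightarrow> d zh z0 | Some v \<Rightarrow> d (wp v) z0 + d (wm v) z0)" for j
  define \<kappa> where "\<kappa> j = (case j of None \<Rightarrow> 1 / \<eta> | Some v \<Rightarrow> C v * Na / sp v + C v * Na / sm v)" for j
  have D_nonneg: "0 \<le> D j" if "j \<in> JJ" for j
    using that pm zh z0 d_nonneg by (auto simp: D_def JJ_def)
  have \<kappa>_nonneg: "0 \<le> \<kappa> j" if "j \<in> JJ" for j
    using that pm(1,2) \<eta> C(1) Na by (auto simp: \<kappa>_def JJ_def intro!: add_nonneg_nonneg divide_nonneg_pos mult_nonneg_nonneg)
  \<comment> \<open>Each weight is at most \<open>\<kappa> j * \<phi> z\<close> and each distance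
    from \<open>w j\<close> to \<open>z\<close> at most \<open>D j + \<bar>M\<bar>\<close>; the
    leading 1 ensures positivity.\<close>
  define K where "K = 1 + (\<Sum>j\<in>JJ. \<kappa> j * (D j + \<bar>M\<bar>))"
  have K: "0 < K"
    unfolding K_def using D_nonneg \<kappa>_nonneg by (intro add_pos_nonneg sum_nonneg mult_nonneg_nonneg) auto
  define R where "R = \<bar>M\<bar> + sum D JJ"
  have "\<exists>w\<in>A. \<phi> w = 0 \<and> d w z \<le> K * \<phi> z \<and> d w z0 \<le> R" if z: "z \<in> A" "d z z0 \<le> M" for z
  proof -
    define c where "c v = f v (H z)" for v
    define w where "w j = (case j of None \<Rightarrow> zh | Some v \<Rightarrow> if 0 \<le> c v then wp v else wm v)" for j
    \<comment> \<open>The weight of \<open>Some v\<close> makes its contribution to \<open>H\<close>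
      equal to minus the \<open>v\<close>-component of \<open>H z\<close>. The weight of
      \<open>zh\<close> contributes at most \<open>- \<phi> z\<close> to each inequality, which
      offsets the violation at \<open>z\<close>.\<close>
    define t where "t j = (case j of None \<Rightarrow> \<phi> z / \<eta> | Some v \<Rightarrow> if 0 \<le> c v then c v / sp v else - c v / sm v)" for j
    have wA: "w j \<in> A" if "j \<in> JJ" for j
      using that pm zh by (auto simp: w_def JJ_def)
    have t0: "0 \<le> t j" if "j \<in> JJ" for j
      using that pm(1,2) \<eta> \<phi>_nonneg[of z] by (auto simp: t_def JJ_def intro!: divide_nonneg_pos divide_nonpos_pos)
    have tt: "0 \<le> sum t JJ" using t0 by (intro sum_nonneg)
    have t_le: "t j \<le> \<kappa> j * \<phi> z" if j: "j \<in> JJ" for j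
    proof (cases j)
      case None
      then show ?thesis by (simp add: t_def \<kappa>_def)
    next
      case (Some v)
      with j have v: "v \<in> B" by (auto simp: JJ_def)
      have "\<bar>c v\<bar> \<le> C v * norm (H z)" unfolding c_def by (rule C)
      also have "\<dots> \<le> C v * (Na * \<phi> z)" using C(1) norm_H by (intro mult_left_mono) auto
      finally have cv: "\<bar>c v\<bar> \<le> C v * Na * \<phi> z" by simp
      have nn: "0 \<le> C v * Na * \<phi> z" using C(1) Na \<phi>_nonneg by simp
      have "t j \<le> (C v * Na * \<phi> z) / sp v + (C v * Na * \<phi> z) / sm v"
      proof (cases "0 \<le> c v")
        case True
        have "c v / sp v \<le> (C v * Na * \<phi> z) / sp v" "0 \<le> (C v * Na * \<phi> z) / sm v"
          using cv nn pm(1,2)[OF v] by (auto intro!: divide_right_mono divide_nonneg_pos)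
        then show ?thesis using Some True by (simp add: t_def)
      next
        case False
        have "- c v / sm v \<le> (C v * Na * \<phi> z) / sm v" "0 \<le> (C v * Na * \<phi> z) / sp v"
          using cv nn pm(1,2)[OF v] divide_right_mono[of "- c v" "C v * Na * \<phi> z" "sm v"]
          by (auto intro!: divide_nonneg_pos)
        then show ?thesis using Some False by (simp add: t_def)
      qed
      then show ?thesis using Some by (simp add: \<kappa>_def distrib_right)
    qed
    have dD: "d (w j) z0 \<le> D j" if "j \<in> JJ" for j
      using that pm(3,4) z0 d_nonneg by (auto simp: w_def D_def JJ_def add_increasing add_increasing2)
    have "\<exists>z'\<in>A. (\<forall>y\<in>A. (1 + sum t JJ) * d z' y \<le> d z y + (\<Sum>j\<in>JJ. t j * d (w j) y)) \<and>
      (\<forall>G. convex_on UNIV G \<longrightarrow> (1 + sum t JJ) * G (e z') \<le> G (e z) + (\<Sum>j\<in>JJ. t j * G (e (w j))))"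
    proof (rule weighted_combination_exists)
      show "e (mix s x y) = (1 - s) *\<^sub>R e x + s *\<^sub>R e y" if "x \<in> A" "y \<in> A" "0 \<le> s" "s \<le> 1" for x y s
        using that by (rule e_mix)
    qed (use z finJJ wA t0 in auto)
    then obtain z' where z': "z' \<in> A"
      and dz': "\<And>y. y \<in> A \<Longrightarrow> (1 + sum t JJ) * d z' y \<le> d z y + (\<Sum>j\<in>JJ. t j * d (w j) y)"
      and Gz': "\<And>G. convex_on UNIV G \<Longrightarrow> (1 + sum t JJ) * G (e z') \<le> G (e z) + (\<Sum>j\<in>JJ. t j * G (e (w j)))"
      by blast
    \<comment> \<open>For affine \<open>g k\<close> both \<open>g k\<close> and its negative are
      convex, so the estimate for convex functions holds in both directions.\<close>
    have g_J_eq: "(1 + sum t JJ) * g k (e z') = g k (e z) + (\<Sum>j\<in>JJ. t j * g k (e (w j)))" if k: "k \<in> J" for k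
    proof (rule antisym)
      have eq: "g k = (\<lambda>\<xi>. a k \<bullet> \<xi> + b k)" using ab[OF k] by auto
      have cv: "convex_on UNIV (g k)"
        unfolding eq by (intro convex_onI) (auto simp: inner_add_right algebra_simps)
      have cc: "convex_on UNIV (\<lambda>\<xi>. - g k \<xi>)"
        unfolding eq by (intro convex_onI) (auto simp: inner_add_right algebra_simps)
      show "(1 + sum t JJ) * g k (e z') \<le> g k (e z) + (\<Sum>j\<in>JJ. t j * g k (e (w j)))"
        by (rule Gz'[OF cv])
      show "g k (e z) + (\<Sum>j\<in>JJ. t j * g k (e (w j))) \<le> (1 + sum t JJ) * g k (e z')"
        using Gz'[OF cc] by (simp add: sum_negf)
    qed
    have tH: "t (Some v) *\<^sub>R H (w (Some v)) = - c v *\<^sub>R v" if "v \<in> B" for v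
      using pm(1,2,5,6)[OF that] by (simp add: t_def w_def)
    have "(1 + sum t JJ) *\<^sub>R H z' = (\<Sum>k\<in>J. ((1 + sum t JJ) * g k (e z')) *\<^sub>R a k)"
      by (simp add: H_def scaleR_sum_right)
    also have "\<dots> = (\<Sum>k\<in>J. (g k (e z) + (\<Sum>v\<in>B. t (Some v) * g k (e (w (Some v))))) *\<^sub>R a k)"
    proof (rule sum.cong)
      fix k assume k: "k \<in> J"
      have "w None = zh" by (simp add: w_def)
      then have "(1 + sum t JJ) * g k (e z') = g k (e z) + (\<Sum>v\<in>B. t (Some v) * g k (e (w (Some v))))"
        using g_J_eq[OF k] sum_JJ[of "\<lambda>j. t j * g k (e (w j))"] zh(3)[OF k] by simp
      then show "((1 + sum t JJ) * g k (e z')) *\<^sub>R a k =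
          (g k (e z) + (\<Sum>v\<in>B. t (Some v) * g k (e (w (Some v))))) *\<^sub>R a k"
        by (simp only:)
    qed simp
    also have "\<dots> = H z + (\<Sum>k\<in>J. \<Sum>v\<in>B. (t (Some v) * g k (e (w (Some v)))) *\<^sub>R a k)"
      by (simp add: H_def scaleR_add_left sum.distrib scaleR_sum_left)
    also have "(\<Sum>k\<in>J. \<Sum>v\<in>B. (t (Some v) * g k (e (w (Some v)))) *\<^sub>R a k)
        = (\<Sum>v\<in>B. t (Some v) *\<^sub>R H (w (Some v)))"
      by (subst sum.swap) (simp add: H_def scaleR_sum_right)
    also have "\<dots> = (\<Sum>v\<in>B. - (c v *\<^sub>R v))"
      using tH by (intro sum.cong) auto
    also have "H z + \<dots> = 0"
      using repr[of "H z"] B(3) z(1) by (auto simp: sum_negf c_def)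
    finally have Hz': "H z' = 0" using tt by auto
    have g_I_z': "g i (e z') \<le> 0" if i: "i \<in> I" for i
    proof -
      have "(1 + sum t JJ) * g i (e z') \<le> g i (e z) + (\<Sum>j\<in>JJ. t j * g i (e (w j)))"
        by (rule Gz'[OF g_I[OF i]])
      also have "\<dots> = g i (e z) + (\<phi> z / \<eta>) * g i (e zh) + (\<Sum>v\<in>B. t (Some v) * g i (e (w (Some v))))"
        unfolding sum_JJ by (simp add: t_def w_def)
      also have "\<dots> \<le> \<phi> z + (\<phi> z / \<eta>) * (- \<eta>) + 0"
      proof (intro add_mono)
        show "(\<phi> z / \<eta>) * g i (e zh) \<le> (\<phi> z / \<eta>) * (- \<eta>)"
          using \<eta> i \<phi>_nonneg by (intro mult_left_mono) auto
        show "(\<Sum>v\<in>B. t (Some v) * g i (e (w (Some v)))) \<le> 0"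
        proof (intro sum_nonpos mult_nonneg_nonpos)
          fix v assume v: "v \<in> B"
          show "0 \<le> t (Some v)" using v by (intro t0) (auto simp: JJ_def)
          show "g i (e (w (Some v))) \<le> 0" using pm(7,8)[OF v i] by (simp add: w_def)
        qed
      qed (rule g_I_le[OF i])
      also have "\<dots> = 0" using \<eta> by simp
      finally show ?thesis using tt by (simp add: mult_le_0_iff)
    qed
    have "\<phi> z' = 0"
      unfolding \<phi>_def using g_I_z' H0[OF Hz'] by (simp add: max_absorb2)
    moreover have "d z' z \<le> K * \<phi> z"
    proof -
      have "1 * d z' z \<le> (1 + sum t JJ) * d z' z"
        using tt d_nonneg[OF z' z(1)] by (intro mult_right_mono) auto
      also have "\<dots> \<le> (\<Sum>j\<in>JJ. t j * d (w j) z)"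
        using dz'[OF z(1)] d_self[OF z(1)] by simp
      also have "\<dots> \<le> (\<Sum>j\<in>JJ. (\<kappa> j * \<phi> z) * (D j + \<bar>M\<bar>))"
      proof (intro sum_mono mult_mono)
        fix j assume j: "j \<in> JJ"
        show "t j \<le> \<kappa> j * \<phi> z" by (rule t_le[OF j])
        show "d (w j) z \<le> D j + \<bar>M\<bar>"
          using d_triangle[OF wA[OF j] z0 z(1)] d_commute[OF z0 z(1)] dD[OF j] z(2) by linarith
        show "0 \<le> \<kappa> j * \<phi> z" using \<kappa>_nonneg[OF j] \<phi>_nonneg by simp
        show "0 \<le> d (w j) z" by (rule d_nonneg[OF wA[OF j] z(1)])
      qed
      also have "\<dots> = (\<Sum>j\<in>JJ. \<kappa> j * (D j + \<bar>M\<bar>)) * \<phi> z"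
        by (simp add: sum_distrib_right sum_distrib_left mult_ac)
      also have "\<dots> \<le> K * \<phi> z"
        using \<phi>_nonneg by (intro mult_right_mono) (auto simp: K_def)
      finally show ?thesis by simp
    qed
    \<comment> \<open>All averaged points lie within \<open>R\<close> of \<open>z0\<close>, so the
      radius does not depend on the weights.\<close>
    moreover have "d z' z0 \<le> R"
    proof -
      have sD: "0 \<le> sum D JJ" using D_nonneg by (intro sum_nonneg)
      have "(1 + sum t JJ) * d z' z0 \<le> d z z0 + (\<Sum>j\<in>JJ. t j * d (w j) z0)"
        by (rule dz'[OF z0])
      also have "\<dots> \<le> R + (\<Sum>j\<in>JJ. t j * R)"
      proof (intro add_mono sum_mono mult_left_mono)
        show "d z z0 \<le> R" using z(2) sD by (simp add: R_def)
        fix j assume j: "j \<in> JJ"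
        have "D j \<le> sum D JJ" using j finJJ D_nonneg by (intro member_le_sum) auto
        then show "d (w j) z0 \<le> R" using dD[OF j] by (simp add: R_def)
        show "0 \<le> t j" by (rule t0[OF j])
      qed
      also have "\<dots> = (1 + sum t JJ) * R" by (simp add: sum_distrib_right distrib_right)
      finally show ?thesis using tt by simp
    qed
    ultimately show ?thesis using z' by blast
  qed
  with K show ?thesis by blast
qed

end

section \<open>Reflection of equality defects through the relative interior\<close>

lemma fun_affineD:
  "\<lbrakk>fun_affine S; x \<in> S; y \<in> S; a + b = 1\<rbrakk> \<Longrightarrow> (\<lambda>i. a * x i + b * y i) \<in> S"
  by (simp add: fun_affine_def)

text \<open>Weights 1 + s at 0 and - s at \<open>x\<close> show that the line through them stays in
  the affine hull; for small s its points lie in the relative neighbourhood of 0 contained in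
  \<open>S\<close>. The vanishing condition keeps the line inside
  \<open>Euclidean_space n\<close>.\<close>

lemma relint_zero_reflect:
  assumes rel: "(\<lambda>_. 0) \<in> relint n S" and x: "x \<in> S" and x0: "\<And>i. n \<le> i \<Longrightarrow> x i = 0"
  shows "\<exists>s>0. (\<lambda>i. - (s * x i)) \<in> S"
proof -
  let ?X = "subtopology (Euclidean_space n) (fun_affine hull S)"
  obtain U where U: "openin ?X U" "(\<lambda>_. 0) \<in> U" "U \<subseteq> S"
    using rel unfolding relint_def interior_of_def by auto
  have zero: "(\<lambda>_. 0) \<in> S" using U by blast
  have aff: "fun_affine (fun_affine hull S)"
    by (rule hull_in) (auto simp: fun_affine_def)
  have hull: "(\<lambda>i. - (s * x i)) \<in> fun_affine hull S" for s :: real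
  proof -
    have "(\<lambda>_. 0) \<in> fun_affine hull S" "x \<in> fun_affine hull S"
      using zero x by (auto intro: hull_inc)
    from fun_affineD[OF aff this, of "1 + s" "- s"] show ?thesis by simp
  qed
  have "continuous_map euclideanreal ?X (\<lambda>s i. - (s * x i))"
    unfolding Euclidean_space_def continuous_map_in_subtopology continuous_map_componentwise_UNIV
    using x0 hull by (auto intro!: continuous_intros)
  then have "openin euclideanreal {s \<in> topspace euclideanreal. (\<lambda>i. - (s * x i)) \<in> U}"
    using U(1) by (rule openin_continuous_map_preimage)
  then have "open {s. (\<lambda>i. - (s * x i)) \<in> U}" by simp
  moreover have "0 \<in> {s. (\<lambda>i. - (s * x i)) \<in> U}" using U(2) by simp
  ultimately obtain r where r: "0 < r" "\<And>s. dist s 0 < r \<Longrightarrow> (\<lambda>i. - (s * x i)) \<in> U"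
    unfolding open_dist by blast
  have "(\<lambda>i. - (r / 2 * x i)) \<in> U" using r(1) by (intro r(2)) (simp add: dist_norm)
  with U(3) r(1) show ?thesis by (intro exI[of _ "r / 2"]) auto
qed

context convex_pseudometric
begin

text \<open>The end point of \<open>z\<close> may violate the inequalities and then lies outside the
  set described by \<open>rel\<close>. A small step from \<open>zh\<close> towards \<open>z\<close>
  keeps them, since they are strict at \<open>zh\<close>, and scales the equality defects of
  \<open>z\<close> by the step size, since those of \<open>zh\<close> vanish. That scaled vector is
  reflected.\<close>

lemma slater_reflect:
  fixes e :: "'z \<Rightarrow> 'a::euclidean_space" and g :: "nat \<Rightarrow> 'a \<Rightarrow> real"
  assumes e_mix: "\<And>x y s. \<lbrakk>x \<in> A; y \<in> A; 0 \<le> s; s \<le> 1\<rbrakk> \<Longrightarrow> e (mix s x y) = (1 - s) *\<^sub>R e x + s *\<^sub>R e y"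
    and g_I: "\<And>i. i \<in> {1..l1} \<Longrightarrow> convex_on UNIV (g i)"
    and g_J: "\<And>k. k \<in> {l1+1..l2} \<Longrightarrow> \<exists>a b. \<forall>\<xi>. g k \<xi> = a \<bullet> \<xi> + b"
    and zh: "zh \<in> A" "\<And>i. i \<in> {1..l1} \<Longrightarrow> g i (e zh) < 0" "\<And>k. k \<in> {l1+1..l2} \<Longrightarrow> g k (e zh) = 0"
    and rel: "(\<lambda>_. 0) \<in> relint (l2 - l1) (vec_J l1 l2 g ` {\<xi> \<in> e ` A. \<forall>i\<in>{1..l1}. g i \<xi> \<le> 0})"
    and z: "z \<in> A"
  shows "\<exists>s>0. \<exists>w\<in>A. (\<forall>i\<in>{1..l1}. g i (e w) \<le> 0) \<and> (\<forall>k\<in>{l1+1..l2}. g k (e w) = - s * g k (e z))"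
proof -
  have "\<forall>\<^sub>F s in at_right 0. (1 - s) * g i (e zh) + s * g i (e z) < 0" if "i \<in> {1..l1}" for i
  proof (rule order_tendstoD(2))
    show "((\<lambda>s. (1 - s) * g i (e zh) + s * g i (e z)) \<longlongrightarrow> (1 - 0) * g i (e zh) + 0 * g i (e z)) (at_right 0)"
      by (intro tendsto_intros)
  qed (use zh(2)[OF that] in simp)
  then have "\<forall>\<^sub>F s in at_right 0. \<forall>i\<in>{1..l1}. (1 - s) * g i (e zh) + s * g i (e z) < 0"
    by (intro eventually_ball_finite) auto
  moreover have "\<forall>\<^sub>F s::real in at_right 0. 0 < s \<and> s < 1"
    using eventually_at_right_less[of 0] eventually_at_right_field[of "\<lambda>s. s < 1" "0::real"]
    by (auto intro: eventually_conj exI[of _ 1])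
  ultimately have "\<forall>\<^sub>F s in at_right 0. (\<forall>i\<in>{1..l1}. (1 - s) * g i (e zh) + s * g i (e z) < 0) \<and> 0 < s \<and> s < 1"
    by (rule eventually_conj)
  then obtain s where s: "\<And>i. i \<in> {1..l1} \<Longrightarrow> (1 - s) * g i (e zh) + s * g i (e z) < 0" "0 < s" "s < 1"
    using eventually_happens'[of "at_right (0::real)"] by (metis (no_types, lifting) trivial_limit_at_right_real)
  let ?y = "mix s zh z" and ?S = "vec_J l1 l2 g ` {\<xi> \<in> e ` A. \<forall>i\<in>{1..l1}. g i \<xi> \<le> 0}"
  have y: "?y \<in> A" using zh z s by (intro mix_mem) auto
  have ey: "e ?y = (1 - s) *\<^sub>R e zh + s *\<^sub>R e z" using zh z s by (intro e_mix) auto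
  have "g i (e ?y) \<le> 0" if i: "i \<in> {1..l1}" for i
    unfolding ey using convex_onD[OF g_I[OF i], of s "e zh" "e z"] s(1)[OF i] s(2,3) by simp
  then have yS: "vec_J l1 l2 g (e ?y) \<in> ?S" using y by blast
  have gJ_y: "g k (e ?y) = s * g k (e z)" if k: "k \<in> {l1+1..l2}" for k
  proof -
    obtain a b where ab: "\<And>\<xi>. g k \<xi> = a \<bullet> \<xi> + b" using g_J[OF k] by blast
    have "g k (e ?y) = (1 - s) * g k (e zh) + s * g k (e z)"
      unfolding ey ab by (simp add: inner_add_right algebra_simps)
    then show ?thesis using zh(3)[OF k] by simp
  qed
  obtain s' where s': "0 < s'" "(\<lambda>i. - (s' * vec_J l1 l2 g (e ?y) i)) \<in> ?S"
    using relint_zero_reflect[OF rel yS] by (auto simp: vec_J_def)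
  then obtain w where w: "w \<in> A" "\<forall>i\<in>{1..l1}. g i (e w) \<le> 0"
    and eq: "(\<lambda>i. - (s' * vec_J l1 l2 g (e ?y) i)) = vec_J l1 l2 g (e w)"
    by auto
  have "g k (e w) = - (s' * s) * g k (e z)" if k: "k \<in> {l1+1..l2}" for k
  proof -
    \<comment> \<open>\<open>vec_J\<close> counts its components from 0.\<close>
    have "k - (l1 + 1) < l2 - l1" "l1 + 1 + (k - (l1 + 1)) = k" using k by auto
    then have "g k (e w) = - (s' * g k (e ?y))"
      using fun_cong[OF eq, of "k - (l1 + 1)"] by (simp add: vec_J_def)
    then show ?thesis using gJ_y[OF k] by simp
  qed
  with w s' s(2) show ?thesis by (intro exI[of _ "s' * s"]) auto
qed

end

section \<open>Lipschitz continuity of the cost\<close>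

text \<open>Insert s = |w(t)| / b with b above the norm of \<open>w\<close> into the pointwise
  inequality: the integral of the q-th power is then at most 1, and b may decrease to the norm. The
  resulting constant does not depend on \<open>w\<close>.\<close>

lemma holder_of_young:
  fixes w :: "real \<Rightarrow> 'b::euclidean_space" and h m :: "real \<Rightarrow> real"
  assumes w: "w \<in> Lp_space q T" and q: "q \<noteq> \<infinity>" "1 \<le> q" and T: "0 < T"
    and h: "h \<in> borel_measurable (lebesgue_on {0..T})" and m: "integrable (lebesgue_on {0..T}) m"
    and young: "AE t in lebesgue_on {0..T}. \<forall>s\<ge>0. \<bar>h t\<bar> * s \<le> m t + c * s powr enn2real q"
    and c: "0 \<le> c"
  shows "integrable (lebesgue_on {0..T}) (\<lambda>t. h t * norm (w t)) \<and>
    (LINT t|lebesgue_on {0..T}. h t * norm (w t)) \<le> ((LINT t|lebesgue_on {0..T}. m t) + c) * Lp_norm q T w"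
proof -
  let ?M = "lebesgue_on {0..T}"
  have [measurable]: "w \<in> borel_measurable ?M" "h \<in> borel_measurable ?M"
    using w h by (auto simp: Lp_space_def)
  have *: "integrable ?M (\<lambda>t. h t * norm (w t)) \<and> (LINT t|?M. h t * norm (w t)) \<le> ((LINT t|?M. m t) + c) * b"
    if b: "Lp_norm q T w < b" for b
  proof -
    have b0: "0 < b" using b Lp_norm_nonneg[OF w T] by auto
    let ?p = "\<lambda>t. (norm (w t) / b) powr enn2real q"
    have p: "integrable ?M ?p" by (rule integrable_powr_scale[OF w q(1) b0])
    have i: "integrable ?M (\<lambda>t. b * (m t + c * ?p t))" using p m by simp
    have AE: "AE t in ?M. \<bar>h t * norm (w t)\<bar> \<le> b * (m t + c * ?p t)"
      using young
    proof eventually_elim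
      case (elim t)
      have "b * (\<bar>h t\<bar> * (norm (w t) / b)) \<le> b * (m t + c * ?p t)"
        using elim[rule_format, of "norm (w t) / b"] b0 by (intro mult_left_mono) (simp_all del: times_divide_eq_right)
      then show ?case using b0 by (simp add: abs_mult)
    qed
    have int: "integrable ?M (\<lambda>t. h t * norm (w t))"
      by (rule Bochner_Integration.integrable_bound[OF i]) (use AE in \<open>auto elim!: eventually_mono\<close>)
    have "(LINT t|?M. h t * norm (w t)) \<le> (LINT t|?M. b * (m t + c * ?p t))"
      using AE by (intro integral_mono_AE int i) (auto elim!: eventually_mono)
    also have "\<dots> = b * ((LINT t|?M. m t) + c * (LINT t|?M. ?p t))"
      using p m by simp
    also have "\<dots> \<le> b * ((LINT t|?M. m t) + c * 1)"
      using b b0 c Lp_norm_finite_le_iff[OF q b0, of T w]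
      by (intro mult_left_mono add_left_mono) auto
    finally show ?thesis using int by (simp add: mult.commute)
  qed
  have "AE t in ?M. 0 \<le> m t"
    using young by eventually_elim (auto dest!: spec[of _ 0])
  then have "0 \<le> (LINT t|?M. m t) + c"
    using c by (intro add_nonneg_nonneg integral_nonneg_AE)
  moreover have "integrable ?M (\<lambda>t. h t * norm (w t))"
    using *[of "Lp_norm q T w + 1"] by simp
  ultimately show ?thesis
    using le_mult_if_le_mult_greater * by blast
qed

text \<open>Compare x with s^(r-1): if x is smaller, the product is at most s^r; otherwise s is at
  most x^(1/(r-1)), and the product is bounded by the other term.\<close>

lemma young_powr:
  fixes x s r :: real
  assumes "0 \<le> x" "0 \<le> s" "1 < r"
  shows "x * s \<le> x powr (r / (r - 1)) + s powr r"
proof -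
  have r: "r / (r - 1) = 1 + 1 / (r - 1)" using assms by (simp add: field_simps)
  show ?thesis
  proof (cases "x \<le> s powr (r - 1)")
    case True
    then have "x * s \<le> s powr (r - 1) * s" using assms by (intro mult_right_mono) auto
    also have "\<dots> = s powr r"
      using assms powr_mult_base[of s "r - 1"] by (cases "s = 0") (auto simp: mult.commute)
    finally show ?thesis by (simp add: add_increasing)
  next
    case False
    then have x: "0 < x" using powr_ge_zero[of s "r - 1"] by linarith
    have "s = (s powr (r - 1)) powr (1 / (r - 1))"
      using assms by (simp add: powr_powr)
    also have "\<dots> \<le> x powr (1 / (r - 1))"
      using False assms by (intro powr_mono2) auto
    finally have "x * s \<le> x * x powr (1 / (r - 1))" using x by (intro mult_left_mono) auto
    also have "\<dots> = x powr (r / (r - 1))"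
      using x unfolding r by (simp add: powr_add)
    finally show ?thesis by (simp add: add_increasing2)
  qed
qed

text \<open>Exponent 1 is separated because inverting 0 gives \<infinity> in \<open>ennreal\<close>,
  whereas r / (r - 1) would be 0 in the reals.\<close>

lemma conj_exponent_finite:
  assumes "q \<noteq> \<infinity>" "1 \<le> q"
  shows "if enn2real q = 1 then conj_exponent q = \<infinity>
    else 1 < enn2real q \<and> conj_exponent q = ennreal (enn2real q / (enn2real q - 1))"
proof -
  obtain r where r: "q = ennreal r" "0 \<le> r" using assms by (cases q) auto
  with assms have r1: "1 \<le> r" by simp
  have e: "enn2real q = r" using r by simp
  show ?thesis
  proof (cases "r = 1")
    case True
    then show ?thesis using r by (simp add: conj_exponent_def)
  next
    case False
    with r1 have "1 < r" by simp
    have "1 - inverse q = ennreal (1 - inverse r)"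
      using \<open>1 < r\<close> r by (simp add: inverse_ennreal ennreal_minus[symmetric])
    also have "inverse \<dots> = ennreal (inverse (1 - inverse r))"
      using \<open>1 < r\<close> by (intro inverse_ennreal) (simp add: field_simps)
    also have "inverse (1 - inverse r) = r / (r - 1)"
      using \<open>1 < r\<close> by (simp add: field_simps)
    finally show ?thesis using False \<open>1 < r\<close> e by (simp add: conj_exponent_def)
  qed
qed

text \<open>The constant is fixed by \<omega> alone: an essential bound for q = 1, otherwise the
  integral of its q'-th power plus 1, from Young's inequality.\<close>

lemma holder_conj_exponent:
  fixes \<omega> :: "real \<Rightarrow> real"
  assumes \<omega>: "\<omega> \<in> Lp_space (conj_exponent q) T" and q: "q \<noteq> \<infinity>" "1 \<le> q" and T: "0 < T"
  shows "\<exists>\<kappa>. \<forall>w \<in> (Lp_space q T :: (real \<Rightarrow> 'b::euclidean_space) set).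
    integrable (lebesgue_on {0..T}) (\<lambda>t. \<omega> t * norm (w t)) \<and>
    (LINT t|lebesgue_on {0..T}. \<omega> t * norm (w t)) \<le> \<kappa> * Lp_norm q T w"
proof -
  let ?M = "lebesgue_on {0..T}" and ?r = "enn2real q"
  have m: "\<omega> \<in> borel_measurable ?M" using \<omega> by (simp add: Lp_space_def)
  show ?thesis
  proof (cases "?r = 1")
    case True
    then have "conj_exponent q = \<infinity>" using conj_exponent_finite[OF q] by simp
    with \<omega> obtain C where C: "AE t in ?M. norm (\<omega> t) \<le> C" by (auto simp: Lp_space_def)
    have "AE t in ?M. \<forall>s\<ge>0. \<bar>\<omega> t\<bar> * s \<le> 0 + max C 0 * s powr ?r"
      using C by eventually_elim (auto simp: True intro: mult_right_mono)
    from holder_of_young[OF _ q T m _ this] show ?thesis by auto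
  next
    case False
    then have r: "1 < ?r" and cq: "conj_exponent q = ennreal (?r / (?r - 1))"
      using conj_exponent_finite[OF q] by auto
    have "integrable ?M (\<lambda>t. \<bar>\<omega> t\<bar> powr (?r / (?r - 1)))"
      using \<omega> r unfolding cq by (simp add: Lp_space_def)
    moreover have "AE t in ?M. \<forall>s\<ge>0. \<bar>\<omega> t\<bar> * s \<le> \<bar>\<omega> t\<bar> powr (?r / (?r - 1)) + 1 * s powr ?r"
      using young_powr r by auto
    ultimately show ?thesis
      by (intro exI[of _ "(LINT t|?M. \<bar>\<omega> t\<bar> powr (?r / (?r - 1))) + 1"] ballI holder_of_young[OF _ q T m]) auto
  qed
qed

lemma LINT_powr_le:
  fixes u :: "real \<Rightarrow> 'b::euclidean_space"
  assumes "q \<noteq> \<infinity>" "1 \<le> q" "Lp_norm q T u \<le> N" "0 < N"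
  shows "(LINT t|lebesgue_on {0..T}. norm (u t) powr enn2real q) \<le> N powr enn2real q"
proof -
  have "(LINT t|lebesgue_on {0..T}. norm (u t) powr enn2real q) / N powr enn2real q \<le> 1"
    using Lp_norm_finite_le_iff[OF assms(1,2,4), of T u] assms(3)
    unfolding LINT_powr_scale[OF assms(4)] by simp
  then show ?thesis using assms(4) by simp
qed

text \<open>Rests on a^(r-1) s \<le> a^r + s^r, where the larger of a and s dominates. For q = 1 the
  value 1 of \<open>h\<close> follows the convention of \<open>growth_condition\<close> for order
  0.\<close>

lemma holder_powr:
  fixes u w :: "real \<Rightarrow> 'b::euclidean_space"
  assumes u: "u \<in> Lp_space q T" and w: "w \<in> Lp_space q T" and q: "q \<noteq> \<infinity>" "1 \<le> q" and T: "0 < T"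
    and N: "Lp_norm q T u \<le> N" "0 < N"
  defines "h \<equiv> \<lambda>t. if enn2real q - 1 = 0 then 1 else norm (u t) powr (enn2real q - 1)"
  shows "integrable (lebesgue_on {0..T}) (\<lambda>t. h t * norm (w t)) \<and>
    (LINT t|lebesgue_on {0..T}. h t * norm (w t)) \<le> (N powr enn2real q + 1) * Lp_norm q T w"
proof -
  let ?M = "lebesgue_on {0..T}" and ?r = "enn2real q"
  have r: "1 \<le> ?r" using enn2real_ge_1 q by auto
  have [measurable]: "u \<in> borel_measurable ?M" using u by (simp add: Lp_space_def)
  have h: "h \<in> borel_measurable ?M" unfolding h_def by measurable
  have "\<bar>h t\<bar> * s \<le> norm (u t) powr ?r + 1 * s powr ?r" if "0 \<le> s" for s t
  proof (cases "?r = 1")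
    case True
    then show ?thesis using that by (simp add: h_def)
  next
    case False
    with r have r1: "0 < ?r - 1" by linarith
    have pb: "y powr (?r - 1) * y = y powr ?r" if "0 \<le> y" for y
      using that powr_mult_base[of y "?r - 1"] by (cases "y = 0") (auto simp: mult.commute)
    have h_eq: "\<bar>h t\<bar> = norm (u t) powr (?r - 1)" using False by (simp add: h_def)
    show ?thesis
    proof (cases "s \<le> norm (u t)")
      case True
      then have "\<bar>h t\<bar> * s \<le> norm (u t) powr (?r - 1) * norm (u t)"
        unfolding h_eq by (intro mult_left_mono) auto
      also have "\<dots> = norm (u t) powr ?r" by (rule pb) simp
      finally show ?thesis by (simp add: add_increasing2)
    next
      case False
      then have "\<bar>h t\<bar> * s \<le> s powr (?r - 1) * s"
        unfolding h_eq using r1 that by (intro mult_right_mono powr_mono2) auto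
      also have "\<dots> = s powr ?r" by (rule pb[OF that])
      finally show ?thesis by (simp add: add_increasing)
    qed
  qed
  then have "AE t in ?M. \<forall>s\<ge>0. \<bar>h t\<bar> * s \<le> norm (u t) powr ?r + 1 * s powr ?r" by simp
  moreover have "integrable ?M (\<lambda>t. norm (u t) powr ?r)" using u q by (simp add: Lp_space_def)
  ultimately have *: "integrable ?M (\<lambda>t. h t * norm (w t)) \<and>
      (LINT t|?M. h t * norm (w t)) \<le> ((LINT t|?M. norm (u t) powr ?r) + 1) * Lp_norm q T w"
    by (intro holder_of_young[OF w q T h]) auto
  moreover have "((LINT t|?M. norm (u t) powr ?r) + 1) * Lp_norm q T w \<le> (N powr ?r + 1) * Lp_norm q T w"
    using LINT_powr_le[OF q N] Lp_norm_nonneg[OF w T] by (intro mult_right_mono) auto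
  ultimately show ?thesis by linarith
qed

section \<open>Integrand estimates from gradients and growth conditions\<close>

lemma GDERIV_lipschitz_bound:
  fixes f :: "'a::euclidean_space \<Rightarrow> real"
  assumes "convex S" "\<And>x. x \<in> S \<Longrightarrow> GDERIV f x :> D x" "\<And>x. x \<in> S \<Longrightarrow> norm (D x) \<le> B"
    and "x \<in> S" "y \<in> S"
  shows "\<bar>f x - f y\<bar> \<le> B * norm (x - y)"
proof -
  have "norm (f x - f y) \<le> B * norm (x - y)"
  proof (rule differentiable_bound[OF assms(1) _ _ assms(4,5)])
    fix x assume x: "x \<in> S"
    show "(f has_derivative (\<lambda>h. h \<bullet> D x)) (at x within S)"
      using assms(2)[OF x] unfolding gderiv_def by (rule has_derivative_at_withinI)
    have "norm (h \<bullet> D x) \<le> B * norm h" for h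
      using order_trans[OF Cauchy_Schwarz_ineq2[of h "D x"] mult_left_mono[OF assms(3)[OF x], of "norm h"]]
      by (simp add: mult.commute)
    moreover have "0 \<le> B" using assms(3)[OF x] norm_ge_zero[of "D x"] by linarith
    ultimately show "onorm (\<lambda>h. h \<bullet> D x) \<le> B" by (intro onorm_bound) auto
  qed
  then show ?thesis by simp
qed

text \<open>The function is read as a family over the one-point time set {0}, so that the
  compactness argument for \<open>local_lipschitz\<close> applies.\<close>

lemma local_lipschitz_imp_lipschitz_on_cball:
  fixes \<zeta> :: "'a::euclidean_space \<Rightarrow> real"
  assumes "\<And>\<xi>. \<exists>r>0. \<exists>L. L-lipschitz_on (ball \<xi> r) \<zeta>"
  shows "\<exists>L. L-lipschitz_on (cball 0 R) \<zeta>"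
proof -
  have "local_lipschitz {0::real} (cball 0 R) (\<lambda>_. \<zeta>)"
    unfolding local_lipschitz_def
  proof (intro ballI)
    fix x :: 'a and t :: real
    obtain r L where r: "0 < r" "L-lipschitz_on (ball x r) \<zeta>" using assms by blast
    have "cball x (r / 2) \<inter> cball 0 R \<subseteq> ball x r" using r by auto
    then have "L-lipschitz_on (cball x (r / 2) \<inter> cball 0 R) \<zeta>"
      using r(2) lipschitz_on_subset by blast
    then show "\<exists>u>0. \<exists>L. \<forall>t\<in>cball t u \<inter> {0}. L-lipschitz_on (cball x u \<inter> cball 0 R) \<zeta>"
      using r(1) by (intro exI[of _ "r / 2"]) auto
  qed
  then obtain L where "\<And>t. t \<in> {0::real} \<Longrightarrow> L-lipschitz_on (cball 0 R) \<zeta>"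
    by (rule local_lipschitz_compact_implies_lipschitz) auto
  then show ?thesis by blast
qed

lemma continuous_on_bounded_on_balls:
  fixes G :: "'a::euclidean_space \<Rightarrow> 'b::euclidean_space \<Rightarrow> real \<Rightarrow> 'c::real_normed_vector"
  assumes "continuous_on (UNIV \<times> UNIV \<times> {0..T}) (\<lambda>(x, u, t). G x u t)"
  shows "\<exists>B. \<forall>x u t. norm x \<le> R \<longrightarrow> norm u \<le> N \<longrightarrow> t \<in> {0..T} \<longrightarrow> norm (G x u t) \<le> B"
proof -
  let ?K = "cball (0::'a) R \<times> cball (0::'b) N \<times> {0..T}"
  have "continuous_on ?K (\<lambda>(x, u, t). G x u t)"
    by (rule continuous_on_subset[OF assms]) auto
  moreover have "compact ?K" by (intro compact_Times) auto
  ultimately have "bounded ((\<lambda>(x, u, t). G x u t) ` ?K)"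
    by (intro compact_imp_bounded compact_continuous_image)
  then obtain B where "\<forall>y\<in>(\<lambda>(x, u, t). G x u t) ` ?K. norm y \<le> B"
    by (auto simp: bounded_iff)
  then show ?thesis by (intro exI[of _ B]) force
qed

text \<open>Continuity is available only for times in [0, T], so the map t -> (x(t), u(t), t) is
  taken into the restricted Borel space before composing.\<close>

lemma borel_measurable_nemytskii:
  fixes \<theta> :: "'a::euclidean_space \<Rightarrow> 'b::euclidean_space \<Rightarrow> real \<Rightarrow> real"
  assumes cont: "continuous_on (UNIV \<times> UNIV \<times> {0..T}) (\<lambda>(x, u, t). \<theta> x u t)"
    and [measurable]: "x \<in> borel_measurable (lebesgue_on {0..T})" "u \<in> borel_measurable (lebesgue_on {0..T})"
  shows "(\<lambda>t. \<theta> (x t) (u t) t) \<in> borel_measurable (lebesgue_on {0..T})"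
proof -
  let ?M = "lebesgue_on {0..T}"
  have id: "(\<lambda>t. t) \<in> borel_measurable ?M"
    by (intro continuous_imp_measurable_on_sets_lebesgue) auto
  have "(\<lambda>t. (x t, u t, t)) \<in> borel_measurable ?M"
    by (intro borel_measurable_Pair id assms)
  then have "(\<lambda>t. (x t, u t, t)) \<in> measurable ?M (restrict_space borel (UNIV \<times> UNIV \<times> {0..T}))"
    by (intro measurable_restrict_space2) auto
  from measurable_compose[OF this borel_measurable_continuous_on_restrict[OF cont]]
  show ?thesis by simp
qed

lemma growth_conditionE:
  fixes g :: "'a::real_normed_vector \<Rightarrow> 'b::real_normed_vector \<Rightarrow> real \<Rightarrow> 'c::real_normed_vector"
  assumes "growth_condition T l s g"
  obtains C \<omega> where "0 < C" "\<omega> \<in> Lp_space s T"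
    "AE t in lebesgue_on {0..T}. 0 \<le> \<omega> t \<and> (\<forall>x u. norm x \<le> R \<longrightarrow>
        norm (g x u t) \<le> C * (if l = 0 then 1 else norm u powr l) + \<omega> t)"
proof -
  \<comment> \<open>The growth condition speaks of positive radii, while \<open>R\<close> is
    arbitrary here.\<close>
  have "0 < max R 1" by simp
  with assms obtain C \<omega> where C: "0 < C" "\<omega> \<in> Lp_space s T" "AE t in lebesgue_on {0..T}. (0::real) \<le> \<omega> t"
    "AE t in lebesgue_on {0..T}. \<forall>x u. norm x \<le> max R 1 \<longrightarrow>
        norm (g x u t) \<le> C * (if l = 0 then 1 else norm u powr l) + \<omega> t"
    unfolding growth_condition_def by blast
  from C(3,4) have "AE t in lebesgue_on {0..T}. 0 \<le> \<omega> t \<and> (\<forall>x u. norm x \<le> R \<longrightarrow>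
        norm (g x u t) \<le> C * (if l = 0 then 1 else norm u powr l) + \<omega> t)"
    by eventually_elim auto
  with C that show thesis by blast
qed

context
  fixes q :: ennreal and T :: real
    and \<theta> :: "'a::euclidean_space \<Rightarrow> 'b::euclidean_space \<Rightarrow> real \<Rightarrow> real" and \<theta>x \<theta>u
  assumes q: "1 \<le> q" and T: "0 < T"
    and \<theta>_cont: "continuous_on (UNIV \<times> UNIV \<times> {0..T}) (\<lambda>(x, u, t). \<theta> x u t)"
    and \<theta>_grad_x: "\<And>x u t. t \<in> {0..T} \<Longrightarrow> GDERIV (\<lambda>y. \<theta> y u t) x :> \<theta>x x u t"
    and \<theta>_grad_u: "\<And>x u t. t \<in> {0..T} \<Longrightarrow> GDERIV (\<lambda>v. \<theta> x v t) u :> \<theta>u x u t"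
    and \<theta>x_cont: "continuous_on (UNIV \<times> UNIV \<times> {0..T}) (\<lambda>(x, u, t). \<theta>x x u t)"
    and \<theta>u_cont: "continuous_on (UNIV \<times> UNIV \<times> {0..T}) (\<lambda>(x, u, t). \<theta>u x u t)"
    and growth: "q = \<infinity> \<or>
      (growth_condition T (enn2real q) 1 \<theta> \<and> growth_condition T (enn2real q) 1 \<theta>x \<and>
       growth_condition T (enn2real q - 1) (conj_exponent q) \<theta>u)"
begin

text \<open>The state is changed with the control kept at \<open>u\<close>, and the control with the
  state kept at \<open>y\<close>. The state gradient thus enters at one control, and the control
  gradient along the segment between the two controls.\<close>

lemma increment_bound:
  assumes t: "t \<in> {0..T}" and x: "norm x \<le> R" and y: "norm y \<le> R"
    and a: "\<And>\<xi>. norm \<xi> \<le> R \<Longrightarrow> norm (\<theta>x \<xi> u t) \<le> a"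
    and b: "\<And>w. w \<in> closed_segment u v \<Longrightarrow> norm (\<theta>u y w t) \<le> b"
  shows "\<bar>\<theta> x u t - \<theta> y v t\<bar> \<le> a * norm (x - y) + b * norm (u - v)"
proof -
  have "\<bar>\<theta> x u t - \<theta> y u t\<bar> \<le> a * norm (x - y)"
    by (rule GDERIV_lipschitz_bound[of "cball 0 R"]) (use \<theta>_grad_x[OF t] a x y in auto)
  moreover have "\<bar>\<theta> y u t - \<theta> y v t\<bar> \<le> b * norm (u - v)"
    by (rule GDERIV_lipschitz_bound[of "closed_segment u v"]) (use \<theta>_grad_u[OF t] b in auto)
  ultimately show ?thesis by linarith
qed

lemma integrable_nemytskii:
  assumes [measurable]: "x \<in> borel_measurable (lebesgue_on {0..T})"
    and xR: "\<And>t. t \<in> {0..T} \<Longrightarrow> norm (x t) \<le> R" and u: "u \<in> Lp_space q T"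
  shows "integrable (lebesgue_on {0..T}) (\<lambda>t. \<theta> (x t) (u t) t)"
proof -
  let ?M = "lebesgue_on {0..T}"
  have mem: "AE t in ?M. t \<in> {0..T}" by (rule AE_lebesgue_on_mem) simp
  have meas: "(\<lambda>t. \<theta> (x t) (u t) t) \<in> borel_measurable ?M"
    using u by (intro borel_measurable_nemytskii[OF \<theta>_cont]) (auto simp: Lp_space_def)
  show ?thesis
  proof (cases "q = \<infinity>")
    case True
    with u obtain N where N: "AE t in ?M. norm (u t) \<le> N" by (auto simp: Lp_space_def)
    obtain B where B: "\<And>x u t. norm x \<le> R \<Longrightarrow> norm u \<le> N \<Longrightarrow> t \<in> {0..T} \<Longrightarrow> norm (\<theta> x u t) \<le> B"
      using continuous_on_bounded_on_balls[OF \<theta>_cont] by blast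
    have "AE t in ?M. norm (\<theta> (x t) (u t) t) \<le> norm B"
      using N mem
    proof eventually_elim
      case (elim t)
      from B[OF xR[OF elim(2)] elim] show ?case by simp
    qed
    then show ?thesis
      by (rule Bochner_Integration.integrable_bound[OF integrable_const_interval meas])
  next
    case False
    then obtain C \<omega> where C: "0 < C" "\<omega> \<in> Lp_space 1 T"
      "AE t in ?M. 0 \<le> \<omega> t \<and> (\<forall>x u. norm x \<le> R \<longrightarrow>
        norm (\<theta> x u t) \<le> C * (if enn2real q = 0 then 1 else norm u powr enn2real q) + \<omega> t)"
      using growth growth_conditionE[of T "enn2real q" 1 \<theta> R] by blast
    have "integrable ?M (\<lambda>t. C * norm (u t) powr enn2real q + \<omega> t)"
      using u False Lp_space_integrable[OF C(2) _ T] by (simp add: Lp_space_def)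
    moreover have "AE t in ?M. norm (\<theta> (x t) (u t) t) \<le> norm (C * norm (u t) powr enn2real q + \<omega> t)"
      using C(3) mem
    proof eventually_elim
      case (elim t)
      then have "norm (\<theta> (x t) (u t) t) \<le> C * norm (u t) powr enn2real q + \<omega> t"
        using xR enn2real_ge_1[OF q False] by force
      then show ?case by simp
    qed
    ultimately show ?thesis by (rule Bochner_Integration.integrable_bound[OF _ meas])
  qed
qed

text \<open>State differences are bounded uniformly in time, so an integrable coefficient
  \<open>a\<close> suffices for them; control differences are merely in L^q, so \<open>b\<close> is
  measured by its pairing with them. Both coefficients vary with \<open>u\<close> and
  \<open>v\<close>, but \<kappa> does not.\<close>

lemma nemytskii_increment:
  fixes R N :: real
  assumes N: "0 < N"
  shows "\<exists>\<kappa>\<ge>0. \<forall>u\<in>Lp_space q T. \<forall>v\<in>Lp_space q T. Lp_norm q T u \<le> N \<longrightarrow> Lp_norm q T v \<le> N \<longrightarrow>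
    (\<exists>a b. integrable (lebesgue_on {0..T}) a \<and> (LINT t|lebesgue_on {0..T}. a t) \<le> \<kappa> \<and>
      integrable (lebesgue_on {0..T}) (\<lambda>t. b t * norm (u t - v t)) \<and>
      (LINT t|lebesgue_on {0..T}. b t * norm (u t - v t)) \<le> \<kappa> * Lp_norm q T (\<lambda>t. u t - v t) \<and>
      (AE t in lebesgue_on {0..T}. 0 \<le> a t \<and> (\<forall>x y. norm x \<le> R \<longrightarrow> norm y \<le> R \<longrightarrow>
        \<bar>\<theta> x (u t) t - \<theta> y (v t) t\<bar> \<le> a t * norm (x - y) + b t * norm (u t - v t))))"
proof -
  let ?M = "lebesgue_on {0..T}"
  have mem: "AE t in ?M. t \<in> {0..T}" by (rule AE_lebesgue_on_mem) simp
  have diff: "(\<lambda>t. u t - v t) \<in> Lp_space q T" if "u \<in> Lp_space q T" "v \<in> Lp_space q T" for u v :: "real \<Rightarrow> 'b"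
    using Lp_lincomb(1)[OF that q T, of 1 "-1"] by simp
  show ?thesis
  proof (cases "q = \<infinity>")
    case True
    obtain B1 where B1: "\<And>x u t. norm x \<le> R \<Longrightarrow> norm u \<le> N \<Longrightarrow> t \<in> {0..T} \<Longrightarrow> norm (\<theta>x x u t) \<le> B1"
      using continuous_on_bounded_on_balls[OF \<theta>x_cont] by blast
    obtain B2 where B2: "\<And>x u t. norm x \<le> R \<Longrightarrow> norm u \<le> N \<Longrightarrow> t \<in> {0..T} \<Longrightarrow> norm (\<theta>u x u t) \<le> B2"
      using continuous_on_bounded_on_balls[OF \<theta>u_cont] by blast
    define B where "B = max 0 (max B1 B2)"
    have B: "0 \<le> B" "\<And>x u t. norm x \<le> R \<Longrightarrow> norm u \<le> N \<Longrightarrow> t \<in> {0..T} \<Longrightarrow> norm (\<theta>x x u t) \<le> B"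
      "\<And>x u t. norm x \<le> R \<Longrightarrow> norm u \<le> N \<Longrightarrow> t \<in> {0..T} \<Longrightarrow> norm (\<theta>u x u t) \<le> B"
      using B1 B2 by (force simp: B_def)+
    have "\<exists>a b. integrable ?M a \<and> (LINT t|?M. a t) \<le> B * (T + 1) \<and>
      integrable ?M (\<lambda>t. b t * norm (u t - v t)) \<and>
      (LINT t|?M. b t * norm (u t - v t)) \<le> (B * (T + 1)) * Lp_norm q T (\<lambda>t. u t - v t) \<and>
      (AE t in ?M. 0 \<le> a t \<and> (\<forall>x y. norm x \<le> R \<longrightarrow> norm y \<le> R \<longrightarrow>
        \<bar>\<theta> x (u t) t - \<theta> y (v t) t\<bar> \<le> a t * norm (x - y) + b t * norm (u t - v t)))"
      if u: "u \<in> Lp_space q T" and v: "v \<in> Lp_space q T" and uv: "Lp_norm q T u \<le> N" "Lp_norm q T v \<le> N"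
      for u v
    proof (intro exI[of _ "\<lambda>_. B"] conjI)
      show "(LINT t|?M. B) \<le> B * (T + 1)" using T B(1) by (simp add: algebra_simps)
      show "integrable ?M (\<lambda>t. B * norm (u t - v t))"
        using Lp_space_integrable[OF diff[OF u v] q T] by simp
      have "B * (LINT t|?M. norm (u t - v t)) \<le> B * ((T + 1) * Lp_norm q T (\<lambda>t. u t - v t))"
        using L1_le_Lp_norm[OF diff[OF u v] q T] B(1) by (intro mult_left_mono)
      then show "(LINT t|?M. B * norm (u t - v t)) \<le> (B * (T + 1)) * Lp_norm q T (\<lambda>t. u t - v t)"
        by (simp add: mult.assoc)
      have "AE t in ?M. norm (u t) \<le> N" "AE t in ?M. norm (v t) \<le> N"
        using u v uv True Lp_norm_infinity_le_iff[OF _ T] by auto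
      with mem show "AE t in ?M. 0 \<le> B \<and> (\<forall>x y. norm x \<le> R \<longrightarrow> norm y \<le> R \<longrightarrow>
          \<bar>\<theta> x (u t) t - \<theta> y (v t) t\<bar> \<le> B * norm (x - y) + B * norm (u t - v t))"
      proof eventually_elim
        case (elim t)
        have "closed_segment (u t) (v t) \<subseteq> cball 0 N"
          using elim by (intro closed_segment_subset) auto
        then have "norm w \<le> N" if "w \<in> closed_segment (u t) (v t)" for w
          using that by auto
        with elim B show ?case by (intro conjI allI impI increment_bound) auto
      qed
    qed simp
    with B(1) T show ?thesis by (intro exI[of _ "B * (T + 1)"]) auto
  next
    case False
    let ?r = "enn2real q"
    have r: "1 \<le> ?r" using enn2real_ge_1[OF q False] .
    obtain C1 \<omega>1 where C1: "0 < C1" "\<omega>1 \<in> Lp_space 1 T"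
      "AE t in ?M. 0 \<le> \<omega>1 t \<and> (\<forall>x u. norm x \<le> R \<longrightarrow>
        norm (\<theta>x x u t) \<le> C1 * (if ?r = 0 then 1 else norm u powr ?r) + \<omega>1 t)"
      using growth growth_conditionE[of T "enn2real q" 1 \<theta>x R] False by blast
    obtain C2 \<omega>2 where C2: "0 < C2" "\<omega>2 \<in> Lp_space (conj_exponent q) T"
      "AE t in ?M. 0 \<le> \<omega>2 t \<and> (\<forall>x u. norm x \<le> R \<longrightarrow>
        norm (\<theta>u x u t) \<le> C2 * (if ?r - 1 = 0 then 1 else norm u powr (?r - 1)) + \<omega>2 t)"
      using growth growth_conditionE[of T "enn2real q - 1" "conj_exponent q" \<theta>u R] False by blast
    obtain \<kappa>2 where \<kappa>2: "\<And>w::real\<Rightarrow>'b. w \<in> Lp_space q T \<Longrightarrow> integrable ?M (\<lambda>t. \<omega>2 t * norm (w t)) \<and>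
        (LINT t|?M. \<omega>2 t * norm (w t)) \<le> \<kappa>2 * Lp_norm q T w"
      using holder_conj_exponent[OF C2(2) False q T] by blast
    have \<omega>1: "integrable ?M \<omega>1" using Lp_space_integrable[OF C1(2) _ T] by simp
    \<comment> \<open>The power from the growth condition as a nondecreasing function: at a point
      between two controls it is at most the sum of its values at both.\<close>
    define pw where "pw s = (if ?r - 1 = 0 then 1 else s powr (?r - 1))" for s :: real
    define P where "P = N powr ?r + 1"
    have P: "0 \<le> P" by (simp add: P_def)
    \<comment> \<open>One entry bounds the integral of \<open>a\<close>. The other bounds the
      pairing with \<open>b\<close>, where \<open>P\<close> occurs once for each of the two
      controls.\<close>
    define \<kappa> where "\<kappa> = max 0 (max (C1 * N powr ?r + (LINT t|?M. \<omega>1 t)) (C2 * (P + P) + \<kappa>2))"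
    have pw_mono: "pw s \<le> pw s'" if "0 \<le> s" "s \<le> s'" for s s'
      using that r by (auto simp: pw_def intro: powr_mono2)
    have pw_nonneg: "0 \<le> pw s" for s by (simp add: pw_def)
    have "\<exists>a b. integrable ?M a \<and> (LINT t|?M. a t) \<le> \<kappa> \<and>
      integrable ?M (\<lambda>t. b t * norm (u t - v t)) \<and>
      (LINT t|?M. b t * norm (u t - v t)) \<le> \<kappa> * Lp_norm q T (\<lambda>t. u t - v t) \<and>
      (AE t in ?M. 0 \<le> a t \<and> (\<forall>x y. norm x \<le> R \<longrightarrow> norm y \<le> R \<longrightarrow>
        \<bar>\<theta> x (u t) t - \<theta> y (v t) t\<bar> \<le> a t * norm (x - y) + b t * norm (u t - v t)))"
      if u: "u \<in> Lp_space q T" and v: "v \<in> Lp_space q T" and uv: "Lp_norm q T u \<le> N" "Lp_norm q T v \<le> N"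
      for u v
    proof -
      let ?w = "\<lambda>t. u t - v t"
      define a where "a t = C1 * norm (u t) powr ?r + \<omega>1 t" for t
      define b where "b t = C2 * (pw (norm (u t)) + pw (norm (v t))) + \<omega>2 t" for t
      note w = diff[OF u v]
      have ur: "integrable ?M (\<lambda>t. norm (u t) powr ?r)" using u False by (simp add: Lp_space_def)
      have "(LINT t|?M. a t) = C1 * (LINT t|?M. norm (u t) powr ?r) + (LINT t|?M. \<omega>1 t)"
        unfolding a_def using ur \<omega>1 by simp
      also have "\<dots> \<le> C1 * N powr ?r + (LINT t|?M. \<omega>1 t)"
        using LINT_powr_le[OF False q uv(1) N] C1(1) by (intro add_right_mono mult_left_mono) auto
      finally have a_le: "(LINT t|?M. a t) \<le> \<kappa>" by (simp add: \<kappa>_def)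
      have a_int: "integrable ?M a" unfolding a_def using ur \<omega>1 by simp
      have hu: "integrable ?M (\<lambda>t. pw (norm (u t)) * norm (?w t))"
          "(LINT t|?M. pw (norm (u t)) * norm (?w t)) \<le> P * Lp_norm q T ?w"
        using holder_powr[OF u w False q T uv(1) N] unfolding pw_def P_def by auto
      have hv: "integrable ?M (\<lambda>t. pw (norm (v t)) * norm (?w t))"
          "(LINT t|?M. pw (norm (v t)) * norm (?w t)) \<le> P * Lp_norm q T ?w"
        using holder_powr[OF v w False q T uv(2) N] unfolding pw_def P_def by auto
      note h\<omega> = \<kappa>2[OF w]
      have b_eq: "b t * norm (?w t) = C2 * (pw (norm (u t)) * norm (?w t) + pw (norm (v t)) * norm (?w t)) + \<omega>2 t * norm (?w t)" for t
        by (simp add: b_def algebra_simps)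
      have b_int: "integrable ?M (\<lambda>t. b t * norm (?w t))"
        unfolding b_eq using hu hv h\<omega> by (intro Bochner_Integration.integrable_add integrable_mult_right) auto
      have "(LINT t|?M. b t * norm (?w t)) = C2 * ((LINT t|?M. pw (norm (u t)) * norm (?w t)) +
          (LINT t|?M. pw (norm (v t)) * norm (?w t))) + (LINT t|?M. \<omega>2 t * norm (?w t))"
        unfolding b_eq using hu(1) hv(1) h\<omega> by simp
      also have "\<dots> \<le> C2 * (P * Lp_norm q T ?w + P * Lp_norm q T ?w) + \<kappa>2 * Lp_norm q T ?w"
        using hu(2) hv(2) h\<omega> C2(1) by (intro add_mono mult_left_mono) auto
      also have "\<dots> = (C2 * (P + P) + \<kappa>2) * Lp_norm q T ?w" by (simp add: algebra_simps)
      also have "\<dots> \<le> \<kappa> * Lp_norm q T ?w"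
        using Lp_norm_nonneg[OF w T] by (intro mult_right_mono) (auto simp: \<kappa>_def)
      finally have b_le: "(LINT t|?M. b t * norm (?w t)) \<le> \<kappa> * Lp_norm q T ?w" .
      have "AE t in ?M. 0 \<le> a t \<and> (\<forall>x y. norm x \<le> R \<longrightarrow> norm y \<le> R \<longrightarrow>
        \<bar>\<theta> x (u t) t - \<theta> y (v t) t\<bar> \<le> a t * norm (x - y) + b t * norm (u t - v t))"
        using mem C1(3) C2(3)
      proof eventually_elim
        case (elim t)
        have "0 \<le> a t" using elim C1(1) by (simp add: a_def)
        moreover have "norm (\<theta>x \<xi> (u t) t) \<le> a t" if "norm \<xi> \<le> R" for \<xi>
          using elim(2) that r unfolding a_def by force
        moreover have "norm (\<theta>u y w t) \<le> b t" if y: "norm y \<le> R" and w: "w \<in> closed_segment (u t) (v t)" for y w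
        proof -
          have "w \<in> cball 0 (max (norm (u t)) (norm (v t)))"
            using w closed_segment_subset[of "u t" "cball 0 (max (norm (u t)) (norm (v t)))" "v t"] by auto
          then have "pw (norm w) \<le> pw (max (norm (u t)) (norm (v t)))" by (intro pw_mono) auto
          also have "\<dots> \<le> pw (norm (u t)) + pw (norm (v t))"
            using pw_nonneg by (simp add: max_def add_increasing add_increasing2)
          finally have "C2 * pw (norm w) \<le> C2 * (pw (norm (u t)) + pw (norm (v t)))"
            using C2(1) by (intro mult_left_mono) auto
          moreover have "norm (\<theta>u y w t) \<le> C2 * pw (norm w) + \<omega>2 t"
            using elim(3) y unfolding pw_def by blast
          ultimately show ?thesis by (simp add: b_def)
        qed
        ultimately show ?case using elim(1) by (intro conjI allI impI increment_bound) auto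
      qed
      with a_int a_le b_int b_le show ?thesis by blast
    qed
    moreover have "0 \<le> \<kappa>" by (simp add: \<kappa>_def)
    ultimately show ?thesis by blast
  qed
qed

lemma cost_lipschitz_on_bounded:
  fixes p :: ennreal and z0 :: "(real \<Rightarrow> 'a) \<times> (real \<Rightarrow> 'b)"
  assumes p: "1 \<le> p" and \<zeta>: "\<And>\<xi>. \<exists>r>0. \<exists>L. L-lipschitz_on (ball \<xi> r) \<zeta>"
    and z0: "z0 \<in> X_diff p q T"
  shows "\<exists>L\<ge>0. \<forall>z\<in>X_diff p q T. \<forall>y\<in>X_diff p q T. fst z 0 = fst z0 0 \<longrightarrow> fst y 0 = fst z0 0 \<longrightarrow>
    X_dist p q T z z0 \<le> M \<longrightarrow> X_dist p q T y z0 \<le> M \<longrightarrow>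
    \<bar>cost T \<theta> \<zeta> z - cost T \<theta> \<zeta> y\<bar> \<le> L * X_dist p q T z y"
proof -
  let ?M = "lebesgue_on {0..T}"
  note pqT = p q T
  have cont: "continuous_on {0..T} (fst z)" if "z \<in> X_diff p q T" for z :: "(real \<Rightarrow> 'a) \<times> (real \<Rightarrow> 'b)"
    using that abs_continuous_on_interval_imp_continuous_on
    by (auto simp: X_diff_def W1p_diff_def W1p_space_def)
  have "bounded (fst z0 ` {0..T})"
    using cont[OF z0] by (intro compact_imp_bounded compact_continuous_image) auto
  then obtain R0 where R0: "\<forall>t\<in>{0..T}. norm (fst z0 t) \<le> R0" by (auto simp: bounded_iff)
  \<comment> \<open>By the embedding, states at distance at most \<open>M\<close> from
    \<open>z0\<close> with the same initial value stay within this radius.\<close>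
  define R where "R = (T + 1) * M + R0"
  have xR: "norm (fst z t) \<le> R"
    if z: "z \<in> X_diff p q T" "fst z 0 = fst z0 0" "X_dist p q T z z0 \<le> M" and t: "t \<in> {0..T}" for z t
  proof -
    have "norm (fst z t - fst z0 t) \<le> (T + 1) * X_dist p q T z z0"
      by (rule state_diff_le_X_dist[OF pqT z(1) z0 z(2) t])
    also have "\<dots> \<le> (T + 1) * M" using z T by (intro mult_left_mono) auto
    finally show ?thesis
      using norm_triangle_sub[of "fst z t" "fst z0 t"] R0 t unfolding R_def by fastforce
  qed
  define N where "N = max 1 (M + Lp_norm q T (snd z0))"
  have N: "0 < N" by (simp add: N_def)
  have uN: "Lp_norm q T (snd z) \<le> N"
    if z: "z \<in> X_diff p q T" "X_dist p q T z z0 \<le> M" for z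
  proof -
    have Lp: "snd z \<in> Lp_space q T" "snd z0 \<in> Lp_space q T" using z z0 by (auto simp: X_diff_def)
    have w: "(\<lambda>t. snd z t - snd z0 t) \<in> Lp_space q T"
      using Lp_lincomb(1)[OF Lp q T, of 1 "-1"] by simp
    have "Lp_norm q T (snd z) \<le> Lp_norm q T (\<lambda>t. snd z t - snd z0 t) + Lp_norm q T (snd z0)"
      using Lp_norm_triangle[OF w Lp(2) q T] by simp
    also have "\<dots> \<le> M + Lp_norm q T (snd z0)"
      using control_diff_le_X_dist[OF pqT z(1) z0] z(2) by simp
    finally show ?thesis by (simp add: N_def)
  qed
  obtain \<kappa> where \<kappa>: "0 \<le> \<kappa>" and incr: "\<And>u v. u \<in> Lp_space q T \<Longrightarrow> v \<in> Lp_space q T \<Longrightarrow>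
    Lp_norm q T u \<le> N \<Longrightarrow> Lp_norm q T v \<le> N \<Longrightarrow>
    \<exists>a b. integrable ?M a \<and> (LINT t|?M. a t) \<le> \<kappa> \<and>
      integrable ?M (\<lambda>t. b t * norm (u t - v t)) \<and>
      (LINT t|?M. b t * norm (u t - v t)) \<le> \<kappa> * Lp_norm q T (\<lambda>t. u t - v t) \<and>
      (AE t in ?M. 0 \<le> a t \<and> (\<forall>x y. norm x \<le> R \<longrightarrow> norm y \<le> R \<longrightarrow>
        \<bar>\<theta> x (u t) t - \<theta> y (v t) t\<bar> \<le> a t * norm (x - y) + b t * norm (u t - v t)))"
    using nemytskii_increment[OF N, of R] by blast
  obtain L\<zeta> where L\<zeta>: "L\<zeta>-lipschitz_on (cball 0 R) \<zeta>"
    using local_lipschitz_imp_lipschitz_on_cball[OF \<zeta>] by blast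
  have L\<zeta>0: "0 \<le> L\<zeta>" using L\<zeta> by (rule lipschitz_on_nonneg)
  \<comment> \<open>The three summands come from the states and the controls in the running cost,
    and from the end point in the terminal cost.\<close>
  define L where "L = (T + 1) * \<kappa> + \<kappa> + L\<zeta> * (T + 1)"
  have L: "0 \<le> L" using \<kappa> L\<zeta>0 T by (simp add: L_def)
  have "\<bar>cost T \<theta> \<zeta> z - cost T \<theta> \<zeta> y\<bar> \<le> L * X_dist p q T z y"
    if z: "z \<in> X_diff p q T" "fst z 0 = fst z0 0" "X_dist p q T z z0 \<le> M"
      and y: "y \<in> X_diff p q T" "fst y 0 = fst z0 0" "X_dist p q T y z0 \<le> M" for z y
  proof -
    let ?d = "X_dist p q T z y" and ?w = "\<lambda>t. snd z t - snd y t"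
    have d0: "0 \<le> ?d" by (rule X_dist_nonneg[OF pqT z(1) y(1)])
    have Lp: "snd z \<in> Lp_space q T" "snd y \<in> Lp_space q T" using z y by (auto simp: X_diff_def)
    have meas: "fst z \<in> borel_measurable ?M" "fst y \<in> borel_measurable ?M"
      using cont[OF z(1)] cont[OF y(1)] by (auto intro: continuous_imp_measurable_on_sets_lebesgue)
    have sd: "norm (fst z t - fst y t) \<le> (T + 1) * ?d" if "t \<in> {0..T}" for t
      using state_diff_le_X_dist[OF pqT z(1) y(1) _ that] z(2) y(2) by simp
    obtain a b where ab: "integrable ?M a" "(LINT t|?M. a t) \<le> \<kappa>"
      "integrable ?M (\<lambda>t. b t * norm (?w t))"
      "(LINT t|?M. b t * norm (?w t)) \<le> \<kappa> * Lp_norm q T ?w"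
      "AE t in ?M. 0 \<le> a t \<and> (\<forall>x x'. norm x \<le> R \<longrightarrow> norm x' \<le> R \<longrightarrow>
        \<bar>\<theta> x (snd z t) t - \<theta> x' (snd y t) t\<bar> \<le> a t * norm (x - x') + b t * norm (?w t))"
      using incr[OF Lp uN[OF z(1,3)] uN[OF y(1,3)]] by blast
    have int: "integrable ?M (\<lambda>t. \<theta> (fst z t) (snd z t) t)" "integrable ?M (\<lambda>t. \<theta> (fst y t) (snd y t) t)"
      using integrable_nemytskii[OF meas(1) xR[OF z] Lp(1)] integrable_nemytskii[OF meas(2) xR[OF y] Lp(2)] by auto
    have mem: "AE t in ?M. t \<in> {0..T}" by (rule AE_lebesgue_on_mem) simp
    have bound: "AE t in ?M. \<bar>\<theta> (fst z t) (snd z t) t - \<theta> (fst y t) (snd y t) t\<bar>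
        \<le> a t * ((T + 1) * ?d) + b t * norm (?w t)"
      using ab(5) mem
    proof eventually_elim
      case (elim t)
      then have "\<bar>\<theta> (fst z t) (snd z t) t - \<theta> (fst y t) (snd y t) t\<bar>
          \<le> a t * norm (fst z t - fst y t) + b t * norm (?w t)"
        using xR[OF z] xR[OF y] by blast
      also have "a t * norm (fst z t - fst y t) \<le> a t * ((T + 1) * ?d)"
        using elim sd by (intro mult_left_mono) auto
      finally show ?case by simp
    qed
    have "\<bar>(LINT t|?M. \<theta> (fst z t) (snd z t) t) - (LINT t|?M. \<theta> (fst y t) (snd y t) t)\<bar>
        = \<bar>LINT t|?M. \<theta> (fst z t) (snd z t) t - \<theta> (fst y t) (snd y t) t\<bar>"
      using int by simp
    also have "\<dots> \<le> (LINT t|?M. \<bar>\<theta> (fst z t) (snd z t) t - \<theta> (fst y t) (snd y t) t\<bar>)"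
      by (rule integral_abs_bound)
    also have "\<dots> \<le> (LINT t|?M. a t * ((T + 1) * ?d) + b t * norm (?w t))"
      using int ab(1,3) bound by (intro integral_mono_AE) auto
    also have "\<dots> = (LINT t|?M. a t) * ((T + 1) * ?d) + (LINT t|?M. b t * norm (?w t))"
      using ab(1,3) by simp
    also have "\<dots> \<le> \<kappa> * ((T + 1) * ?d) + \<kappa> * ?d"
    proof (intro add_mono mult_right_mono)
      show "(LINT t|?M. b t * norm (?w t)) \<le> \<kappa> * ?d"
        using ab(4) mult_left_mono[OF control_diff_le_X_dist[OF pqT z(1) y(1)] \<kappa>] by linarith
    qed (use ab(2) d0 T in auto)
    finally have 1: "\<bar>(LINT t|?M. \<theta> (fst z t) (snd z t) t) - (LINT t|?M. \<theta> (fst y t) (snd y t) t)\<bar>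
        \<le> \<kappa> * ((T + 1) * ?d) + \<kappa> * ?d" .
    have "dist (\<zeta> (fst z T)) (\<zeta> (fst y T)) \<le> L\<zeta> * dist (fst z T) (fst y T)"
      using xR[OF z, of T] xR[OF y, of T] T by (intro lipschitz_onD[OF L\<zeta>]) auto
    also have "\<dots> \<le> L\<zeta> * ((T + 1) * ?d)"
      using sd[of T] T L\<zeta>0 by (intro mult_left_mono) (auto simp: dist_norm)
    finally have 2: "\<bar>\<zeta> (fst z T) - \<zeta> (fst y T)\<bar> \<le> L\<zeta> * ((T + 1) * ?d)"
      by (simp add: dist_real_def)
    have "L * ?d = (\<kappa> * ((T + 1) * ?d) + \<kappa> * ?d) + L\<zeta> * ((T + 1) * ?d)"
      by (simp add: L_def algebra_simps)
    with 1 2 show ?thesis unfolding cost_def by linarith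
  qed
  with L show ?thesis by blast
qed

end

section \<open>Complete exactness\<close>

lemma convex_on_sum_functions:
  fixes f :: "'i \<Rightarrow> 'a::real_vector \<Rightarrow> real"
  assumes "convex C" "\<And>i. i \<in> I \<Longrightarrow> convex_on C (f i)"
  shows "convex_on C (\<lambda>x. \<Sum>i\<in>I. f i x)"
  using assms(2)
proof (induction I rule: infinite_finite_induct)
  case (insert i I)
  then show ?case by (simp add: convex_on_add)
qed (use assms(1) in \<open>auto intro: convex_onI\<close>)

theorem theorem13:
  fixes p q :: ennreal and T :: real and x0 :: "real ^ 'd" and l1 l2 :: nat
    and U :: "(real \<Rightarrow> real ^ 'm) set"
    and g :: "nat \<Rightarrow> real ^ 'd \<Rightarrow> real"
    and \<theta> :: "real ^ 'd \<Rightarrow> real ^ 'm \<Rightarrow> real \<Rightarrow> real"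
    and \<theta>x :: "real ^ 'd \<Rightarrow> real ^ 'm \<Rightarrow> real \<Rightarrow> real ^ 'd"
    and \<theta>u :: "real ^ 'd \<Rightarrow> real ^ 'm \<Rightarrow> real \<Rightarrow> real ^ 'm"
    and \<zeta> :: "real ^ 'd \<Rightarrow> real"
    and f :: "real ^ 'd \<Rightarrow> real ^ 'm \<Rightarrow> real \<Rightarrow> real ^ 'd"
    and Amat :: "real \<Rightarrow> real ^ 'd ^ 'd" and Bmat :: "real \<Rightarrow> real ^ 'm ^ 'd"
    and A \<Omega> :: "((real \<Rightarrow> real ^ 'd) \<times> (real \<Rightarrow> real ^ 'm)) set"
    and \<I> \<phi> :: "(real \<Rightarrow> real ^ 'd) \<times> (real \<Rightarrow> real ^ 'm) \<Rightarrow> real"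
    and \<Phi> :: "real \<Rightarrow> (real \<Rightarrow> real ^ 'd) \<times> (real \<Rightarrow> real ^ 'm) \<Rightarrow> real"
    and S :: "real \<Rightarrow> real \<Rightarrow> ((real \<Rightarrow> real ^ 'd) \<times> (real \<Rightarrow> real ^ 'm)) set"
    and lam0 c \<delta> :: real
  assumes exponents: "1 \<le> p" "p \<le> q" and T: "0 < T" and l12: "l1 \<le> l2"
    and U: "U \<subseteq> Lp_space q T" "U \<noteq> {}" "Lp_closed q T U" "fun_convex U"
    and g_I: "\<And>i. i \<in> {1..l1} \<Longrightarrow> convex_on UNIV (g i)"
    and g_J: "\<And>k. k \<in> {l1+1..l2} \<Longrightarrow> \<exists>a b. \<forall>\<xi>. g k \<xi> = a \<bullet> \<xi> + b"
    and A_def: "A = trajectories p q T x0 f U"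
    and cost_def: "\<I> = cost T \<theta> \<zeta>"
    and \<phi>_def: "\<phi> = violation T l1 l2 g"
    and \<Phi>_def: "\<Phi> = (\<lambda>l z. \<I> z + l * \<phi> z)"
    and \<Omega>_def: "\<Omega> = {z \<in> A. \<phi> z = 0}"
    and S_def: "S = (\<lambda>l r. {z \<in> A. \<Phi> l z < r})"
    and f_linear: "\<And>x u t. t \<in> {0..T} \<Longrightarrow> f x u t = Amat t *v x + Bmat t *v u"
      "Amat \<in> Lp_space \<infinity> T" "Bmat \<in> Lp_space \<infinity> T"
    and \<zeta>_loc_lipschitz: "\<And>\<xi>. \<exists>r>0. \<exists>L. L-lipschitz_on (ball \<xi> r) \<zeta>"
    and \<theta>_cont: "continuous_on (UNIV \<times> UNIV \<times> {0..T}) (\<lambda>(x, u, t). \<theta> x u t)"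
    and \<theta>_grad_x: "\<And>x u t. t \<in> {0..T} \<Longrightarrow> GDERIV (\<lambda>y. \<theta> y u t) x :> \<theta>x x u t"
    and \<theta>_grad_u: "\<And>x u t. t \<in> {0..T} \<Longrightarrow> GDERIV (\<lambda>v. \<theta> x v t) u :> \<theta>u x u t"
    and \<theta>x_cont: "continuous_on (UNIV \<times> UNIV \<times> {0..T}) (\<lambda>(x, u, t). \<theta>x x u t)"
    and \<theta>u_cont: "continuous_on (UNIV \<times> UNIV \<times> {0..T}) (\<lambda>(x, u, t). \<theta>u x u t)"
    and growth: "q = \<infinity> \<or>
      (growth_condition T (enn2real q) 1 \<theta> \<and> growth_condition T (enn2real q) 1 \<theta>x \<and>
       growth_condition T (enn2real q - 1) (conj_exponent q) \<theta>u)"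
    and solution: "\<exists>z. global_min_on \<Omega> \<I> z"
    and slater_eq: "(\<lambda>_. 0) \<in> relint (l2 - l1)
      (vec_J l1 l2 g ` {\<xi> \<in> reachable T A. \<forall>i\<in>{1..l1}. g i \<xi> \<le> 0})"
    and slater_ineq: "\<exists>(xh, uh)\<in>\<Omega>. \<forall>i\<in>{1..l1}. g i (xh T) < 0"
    and sublevel: "0 < lam0" "optimal_value \<Omega> \<I> < ereal c" "0 < \<delta>"
      "\<exists>M. \<forall>z \<in> S lam0 c \<inter> {z \<in> A. \<phi> z < \<delta>}. X_norm p q T z \<le> M"
    and bounded_below: "\<exists>m. \<forall>z\<in>A. m \<le> \<Phi> lam0 z"
  shows "\<exists>lam'\<ge>0. \<forall>lam\<ge>lam'. completely_exact (X_dist p q T) A \<Omega> \<I> (\<Phi> lam) (S lam c)"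
proof -
  have q1: "1 \<le> q" using exponents by (rule order_trans)
  note pqT = exponents(1) q1 T
  define e :: "(real \<Rightarrow> real ^ 'd) \<times> (real \<Rightarrow> real ^ 'm) \<Rightarrow> real ^ 'd" where "e z = fst z T" for z
  have A_X: "z \<in> X_diff p q T" if "z \<in> A" for z
    using trajectories_subset_X_diff[OF pqT] that unfolding A_def by blast
  have A_0: "fst z 0 = x0" if "z \<in> A" for z
    using that by (auto simp: A_def trajectories_def)
  have f_mix: "f ((1 - s) *\<^sub>R x + s *\<^sub>R x') ((1 - s) *\<^sub>R u + s *\<^sub>R u') t = (1 - s) *\<^sub>R f x u t + s *\<^sub>R f x' u' t"
    if "t \<in> {0..T}" for x u x' u' t s
    unfolding f_linear(1)[OF that]
    by (simp add: linear_add[OF matrix_vector_mul_linear] linear_scale[OF matrix_vector_mul_linear] scaleR_add_right)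
  interpret convex_pseudometric A "X_dist p q T" "\<lambda>s z y. lincomb (1 - s) z s y"
  proof
    show "lincomb (1 - s) x s y \<in> A" if "x \<in> A" "y \<in> A" "0 \<le> s" "s \<le> 1" for x y s
      using that unfolding A_def by (intro trajectories_lincomb[OF pqT] U f_mix)
  qed (intro A_X X_dist_nonneg[OF pqT] X_dist_self[OF pqT] X_dist_commute[OF pqT] X_dist_triangle[OF pqT]
      X_dist_lincomb_le[OF pqT]; assumption)+
  have e_mix: "e (lincomb (1 - s) x s y) = (1 - s) *\<^sub>R e x + s *\<^sub>R e y" for x y s
    by (simp add: e_def)
  have \<phi>_eq: "\<phi> = (\<lambda>z. (\<Sum>i\<in>{1..l1}. max (g i (e z)) 0) + (\<Sum>k\<in>{l1+1..l2}. \<bar>g k (e z)\<bar>))"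
    by (simp add: \<phi>_def violation_def e_def fun_eq_iff)
  have \<phi>_nonneg: "0 \<le> \<phi> z" for z
    unfolding \<phi>_eq by (intro add_nonneg_nonneg sum_nonneg) auto
  obtain zh where zh: "zh \<in> A" "\<phi> zh = 0" "\<And>i. i \<in> {1..l1} \<Longrightarrow> g i (e zh) < 0"
    using slater_ineq by (auto simp: \<Omega>_def e_def)
  have zh_J: "g k (e zh) = 0" if "k \<in> {l1+1..l2}" for k
  proof -
    have "0 \<le> (\<Sum>i\<in>{1..l1}. max (g i (e zh)) 0)" "0 \<le> (\<Sum>k\<in>{l1+1..l2}. \<bar>g k (e zh)\<bar>)"
      by (auto intro: sum_nonneg)
    with zh(2) have "(\<Sum>k\<in>{l1+1..l2}. \<bar>g k (e zh)\<bar>) = 0" unfolding \<phi>_eq by linarith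
    then have "\<forall>k\<in>{l1+1..l2}. \<bar>g k (e zh)\<bar> = 0"
      by (subst (asm) sum_nonneg_eq_0_iff) auto
    with that show ?thesis by auto
  qed
  have "reachable T A = e ` A" by (simp add: reachable_def e_def image_def)
  with slater_eq have rel: "(\<lambda>_. 0) \<in> relint (l2 - l1) (vec_J l1 l2 g ` {\<xi> \<in> e ` A. \<forall>i\<in>{1..l1}. g i \<xi> \<le> 0})"
    by simp
  have g_J_convex: "convex_on UNIV (\<lambda>\<xi>. \<bar>g k \<xi>\<bar>)" if k: "k \<in> {l1+1..l2}" for k
  proof -
    obtain a b where ab: "\<And>\<xi>. g k \<xi> = a \<bullet> \<xi> + b" using g_J[OF k] by blast
    show ?thesis
    proof (rule convex_onI)
      fix s x y assume s: "(0::real) < s" "s < 1"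
      have "a \<bullet> ((1 - s) *\<^sub>R x + s *\<^sub>R y) + b = (1 - s) * (a \<bullet> x + b) + s * (a \<bullet> y + b)"
        by (simp add: inner_add_right algebra_simps)
      also have "\<bar>\<dots>\<bar> \<le> (1 - s) * \<bar>a \<bullet> x + b\<bar> + s * \<bar>a \<bullet> y + b\<bar>"
        using s by (intro order_trans[OF abs_triangle_ineq]) (simp add: abs_mult)
      finally show "\<bar>g k ((1 - s) *\<^sub>R x + s *\<^sub>R y)\<bar> \<le> (1 - s) * \<bar>g k x\<bar> + s * \<bar>g k y\<bar>"
        by (simp add: ab)
    qed simp
  qed
  have g_I_convex: "convex_on UNIV (\<lambda>\<xi>. max (g i \<xi>) 0)" if i: "i \<in> {1..l1}" for i
  proof (rule convex_onI)
    fix s x y assume s: "(0::real) < s" "s < 1"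
    have "g i ((1 - s) *\<^sub>R x + s *\<^sub>R y) \<le> (1 - s) * g i x + s * g i y"
      using convex_onD[OF g_I[OF i], of s x y] s by simp
    also have "\<dots> \<le> (1 - s) * max (g i x) 0 + s * max (g i y) 0"
      using s by (intro add_mono mult_left_mono) auto
    finally show "max (g i ((1 - s) *\<^sub>R x + s *\<^sub>R y)) 0 \<le> (1 - s) * max (g i x) 0 + s * max (g i y) 0"
      using s by simp
  qed simp
  \<comment> \<open>The violation factors through the end point. A finite convex function on a
    Euclidean space is continuous, which together with the embedding makes \<open>\<phi>\<close>
    continuous in \<open>X_dist\<close>.\<close>
  define \<psi> where "\<psi> \<xi> = (\<Sum>i\<in>{1..l1}. max (g i \<xi>) 0) + (\<Sum>k\<in>{l1+1..l2}. \<bar>g k \<xi>\<bar>)" for \<xi>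
  have \<phi>_\<psi>: "\<phi> z = \<psi> (e z)" for z by (simp add: \<phi>_eq \<psi>_def)
  have \<psi>_convex: "convex_on UNIV \<psi>"
    unfolding \<psi>_def by (intro convex_on_add convex_on_sum_functions) (auto intro: g_I_convex g_J_convex)
  have \<phi>_mix: "\<phi> (lincomb (1 - s) x s y) \<le> (1 - s) * \<phi> x + s * \<phi> y" if "0 \<le> s" "s \<le> 1" for x y s
    unfolding \<phi>_\<psi> e_mix using convex_onD[OF \<psi>_convex that] by simp
  have \<phi>_cont: "\<exists>r>0. \<forall>y\<in>A. X_dist p q T y z < r \<longrightarrow> \<bar>\<phi> y - \<phi> z\<bar> < \<epsilon>" if z: "z \<in> A" and "0 < \<epsilon>" for z \<epsilon>
  proof -
    have "continuous_on UNIV \<psi>" using \<psi>_convex by (intro convex_on_continuous) auto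
    then obtain r where r: "0 < r" "\<And>\<xi>. dist \<xi> (e z) < r \<Longrightarrow> dist (\<psi> \<xi>) (\<psi> (e z)) < \<epsilon>"
      using \<open>0 < \<epsilon>\<close> unfolding continuous_on_iff by (metis UNIV_I)
    show ?thesis
    proof (intro exI[of _ "r / (T + 1)"] conjI ballI impI)
      fix y assume y: "y \<in> A" "X_dist p q T y z < r / (T + 1)"
      have "dist (e y) (e z) \<le> (T + 1) * X_dist p q T y z"
        using state_diff_le_X_dist[OF pqT A_X[OF y(1)] A_X[OF z], of T] A_0[OF y(1)] A_0[OF z] T
        by (simp add: e_def dist_norm)
      also have "\<dots> < r" using y(2) T by (simp add: pos_less_divide_eq mult.commute)
      finally show "\<bar>\<phi> y - \<phi> z\<bar> < \<epsilon>" using r(2)[of "e y"] by (simp add: \<phi>_\<psi> dist_real_def)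
    qed (use r T in simp)
  qed
  obtain M0 where M0: "\<And>z. z \<in> A \<Longrightarrow> \<Phi> lam0 z < c \<Longrightarrow> \<phi> z < \<delta> \<Longrightarrow> X_norm p q T z \<le> M0"
    using sublevel(4) by (auto simp: S_def)
  obtain m where m: "\<And>z. z \<in> A \<Longrightarrow> m \<le> \<Phi> lam0 z" using bounded_below by blast
  \<comment> \<open>The point \<open>zh\<close> serves as centre, so the norm bound
    \<open>M0\<close> becomes a distance bound. As \<open>M\<close> comes from \<open>lam0\<close>,
    the constants \<open>K\<close>, \<open>R\<close> and \<open>L\<close> can be fixed before
    \<open>lam\<close> is chosen.\<close>
  define M where "M = M0 + X_norm p q T zh"
  have "\<exists>K>0. \<exists>R. \<forall>z\<in>A. X_dist p q T z zh \<le> M + 1 \<longrightarrow>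
      (\<exists>w\<in>A. \<phi> w = 0 \<and> X_dist p q T w z \<le> K * \<phi> z \<and> X_dist p q T w zh \<le> R)"
    unfolding \<phi>_eq
  proof (rule slater_error_bound)
    show "\<exists>s>0. \<exists>w\<in>A. (\<forall>i\<in>{1..l1}. g i (e w) \<le> 0) \<and> (\<forall>k\<in>{l1+1..l2}. g k (e w) = - s * g k (e z))"
      if "z \<in> A" for z
      using zh that by (intro slater_reflect[OF e_mix g_I g_J _ _ zh_J rel]) auto
  qed (use e_mix g_I g_J zh zh_J in auto)
  then obtain K R0 where K: "0 < K" and error_bound: "\<And>z. z \<in> A \<Longrightarrow> X_dist p q T z zh \<le> M + 1 \<Longrightarrow>
      \<exists>w\<in>A. \<phi> w = 0 \<and> X_dist p q T w z \<le> K * \<phi> z \<and> X_dist p q T w zh \<le> R0"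
    by blast
  \<comment> \<open>The Lipschitz estimate has to hold on a ball that contains the bounded set
    enlarged by 1 as well as the feasible points given by the error bound.\<close>
  define R where "R = max R0 (M + 1)"
  obtain L where L: "0 \<le> L" and lip: "\<forall>z\<in>X_diff p q T. \<forall>y\<in>X_diff p q T. fst z 0 = fst zh 0 \<longrightarrow> fst y 0 = fst zh 0 \<longrightarrow>
      X_dist p q T z zh \<le> R \<longrightarrow> X_dist p q T y zh \<le> R \<longrightarrow>
      \<bar>cost T \<theta> \<zeta> z - cost T \<theta> \<zeta> y\<bar> \<le> L * X_dist p q T z y"
    using cost_lipschitz_on_bounded[OF q1 T \<theta>_cont \<theta>_grad_x \<theta>_grad_u \<theta>x_cont \<theta>u_cont growth
        exponents(1) \<zeta>_loc_lipschitz A_X[OF zh(1)], of R] by blast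
  obtain zs where zs: "global_min_on \<Omega> \<I> zs" using solution by blast
  have zs_c: "\<I> zs < c"
  proof -
    obtain y where "y \<in> \<Omega>" "ereal (\<I> y) < ereal c"
      using sublevel(2) unfolding optimal_value_def INF_less_iff by blast
    with zs show ?thesis by (force simp: global_min_on_def)
  qed
  \<comment> \<open>The second entry confines the sublevel set: if \<open>\<phi> z\<close> \<ge>
    \<delta>, then \<open>\<Phi> lam z\<close> \<ge> m + (lam - lam0) \<delta> \<ge> m + |c - m| + 1
    > c.\<close>
  define lam' where "lam' = max (L * K + K) (lam0 + (\<bar>c - m\<bar> + 1) / \<delta>)"
  have "0 \<le> L * K + K" using L K by simp
  then have "0 \<le> lam'" by (simp add: lam'_def)
  moreover have "completely_exact (X_dist p q T) A \<Omega> \<I> (\<Phi> lam) (S lam c)" if lam: "lam' \<le> lam" for lam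
  proof -
    have bounded: "X_dist p q T z zh \<le> M" if z: "z \<in> A" "\<I> z + lam * \<phi> z < c" for z
    proof -
      have lam0: "(\<bar>c - m\<bar> + 1) / \<delta> \<le> lam - lam0" using lam by (simp add: lam'_def)
      have "0 < (\<bar>c - m\<bar> + 1) / \<delta>" using sublevel(3) by simp
      with lam0 have pos: "0 \<le> lam - lam0" by linarith
      have split: "\<I> z + lam * \<phi> z = \<Phi> lam0 z + (lam - lam0) * \<phi> z"
        by (simp add: \<Phi>_def algebra_simps)
      have "0 \<le> (lam - lam0) * \<phi> z" using pos \<phi>_nonneg by simp
      with split z have "\<Phi> lam0 z < c" by linarith
      moreover have "\<phi> z < \<delta>"
      proof (rule ccontr)
        assume "\<not> \<phi> z < \<delta>"
        then have "(\<bar>c - m\<bar> + 1) / \<delta> * \<delta> \<le> (lam - lam0) * \<phi> z"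
          using lam0 pos sublevel(3) by (intro mult_mono) auto
        then have "\<bar>c - m\<bar> + 1 \<le> (lam - lam0) * \<phi> z" using sublevel(3) by simp
        with split z m[OF z(1)] show False by linarith
      qed
      ultimately have "X_norm p q T z \<le> M0" using z by (intro M0)
      then show ?thesis
        using X_dist_le[OF pqT A_X[OF z(1)] A_X[OF zh(1)]] by (simp add: M_def)
    qed
    have "completely_exact (X_dist p q T) A {z \<in> A. \<phi> z = 0} \<I> (\<lambda>z. \<I> z + lam * \<phi> z) {z \<in> A. \<I> z + lam * \<phi> z < c}"
    proof (rule completely_exactI)
      show "\<exists>w\<in>A. \<phi> w = 0 \<and> X_dist p q T w z \<le> K * \<phi> z \<and> X_dist p q T w zh \<le> R"
        if "z \<in> A" "X_dist p q T z zh \<le> M + 1" for z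
        using error_bound[OF that] by (fastforce simp: R_def)
      show "\<bar>\<I> x - \<I> y\<bar> \<le> L * X_dist p q T x y"
        if "x \<in> A" "y \<in> A" "X_dist p q T x zh \<le> R" "X_dist p q T y zh \<le> R" for x y
        using lip A_X[OF that(1)] A_X[OF that(2)] that A_0 zh(1) by (simp add: cost_def)
      show "L * K + K \<le> lam" using lam by (simp add: lam'_def)
      show "global_min_on {z \<in> A. \<phi> z = 0} \<I> zs" using zs by (simp add: \<Omega>_def)
    qed (use \<phi>_nonneg \<phi>_mix \<phi>_cont zh(1) bounded K L zs_c in \<open>auto simp: R_def\<close>)
    then show ?thesis by (simp add: \<Omega>_def \<Phi>_def S_def)
  qed
  ultimately show ?thesis by blast
qed

end
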